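(* Let $d$ be the degree and $r$ the rank of the kernel $\Phi$, and suppose that $\mathbf{E}\Phi = 0$, $\mathrm{Var}(\Phi) = 1$. Let $b \in (2, \infty)$, let $\psi \in \Psi(b)$, and suppose that $\Phi \in G\psi(b)$. Then $$ \sup_{n > d} \left\| \, U(n)/\sigma(n) \, \right\|_{G\psi_d} \le C(\psi) \, \|\Phi\|_{G\psi}, $$ where $C(\psi)$ is a finite constant depending on $\psi$ (for fixed $d$ and $r$), and $$ \psi_d(p) = \left[ \frac{p}{\ln p} \right]^d \cdot \psi(p). $$
   Context: Let $(\Omega, F, \mathbf{P})$ be a probability space, and let $\xi(1), \xi(2), \ldots$ be independent identically distributed random variables on it with values in a measurable space $(X,S)$. Let $\Phi : X^d \to \mathbb{R}$ be a symmetric measurable non-trivial function (the kernel) of $d$ variables; $d$ is called its degree. As a random variable, $\Phi$ denotes $\Phi(\xi(1), \ldots, \xi(d))$, so that $\mathbf{E}\Phi$, $\mathrm{Var}(\Phi)$ and norms of $\Phi$ refer to this random variable. For a random variable $\eta$ and $p \ge 1$, $|\eta|_p = \left[ \mathbf{E} |\eta|^p \right]^{1/p}$. For $n > d$ the $U$-statistic is $$ U(n) = \binom{n}{d}^{-1} \sum_{1 \le i_1 < i_2 < \cdots < i_d \le n} \Phi(\xi(i_1), \xi(i_2), \ldots, \xi(i_d)), $$ and $\sigma(n) = \sqrt{\mathrm{Var}(U(n))}$. The rank $r$ of $\Phi$ is defined through the Hoeffding (martingale) decomposition $U(n) - \mathbf{E}U(n) = \sum_{m=r}^d \binom{d}{m}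 U_{n,m}$, where $$ U_{n,m} = \binom{n}{m}^{-1} \sum_{1 \le i(1) < \cdots < i(m) \le n} g_m(\xi(i(1)), \ldots, \xi(i(m))), $$ $$ g_m(x(1),\ldots,x(m)) = \int_X \cdots \int_X \Phi(y(1),\ldots,y(d)) \prod_{s=1}^m \left( \delta_{x(s)}(dy(s)) - P(dy(s)) \right) \prod_{s=m+1}^d P(dy(s)), $$ $P$ being the distribution of $\xi(1)$ and $\delta_x$ the unit mass at $x$; $r$ is the smallest $m \ge 1$ for which $g_m(\xi(1),\ldots,\xi(m))$ is not almost surely zero. It is assumed that $r \in \{1, 2, \ldots, d-1\}$. Grand Lebesgue Spaces: $\Psi(b)$ denotes the set of all numerical functions $\psi = \psi(p)$ that are continuous on the semi-open interval $[2,b)$, satisfy $\inf_p \psi(p) > 1$, and for which $b = \sup\{p : \psi(p) < \infty\}$. For $\psi \in \Psi(b)$ the Banach space $G\psi = G\psi(b)$ consists of all real random variables $\zeta$ on $(\Omega, F, \mathbf{P})$ with finite norm $$ \|\zeta\|_{G\psi} = \sup_{p \in [2,b)} \frac{|\zeta|_p}{\psi(p)} . $$ If $\psi \in \Psi(b)$ then $\psi_d \in \Psi(b)$ as well, and $\|\cdot\|_{G\psi_d}$ is defined in the same way with $\psi_d$ in place of $\psi$.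
   Formalization: The constant depends on d, r, b, ψ and also on Var g_r(ξ(1),…,ξ(r)), the variance of the leading Hoeffding component (for given underlying sets Ω, X); a constant depending only on ψ, d, r, uniform over all kernels Φ, does not exist. *)

theory Defs
  imports "HOL-Probability.Probability" "HOL-Combinatorics.Permutations"
begin

section \<open>Kernels and U-statistics of an i.i.d. sequence\<close>

definition iid_seq :: "'a measure \<Rightarrow> 'x measure \<Rightarrow> (nat \<Rightarrow> 'a \<Rightarrow> 'x) \<Rightarrow> bool" where
  "iid_seq M S \<xi> \<longleftrightarrow>
     prob_space M \<and>
     prob_space.indep_vars M (\<lambda>_. S) \<xi> {1..} \<and>
     (\<forall>i\<ge>1. distr M S (\<xi> i) = distr M S (\<xi> 1))"

text \<open>Points of \<open>X^m\<close> are extensional functions on \<open>{1..m}\<close>, so that \<open>X^m\<close> is the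
  product space \<open>PiM {1..m} (\<lambda>_. S)\<close>. The entries \<open>\<xi> i\<close> with \<open>i = 0\<close> are never used.\<close>

definition sym_kernel :: "nat \<Rightarrow> 'x measure \<Rightarrow> ((nat \<Rightarrow> 'x) \<Rightarrow> real) \<Rightarrow> bool" where
  "sym_kernel d S \<Phi> \<longleftrightarrow>
     \<Phi> \<in> borel_measurable (PiM {1..d} (\<lambda>_. S)) \<and>
     (\<forall>x\<in>space (PiM {1..d} (\<lambda>_. S)). \<forall>\<pi>. \<pi> permutes {1..d} \<longrightarrow> \<Phi> (x \<circ> \<pi>) = \<Phi> x)"

definition at_sample ::
  "nat \<Rightarrow> ((nat \<Rightarrow> 'x) \<Rightarrow> real) \<Rightarrow> (nat \<Rightarrow> 'a \<Rightarrow> 'x) \<Rightarrow> (nat \<Rightarrow> nat) \<Rightarrow> 'a \<Rightarrow> real" where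
  "at_sample m f \<xi> i = (\<lambda>\<omega>. f (\<lambda>s\<in>{1..m}. \<xi> (i s) \<omega>))"

definition incr_tuples :: "nat \<Rightarrow> nat \<Rightarrow> (nat \<Rightarrow> nat) set" where
  "incr_tuples d n = {i \<in> {1..d} \<rightarrow>\<^sub>E {1..n}. strict_mono_on {1..d} i}"

definition U_stat ::
  "nat \<Rightarrow> ((nat \<Rightarrow> 'x) \<Rightarrow> real) \<Rightarrow> (nat \<Rightarrow> 'a \<Rightarrow> 'x) \<Rightarrow> nat \<Rightarrow> 'a \<Rightarrow> real" where
  "U_stat d \<Phi> \<xi> n =
     (\<lambda>\<omega>. (\<Sum>i\<in>incr_tuples d n. at_sample d \<Phi> \<xi> i \<omega>) / real (n choose d))"

definition sigma_U ::
  "'a measure \<Rightarrow> nat \<Rightarrow> ((nat \<Rightarrow> 'x) \<Rightarrow> real) \<Rightarrow> (nat \<Rightarrow> 'a \<Rightarrow> 'x) \<Rightarrow> nat \<Rightarrow> real" where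
  "sigma_U M d \<Phi> \<xi> n = sqrt (prob_space.variance M (U_stat d \<Phi> \<xi> n))"

section \<open>The Hoeffding components and the rank\<close>

text \<open>\<open>hoeffding_g d P \<Phi> m x\<close> is the integral of \<open>\<Phi>\<close> against the product over
  \<open>s \<in> {1..m}\<close> of the signed measures \<open>\<delta>_{x s} - P\<close>, times the product of \<open>P\<close> over
  \<open>s \<in> {m+1..d}\<close>. Since the library has no products of signed measures, the product is
  multiplied out; \<open>A\<close> is the set of factors contributing their point mass. The integrals
  exist for almost every \<open>x\<close> when \<open>\<Phi>\<close> is integrable, which is all that the rank
  depends on.\<close>

definition hoeffding_g ::
  "nat \<Rightarrow> 'x measure \<Rightarrow> ((nat \<Rightarrow> 'x) \<Rightarrow> real) \<Rightarrow> nat \<Rightarrow> (nat \<Rightarrow> 'x) \<Rightarrow> real" where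
  "hoeffding_g d P \<Phi> m x =
     (\<Sum>A\<in>Pow {1..m}. (-1) ^ (m - card A) *
        (\<integral>y. \<Phi> y \<partial>(PiM {1..d} (\<lambda>s. if s \<in> A then return P (x s) else P))))"

definition g_comp ::
  "'a measure \<Rightarrow> 'x measure \<Rightarrow> nat \<Rightarrow> ((nat \<Rightarrow> 'x) \<Rightarrow> real) \<Rightarrow> (nat \<Rightarrow> 'a \<Rightarrow> 'x) \<Rightarrow> nat \<Rightarrow> 'a \<Rightarrow> real"
where
  "g_comp M S d \<Phi> \<xi> m = at_sample m (hoeffding_g d (distr M S (\<xi> 1)) \<Phi> m) \<xi> (\<lambda>s. s)"

definition has_rank ::
  "'a measure \<Rightarrow> 'x measure \<Rightarrow> nat \<Rightarrow> ((nat \<Rightarrow> 'x) \<Rightarrow> real) \<Rightarrow> (nat \<Rightarrow> 'a \<Rightarrow> 'x) \<Rightarrow> nat \<Rightarrow> bool"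
where
  "has_rank M S d \<Phi> \<xi> r \<longleftrightarrow>
     1 \<le> r \<and> r \<le> d \<and>
     \<not> (AE \<omega> in M. g_comp M S d \<Phi> \<xi> r \<omega> = 0) \<and>
     (\<forall>m. 1 \<le> m \<and> m < r \<longrightarrow> (AE \<omega> in M. g_comp M S d \<Phi> \<xi> m \<omega> = 0))"

text \<open>The variance of the leading component, on which constants may depend:
  \<open>n^r * sigma_U(n)^2\<close> tends to \<open>r! * (d choose r)^2 * lead_var\<close> for a kernel of rank \<open>r\<close>.
  Bounds for \<open>U_stat / sigma_U\<close> that are uniform in \<open>n\<close> in terms of the moments of a kernel
  of unit variance degenerate as \<open>lead_var\<close> tends to \<open>0\<close>.\<close>

definition lead_var ::
  "'a measure \<Rightarrow> 'x measure \<Rightarrow> nat \<Rightarrow> ((nat \<Rightarrow> 'x) \<Rightarrow> real) \<Rightarrow> (nat \<Rightarrow> 'a \<Rightarrow> 'x) \<Rightarrow> nat \<Rightarrow> real"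
where
  "lead_var M S d \<Phi> \<xi> r = prob_space.variance M (g_comp M S d \<Phi> \<xi> r)"

section \<open>Grand Lebesgue spaces\<close>

text \<open>Moments and norms take values in \<open>ennreal\<close>: a missing moment is \<open>\<infinity>\<close>.\<close>

definition Lp_norm :: "'a measure \<Rightarrow> real \<Rightarrow> ('a \<Rightarrow> real) \<Rightarrow> ennreal" where
  "Lp_norm M p \<eta> =
     (let I = (\<integral>\<^sup>+\<omega>. ennreal (\<bar>\<eta> \<omega>\<bar> powr p) \<partial>M)
      in if I = \<infinity> then \<infinity> else ennreal (enn2real I powr (1 / p)))"

text \<open>A generating function lives on \<open>{2..}\<close> and is real-valued on \<open>{2..<b}\<close>; the last
  conjunct forces the value \<open>\<infinity>\<close> beyond \<open>b\<close>.\<close>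

definition Psi :: "real \<Rightarrow> (real \<Rightarrow> ennreal) set" where
  "Psi b = {\<psi>. (\<forall>p\<in>{2..<b}. \<psi> p < \<infinity>) \<and> continuous_on {2..<b} \<psi> \<and>
                (INF p\<in>{2..}. \<psi> p) > 1 \<and>
                (SUP p\<in>{p. 2 \<le> p \<and> \<psi> p < \<infinity>}. ereal p) = ereal b}"

definition GLS_norm :: "'a measure \<Rightarrow> real \<Rightarrow> (real \<Rightarrow> ennreal) \<Rightarrow> ('a \<Rightarrow> real) \<Rightarrow> ennreal" where
  "GLS_norm M b \<psi> \<zeta> = (SUP p\<in>{2..<b}. Lp_norm M p \<zeta> / \<psi> p)"

definition GLS :: "'a measure \<Rightarrow> real \<Rightarrow> (real \<Rightarrow> ennreal) \<Rightarrow> ('a \<Rightarrow> real) set" where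
  "GLS M b \<psi> = {\<zeta> \<in> borel_measurable M. GLS_norm M b \<psi> \<zeta> < \<infinity>}"

definition psi_pow :: "nat \<Rightarrow> (real \<Rightarrow> ennreal) \<Rightarrow> real \<Rightarrow> ennreal" where
  "psi_pow d \<psi> p = ennreal ((p / ln p) ^ d) * \<psi> p"

end

theory Submission
  imports Defs
begin

text \<open>
  Since \<open>b\<close> is finite, constants that stay bounded for \<open>p\<close> in \<open>[2, b)\<close> are harmless, and
  \<open>p / ln p \<ge> 1\<close>; hence it suffices to bound the \<open>L\<^sub>p\<close> norm of \<open>U(n) / \<sigma>(n)\<close> by a constant
  times that of the kernel. Write \<open>U(n)\<close> as the sum over index sets \<open>A\<close> of the Hoeffding
  components, weighted by \<open>(n - |A| choose d - |A|) / (n choose d)\<close>. A component vanishes when any one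
  of its coordinates is averaged out.

  If \<open>Y\<close> is orthogonal to \<open>sgn X |X|^(p-1)\<close>, a second order expansion of \<open>|X + Y|^p\<close> gives
  \<open>\<parallel>X + Y\<parallel>\<^sub>p\<^sup>2 \<le> \<parallel>X\<parallel>\<^sub>p\<^sup>2 + K \<parallel>Y\<parallel>\<^sub>p\<^sup>2\<close>. Splitting along one coordinate after another yields
  \<open>\<parallel>\<Sum> f\<^sub>A\<parallel>\<^sub>p\<^sup>2 \<le> \<Sum> K^|A| \<parallel>f\<^sub>A\<parallel>\<^sub>p\<^sup>2\<close>, so that \<open>\<parallel>U(n)\<parallel>\<^sub>p\<^sup>2\<close> is of order \<open>n^(-r)\<close>. By orthogonality \<open>\<sigma>(n)\<^sup>2\<close> is at
  least the contribution of the sets with \<open>r\<close> elements, which is at least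
  \<open>lead_var / (n choose r)\<close>.
\<close>

section \<open>Moments of sums with orthogonal increments\<close>

text \<open>\<open>\<sigma>(n)\<close> decays like \<open>n^(-r/2)\<close>, whereas the triangle
  inequality applied to the decomposition gives a bound that does not decay at all. For
  \<open>p = 2\<close> orthogonality supplies the missing cancellation. For larger \<open>p\<close>
  the substitute is that \<open>sgn X |X|^(p-1)\<close> is, up to the factor \<open>p\<close>, the
  derivative of \<open>|X|^p\<close>: if \<open>X\<close> ignores coordinate \<open>k\<close> and
  \<open>Y\<close> averages to \<open>0\<close> over it, the linear term of the expansion integrates
  to \<open>0\<close>, and the rest is of second order in \<open>Y\<close>. Moment bounds are
  carried as \<open>a powr (p / 2)\<close>, with \<open>a\<close> a bound for the squared norm,
  because it is the squared norms that add up. A set with \<open>m\<close> elements enters with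
  squared weight of order \<open>n^(-2m)\<close>, and there are about \<open>n^m\<close> such sets,
  so the smallest size present, the rank, decides the order. All integrals are taken over powers of
  the law \<open>P\<close>; degeneracy then comes down to swapping two coordinates of a product
  measure.\<close>

lemma power2_powr: "(x\<^sup>2) powr s = \<bar>x\<bar> powr (2 * s)" for x s :: real
  by (cases "x = 0") (auto simp: powr_powr[of _ 2, symmetric])

lemma exp_le_quadratic:
  fixes u :: real
  shows "exp u \<le> 1 + u + u\<^sup>2 * exp \<bar>u\<bar>"
proof -
  obtain t where t: "\<bar>t\<bar> \<le> \<bar>u\<bar>" "exp u = (\<Sum>m<2. (u ^ m) / fact m) + (exp t / fact 2) * u ^ 2"
    using Maclaurin_exp_le[of u 2] by blast
  have "exp t \<le> exp \<bar>u\<bar>" using t(1) by simp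
  then have "exp t / 2 * u\<^sup>2 \<le> exp \<bar>u\<bar> * u\<^sup>2"
    by (intro mult_right_mono) (use exp_gt_zero[of "\<bar>u\<bar>"] in linarith, simp)
  then show ?thesis using t(2) by (simp add: numeral_2_eq_2 algebra_simps)
qed

text \<open>The first summand pays for the second order remainder where
  \<open>|y| \<le> |x| / 2\<close>. The other two pay for \<open>|x + y|^p\<close> and for a
  negative linear term in the remaining case, where \<open>|x| \<le> 2 |y|\<close>.\<close>

definition smooth_const :: "real \<Rightarrow> real" where
  "smooth_const p = p\<^sup>2 * exp p + 3 powr p + p * 2 powr p"

lemma smooth_const_mono: "1 \<le> p \<Longrightarrow> p \<le> b \<Longrightarrow> smooth_const p \<le> smooth_const b"
  unfolding smooth_const_def
  by (intro add_mono mult_mono power_mono powr_mono) auto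

lemma smooth_const_ge_1: "0 \<le> p \<Longrightarrow> 1 \<le> smooth_const p"
proof -
  assume p: "0 \<le> p"
  have "(1::real) \<le> 3 powr p" using p by (simp add: ge_one_powr_ge_zero)
  moreover have "0 \<le> p\<^sup>2 * exp p" "0 \<le> p * 2 powr p" using p by auto
  ultimately show ?thesis unfolding smooth_const_def by linarith
qed

text \<open>For \<open>y\<close> small against \<open>x\<close>, factoring out \<open>|x|^p\<close>
  leaves \<open>(1 + t) powr p\<close> with \<open>t = y / x\<close>; otherwise every term is at
  most a multiple of \<open>|y|^p\<close>. The linear term is kept exactly because it is to be
  integrated away.\<close>

lemma powr_abs_add_le:
  fixes p x y :: real
  assumes p: "2 \<le> p"
  shows "\<bar>x + y\<bar> powr p \<le> \<bar>x\<bar> powr p + p * (sgn x * \<bar>x\<bar> powr (p - 1) * y)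
           + smooth_const p * (\<bar>x\<bar> powr (p - 2) * y\<^sup>2 + \<bar>y\<bar> powr p)"
proof (cases "\<bar>y\<bar> \<le> \<bar>x\<bar> / 2 \<and> x \<noteq> 0")
  case True
  define t where "t = y / x"
  have x: "x \<noteq> 0" and y: "y = t * x" using True by (auto simp: t_def)
  have t: "\<bar>t\<bar> \<le> 1 / 2" using True by (auto simp: t_def abs_divide field_simps)
  have t1: "0 < 1 + t" using t by linarith
  have "x + y = x * (1 + t)" by (simp add: y algebra_simps)
  then have "\<bar>x + y\<bar> = \<bar>x\<bar> * (1 + t)" using t1 by (simp add: abs_mult)
  then have 1: "\<bar>x + y\<bar> powr p = \<bar>x\<bar> powr p * (1 + t) powr p" using t1 by (simp add: powr_mult)
  have "ln (1 + t) \<le> t" using t1 ln_le_minus_one[of "1 + t"] by simp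
  then have "(1 + t) powr p \<le> exp (p * t)" using t1 p by (simp add: powr_def)
  also have "\<dots> \<le> 1 + p * t + (p * t)\<^sup>2 * exp \<bar>p * t\<bar>" by (rule exp_le_quadratic)
  also have "(p * t)\<^sup>2 * exp \<bar>p * t\<bar> \<le> (p * t)\<^sup>2 * exp p"
  proof (intro mult_left_mono)
    have "\<bar>p * t\<bar> \<le> p * 1" unfolding abs_mult using p t by (intro mult_mono) auto
    then show "exp \<bar>p * t\<bar> \<le> exp p" by simp
  qed simp
  also have "(p * t)\<^sup>2 * exp p \<le> smooth_const p * t\<^sup>2"
  proof -
    have "p\<^sup>2 * exp p \<le> smooth_const p" unfolding smooth_const_def using p by simp
    then show ?thesis using mult_right_mono[of "p\<^sup>2 * exp p" "smooth_const p" "t\<^sup>2"]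
      by (simp add: power_mult_distrib algebra_simps)
  qed
  finally have 2: "\<bar>x + y\<bar> powr p \<le> \<bar>x\<bar> powr p * (1 + p * t + smooth_const p * t\<^sup>2)"
    unfolding 1 by (intro mult_left_mono) auto
  have 3: "sgn x * \<bar>x\<bar> powr (p - 1) * y = \<bar>x\<bar> powr p * t"
  proof -
    have "sgn x * \<bar>x\<bar> powr (p - 1) * y = (\<bar>x\<bar> powr (p - 1) * \<bar>x\<bar>) * t"
      by (simp add: y abs_sgn[of x] algebra_simps)
    also have "\<bar>x\<bar> powr (p - 1) * \<bar>x\<bar> = \<bar>x\<bar> powr p" using x by (simp add: powr_diff)
    finally show ?thesis .
  qed
  have 4: "\<bar>x\<bar> powr (p - 2) * y\<^sup>2 = \<bar>x\<bar> powr p * t\<^sup>2"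
    using x by (simp add: y powr_diff power_mult_distrib)
  have "0 \<le> smooth_const p * \<bar>y\<bar> powr p" using smooth_const_ge_1[of p] p by simp
  with 2 show ?thesis unfolding 3 4 by (simp add: algebra_simps)
next
  case False
  then have xy: "\<bar>x\<bar> \<le> 2 * \<bar>y\<bar>" by auto
  have "\<bar>x + y\<bar> powr p \<le> (3 * \<bar>y\<bar>) powr p" using xy p by (intro powr_mono2) auto
  then have 1: "\<bar>x + y\<bar> powr p \<le> 3 powr p * \<bar>y\<bar> powr p" by (simp add: powr_mult)
  \<comment> \<open>The linear term may be negative here, so its absolute value has to be absorbed
    by \<open>p * 2 powr p\<close>.\<close>
  have "\<bar>sgn x * \<bar>x\<bar> powr (p - 1) * y\<bar> \<le> 1 * \<bar>x\<bar> powr (p - 1) * \<bar>y\<bar>"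
    unfolding abs_mult by (intro mult_right_mono) (auto simp: sgn_if)
  also have "\<dots> \<le> (2 * \<bar>y\<bar>) powr (p - 1) * \<bar>y\<bar>"
    using xy p by (intro mult_right_mono) (auto intro!: powr_mono2)
  also have "\<dots> = 2 powr (p - 1) * \<bar>y\<bar> powr p"
    by (cases "y = 0") (auto simp: powr_mult powr_diff)
  also have "\<dots> \<le> 2 powr p * \<bar>y\<bar> powr p" by (intro mult_right_mono powr_mono) auto
  finally have "p * \<bar>sgn x * \<bar>x\<bar> powr (p - 1) * y\<bar> \<le> p * (2 powr p * \<bar>y\<bar> powr p)"
    using p by (intro mult_left_mono) auto
  moreover have "- (p * (sgn x * \<bar>x\<bar> powr (p - 1) * y)) \<le> p * \<bar>sgn x * \<bar>x\<bar> powr (p - 1) * y\<bar>"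
    using p by (metis abs_ge_minus_self abs_mult abs_of_nonneg order.trans zero_le_numeral)
  ultimately have 2: "- (p * (sgn x * \<bar>x\<bar> powr (p - 1) * y)) \<le> p * (2 powr p * \<bar>y\<bar> powr p)" by linarith
  have s: "(3 powr p + p * 2 powr p) * \<bar>y\<bar> powr p \<le> smooth_const p * \<bar>y\<bar> powr p"
    unfolding smooth_const_def by (intro mult_right_mono) auto
  have 3: "0 \<le> smooth_const p * (\<bar>x\<bar> powr (p - 2) * y\<^sup>2)" "0 \<le> \<bar>x\<bar> powr p"
    using smooth_const_ge_1[of p] p by auto
  show ?thesis using 1 2 s 3 unfolding distrib_left distrib_right mult.assoc by linarith
qed

text \<open>With \<open>q = p / 2\<close> this turns a bound for moments into one for squared norms:
  \<open>a\<close> and \<open>c\<close> are both at most \<open>s = a + 2 * C * c\<close>, so a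
  factor \<open>s powr (q - 1)\<close> can be taken out of each term.\<close>

lemma powr_smooth_combine:
  fixes a c C q :: real
  assumes "1 \<le> q" "0 \<le> a" "0 \<le> c" "1 \<le> C"
  shows "a powr q + C * (a powr (q - 1) * c + c powr q) \<le> (a + 2 * C * c) powr q"
proof -
  have split: "u powr q = u * u powr (q - 1)" if "0 \<le> u" for u :: real
    using that by (cases "u = 0") (auto simp: powr_diff)
  define s where "s = a + 2 * C * c"
  have Cc: "c \<le> C * c" using assms mult_right_mono[of 1 C c] by simp
  have Cc0: "0 \<le> C * c" using assms by simp
  have s: "a \<le> s" "c \<le> s" "0 \<le> s" using assms Cc Cc0 by (auto simp: s_def)
  have "a powr q + C * (a powr (q - 1) * c + c powr q)
     = a * a powr (q - 1) + C * c * a powr (q - 1) + C * c * c powr (q - 1)"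
    using assms by (simp add: split algebra_simps)
  also have "\<dots> \<le> a * s powr (q - 1) + C * c * s powr (q - 1) + C * c * s powr (q - 1)"
    using assms s by (intro add_mono mult_left_mono powr_mono2) auto
  also have "\<dots> = s powr q" using s by (simp add: split[of s]) (simp add: s_def algebra_simps)
  finally show ?thesis by (simp add: s_def)
qed

text \<open>Young's inequality with conjugate exponents \<open>p / (p - 1)\<close> and
  \<open>p\<close>, in a form that includes \<open>p = 1\<close>. Integrated, it yields both
  Hoelder's and Jensen's inequality below.\<close>

lemma powr_young:
  fixes u v p :: real
  assumes "1 \<le> p" "0 \<le> u" "0 \<le> v"
  shows "u powr (p - 1) * v \<le> (1 - 1 / p) * u powr p + v powr p / p"
proof (cases "u = 0 \<or> v = 0 \<or> p = 1")
  case True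
  then show ?thesis using assms by auto
next
  case False
  then have "(u powr p) powr (1 - 1 / p) * (v powr p) powr (1 / p)
      \<le> (1 - 1 / p) * u powr p + 1 / p * v powr p"
    using assms by (intro Youngs_inequality_0) auto
  moreover have "p * (1 - 1 / p) = p - 1" "p * (1 / p) = 1" using assms by (auto simp: field_simps)
  ultimately show ?thesis using assms False by (simp add: powr_powr)
qed

text \<open>Replacing both bases by the larger one suffices, since this only serves to dominate
  mixed products by integrable functions.\<close>

lemma powr_mult_le_add:
  fixes u v p r :: real
  assumes "0 \<le> r" "r \<le> p" "0 \<le> u" "0 \<le> v" 
  shows "u powr (p - r) * v powr r \<le> u powr p + v powr p"
proof (cases "u = 0 \<or> v = 0")
  case True
  then show ?thesis using assms by auto
next
  case False
  define w where "w = max u v"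
  have w: "0 < w" "u \<le> w" "v \<le> w" using False assms by (auto simp: w_def)
  have "u powr (p - r) * v powr r \<le> w powr (p - r) * w powr r"
    using assms w by (intro mult_mono powr_mono2) auto
  also have "\<dots> = w powr p" using w by (simp flip: powr_add)
  also have "\<dots> \<le> u powr p + v powr p" by (simp add: w_def max_def)
  finally show ?thesis .
qed

text \<open>The crude bound by the number of terms times the largest one is enough: it is applied
  where that number is controlled by \<open>d\<close> or where only integrability is wanted.\<close>

lemma powr_abs_sum_le:
  fixes f :: "'i \<Rightarrow> real"
  assumes "finite J" "0 < p"
  shows "\<bar>\<Sum>i\<in>J. f i\<bar> powr p \<le> real (card J) powr p * (\<Sum>i\<in>J. \<bar>f i\<bar> powr p)"
proof (cases "J = {}")
  case False
  define m where "m = Max ((\<lambda>i. \<bar>f i\<bar>) ` J)"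
  obtain j where j: "j \<in> J" "m = \<bar>f j\<bar>"
    using Max_in[of "(\<lambda>i. \<bar>f i\<bar>) ` J"] False assms(1)
    unfolding m_def[symmetric] by auto
  have "\<bar>\<Sum>i\<in>J. f i\<bar> \<le> (\<Sum>i\<in>J. \<bar>f i\<bar>)" by (rule sum_abs)
  also have "\<dots> \<le> real (card J) * m"
    using assms(1) by (intro sum_bounded_above) (auto simp: m_def)
  finally have "\<bar>\<Sum>i\<in>J. f i\<bar> powr p \<le> (real (card J) * m) powr p"
    using assms by (intro powr_mono2) auto
  also have "\<dots> = real (card J) powr p * \<bar>f j\<bar> powr p" using j by (simp add: powr_mult)
  also have "\<dots> \<le> real (card J) powr p * (\<Sum>i\<in>J. \<bar>f i\<bar> powr p)"
    using j assms by (intro mult_left_mono member_le_sum) auto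
  finally show ?thesis .
qed simp

section \<open>Hoelder's inequality and the moments of \<open>X + Y\<close>\<close>

lemma integrable_powr_cross:
  fixes X Y :: "'a \<Rightarrow> real"
  assumes [measurable]: "X \<in> borel_measurable M" "Y \<in> borel_measurable M"
    and "integrable M (\<lambda>\<omega>. \<bar>X \<omega>\<bar> powr p)" "integrable M (\<lambda>\<omega>. \<bar>Y \<omega>\<bar> powr p)"
    and "0 \<le> s" "s \<le> p"
  shows "integrable M (\<lambda>\<omega>. \<bar>X \<omega>\<bar> powr (p - s) * \<bar>Y \<omega>\<bar> powr s)"
  by (rule Bochner_Integration.integrable_bound[of M "\<lambda>\<omega>. \<bar>X \<omega>\<bar> powr p + \<bar>Y \<omega>\<bar> powr p"])
     (use assms(3-) in \<open>auto intro!: AE_I2 powr_mult_le_add simp: abs_mult\<close>)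

lemma integrable_powr_cross1:
  fixes X Y :: "'a \<Rightarrow> real"
  assumes [measurable]: "X \<in> borel_measurable M" "Y \<in> borel_measurable M"
    and "integrable M (\<lambda>\<omega>. \<bar>X \<omega>\<bar> powr p)" "integrable M (\<lambda>\<omega>. \<bar>Y \<omega>\<bar> powr p)" "1 \<le> p"
  shows "integrable M (\<lambda>\<omega>. sgn (X \<omega>) * \<bar>X \<omega>\<bar> powr (p - 1) * Y \<omega>)"
proof (rule Bochner_Integration.integrable_bound[OF integrable_powr_cross[OF assms(1-4), of 1]])
  show "AE \<omega> in M. norm (sgn (X \<omega>) * \<bar>X \<omega>\<bar> powr (p - 1) * Y \<omega>)
      \<le> norm (\<bar>X \<omega>\<bar> powr (p - 1) * \<bar>Y \<omega>\<bar> powr 1)"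
    by (rule AE_I2) (auto simp: abs_mult sgn_if)
qed (use assms(5) in auto)

lemma AE_eq_0_if_integral_powr_le_0:
  fixes X :: "'a \<Rightarrow> real"
  assumes "integrable M (\<lambda>\<omega>. \<bar>X \<omega>\<bar> powr p)" "(\<integral>\<omega>. \<bar>X \<omega>\<bar> powr p \<partial>M) \<le> 0"
  shows "AE \<omega> in M. X \<omega> = 0"
proof -
  have "(\<integral>\<omega>. \<bar>X \<omega>\<bar> powr p \<partial>M) = 0"
    using assms(2) by (intro antisym) auto
  then have "AE \<omega> in M. \<bar>X \<omega>\<bar> powr p = 0"
    using assms(1) by (subst integral_nonneg_eq_0_iff_AE[symmetric]) auto
  then show ?thesis by auto
qed

text \<open>Hoelder's inequality with exponents \<open>p / (p - 2)\<close> and \<open>p / 2\<close>,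
  obtained from Young's inequality for the normalised \<open>X^2 / a\<close> and
  \<open>Y^2 / c\<close>; this also covers \<open>p = 2\<close>.\<close>

lemma integral_powr_mult_square_le:
  fixes X Y :: "'a \<Rightarrow> real"
  assumes p: "2 \<le> p"
    and [measurable]: "X \<in> borel_measurable M" "Y \<in> borel_measurable M"
    and iX: "integrable M (\<lambda>\<omega>. \<bar>X \<omega>\<bar> powr p)" and iY: "integrable M (\<lambda>\<omega>. \<bar>Y \<omega>\<bar> powr p)"
    and X: "(\<integral>\<omega>. \<bar>X \<omega>\<bar> powr p \<partial>M) \<le> a powr (p / 2)"
    and Y: "(\<integral>\<omega>. \<bar>Y \<omega>\<bar> powr p \<partial>M) \<le> c powr (p / 2)"
    and ac: "0 \<le> a" "0 \<le> c"
  shows "(\<integral>\<omega>. \<bar>X \<omega>\<bar> powr (p - 2) * (Y \<omega>)\<^sup>2 \<partial>M) \<le> a powr (p / 2 - 1) * c"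
proof (cases "a = 0 \<or> c = 0")
  case True
  then have "(AE \<omega> in M. X \<omega> = 0) \<or> (AE \<omega> in M. Y \<omega> = 0)"
    using AE_eq_0_if_integral_powr_le_0[OF iX] AE_eq_0_if_integral_powr_le_0[OF iY] X Y p by auto
  \<comment> \<open>At \<open>p = 2\<close> this relies on \<open>0 powr 0 = 0\<close>.\<close>
  then have "AE \<omega> in M. \<bar>X \<omega>\<bar> powr (p - 2) * (Y \<omega>)\<^sup>2 = 0" by auto
  then have "(\<integral>\<omega>. \<bar>X \<omega>\<bar> powr (p - 2) * (Y \<omega>)\<^sup>2 \<partial>M) = 0"
    by (rule integral_eq_zero_AE)
  then show ?thesis using ac by simp
next
  case False
  then have ac: "0 < a" "0 < c" using ac by auto
  define q where "q = p / 2"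
  have q: "1 \<le> q" using p by (simp add: q_def)
  have pw: "\<bar>X \<omega>\<bar> powr (p - 2) * (Y \<omega>)\<^sup>2 \<le> a powr (q - 1) * c *
     ((1 - 1 / q) * (\<bar>X \<omega>\<bar> powr p / a powr q) + (1 / q) * (\<bar>Y \<omega>\<bar> powr p / c powr q))" for \<omega>
  proof -
    have "((X \<omega>)\<^sup>2 / a) powr (q - 1) * ((Y \<omega>)\<^sup>2 / c)
        \<le> (1 - 1 / q) * ((X \<omega>)\<^sup>2 / a) powr q + ((Y \<omega>)\<^sup>2 / c) powr q / q"
      using q ac by (intro powr_young) auto
    also have "((X \<omega>)\<^sup>2 / a) powr (q - 1) = \<bar>X \<omega>\<bar> powr (p - 2) / a powr (q - 1)"
      using ac by (simp add: powr_divide power2_powr q_def algebra_simps)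
    also have "((X \<omega>)\<^sup>2 / a) powr q = \<bar>X \<omega>\<bar> powr p / a powr q"
      using ac by (simp add: powr_divide power2_powr q_def)
    also have "((Y \<omega>)\<^sup>2 / c) powr q = \<bar>Y \<omega>\<bar> powr p / c powr q"
      using ac by (simp add: powr_divide power2_powr q_def)
    finally have *: "\<bar>X \<omega>\<bar> powr (p - 2) / a powr (q - 1) * ((Y \<omega>)\<^sup>2 / c) \<le>
      (1 - 1 / q) * (\<bar>X \<omega>\<bar> powr p / a powr q) + (1 / q) * (\<bar>Y \<omega>\<bar> powr p / c powr q)"
      by (simp only: times_divide_eq_left mult_1_left)
    have "0 \<le> a powr (q - 1) * c" using ac by simp
    from mult_left_mono[OF * this]
    have "a powr (q - 1) * c * (\<bar>X \<omega>\<bar> powr (p - 2) / a powr (q - 1) * ((Y \<omega>)\<^sup>2 / c))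
      \<le> a powr (q - 1) * c *
     ((1 - 1 / q) * (\<bar>X \<omega>\<bar> powr p / a powr q) + (1 / q) * (\<bar>Y \<omega>\<bar> powr p / c powr q))"
      .
    moreover have "a powr (q - 1) * c * (\<bar>X \<omega>\<bar> powr (p - 2) / a powr (q - 1) * ((Y \<omega>)\<^sup>2 / c))
        = \<bar>X \<omega>\<bar> powr (p - 2) * (Y \<omega>)\<^sup>2"
      using ac by simp
    ultimately show ?thesis by simp
  qed
  have "(\<integral>\<omega>. \<bar>X \<omega>\<bar> powr (p - 2) * (Y \<omega>)\<^sup>2 \<partial>M) \<le> (\<integral>\<omega>. a powr (q - 1) * c *
     ((1 - 1 / q) * (\<bar>X \<omega>\<bar> powr p / a powr q) + (1 / q) * (\<bar>Y \<omega>\<bar> powr p / c powr q)) \<partial>M)"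
  proof (rule integral_mono)
    have "integrable M (\<lambda>\<omega>. \<bar>X \<omega>\<bar> powr (p - 2) * \<bar>Y \<omega>\<bar> powr 2)"
      using p by (intro integrable_powr_cross iX iY) auto
    then show "integrable M (\<lambda>\<omega>. \<bar>X \<omega>\<bar> powr (p - 2) * (Y \<omega>)\<^sup>2)" by simp
  qed (use iX iY pw in auto)
  also have "\<dots> = a powr (q - 1) * c * ((1 - 1 / q) * ((\<integral>\<omega>. \<bar>X \<omega>\<bar> powr p \<partial>M) / a powr q)
      + (1 / q) * ((\<integral>\<omega>. \<bar>Y \<omega>\<bar> powr p \<partial>M) / c powr q))"
    using iX iY by simp
  \<comment> \<open>The weights \<open>1 - 1 / q\<close> and \<open>1 / q\<close> add up to
    \<open>1\<close>, so only the prefactor survives.\<close>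
  also have "\<dots> \<le> a powr (q - 1) * c * ((1 - 1 / q) * 1 + (1 / q) * 1)"
    using X Y ac q by (intro mult_left_mono add_mono) (auto simp: q_def)
  finally show ?thesis by (simp add: q_def)
qed

text \<open>In the integrated expansion \<open>orth\<close> removes the first order term and
  Hoelder's inequality controls the quadratic one. It matters that \<open>a\<close> keeps the factor
  \<open>1\<close>: only the degenerate part pays, so repeated splitting does not accumulate factors
  with the number of sets.\<close>

lemma moment_add_le:
  fixes X Y :: "'a \<Rightarrow> real"
  assumes p: "2 \<le> p"
    and [measurable]: "X \<in> borel_measurable M" "Y \<in> borel_measurable M"
    and iX: "integrable M (\<lambda>\<omega>. \<bar>X \<omega>\<bar> powr p)" and iY: "integrable M (\<lambda>\<omega>. \<bar>Y \<omega>\<bar> powr p)"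
    and X: "(\<integral>\<omega>. \<bar>X \<omega>\<bar> powr p \<partial>M) \<le> a powr (p / 2)"
    and Y: "(\<integral>\<omega>. \<bar>Y \<omega>\<bar> powr p \<partial>M) \<le> c powr (p / 2)"
    and ac: "0 \<le> a" "0 \<le> c"
    and orth: "(\<integral>\<omega>. sgn (X \<omega>) * \<bar>X \<omega>\<bar> powr (p - 1) * Y \<omega> \<partial>M) = 0"
  shows "integrable M (\<lambda>\<omega>. \<bar>X \<omega> + Y \<omega>\<bar> powr p)"
    and "(\<integral>\<omega>. \<bar>X \<omega> + Y \<omega>\<bar> powr p \<partial>M) \<le> (a + 2 * smooth_const p * c) powr (p / 2)"
proof -
  let ?C = "smooth_const p"
  let ?R = "\<lambda>\<omega>. \<bar>X \<omega>\<bar> powr p + p * (sgn (X \<omega>) * \<bar>X \<omega>\<bar> powr (p - 1) * Y \<omega>)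
           + ?C * (\<bar>X \<omega>\<bar> powr (p - 2) * (Y \<omega>)\<^sup>2 + \<bar>Y \<omega>\<bar> powr p)"
  have C: "1 \<le> ?C" using smooth_const_ge_1 p by simp
  have "integrable M (\<lambda>\<omega>. \<bar>X \<omega>\<bar> powr (p - 2) * \<bar>Y \<omega>\<bar> powr 2)"
    using p by (intro integrable_powr_cross iX iY) auto
  then have i2: "integrable M (\<lambda>\<omega>. \<bar>X \<omega>\<bar> powr (p - 2) * (Y \<omega>)\<^sup>2)" by simp
  have i1: "integrable M (\<lambda>\<omega>. sgn (X \<omega>) * \<bar>X \<omega>\<bar> powr (p - 1) * Y \<omega>)"
    using p by (intro integrable_powr_cross1 iX iY) auto
  have lin: "integrable M (\<lambda>\<omega>. u1 \<omega> + s * u2 \<omega> + t * (u3 \<omega> + u4 \<omega>))"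
      "(\<integral>\<omega>. u1 \<omega> + s * u2 \<omega> + t * (u3 \<omega> + u4 \<omega>) \<partial>M)
        = integral\<^sup>L M u1 + s * integral\<^sup>L M u2 + t * (integral\<^sup>L M u3 + integral\<^sup>L M u4)"
    if "integrable M u1" "integrable M u2" "integrable M u3" "integrable M u4"
    for u1 u2 u3 u4 :: "'a \<Rightarrow> real" and s t
    using that by simp_all
  have iR: "integrable M ?R" by (rule lin(1)[OF iX i1 i2 iY])
  have le: "\<bar>X \<omega> + Y \<omega>\<bar> powr p \<le> ?R \<omega>" for \<omega> using powr_abs_add_le[OF p] .
  show i: "integrable M (\<lambda>\<omega>. \<bar>X \<omega> + Y \<omega>\<bar> powr p)"
  proof (rule Bochner_Integration.integrable_bound[OF iR])
    show "AE \<omega> in M. norm (\<bar>X \<omega> + Y \<omega>\<bar> powr p) \<le> norm (?R \<omega>)"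
    proof (rule AE_I2)
      fix \<omega>
      show "norm (\<bar>X \<omega> + Y \<omega>\<bar> powr p) \<le> norm (?R \<omega>)"
        unfolding real_norm_def abs_of_nonneg[OF powr_ge_zero]
        by (rule order_trans[OF le abs_ge_self])
    qed
  qed measurable
  have "(\<integral>\<omega>. \<bar>X \<omega> + Y \<omega>\<bar> powr p \<partial>M) \<le> (\<integral>\<omega>. ?R \<omega> \<partial>M)"
    by (intro integral_mono i iR le)
  also have "\<dots> = (\<integral>\<omega>. \<bar>X \<omega>\<bar> powr p \<partial>M)
      + ?C * ((\<integral>\<omega>. \<bar>X \<omega>\<bar> powr (p - 2) * (Y \<omega>)\<^sup>2 \<partial>M) + (\<integral>\<omega>. \<bar>Y \<omega>\<bar> powr p \<partial>M))"
    unfolding lin(2)[OF iX i1 i2 iY] orth by simp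
  also have "\<dots> \<le> a powr (p / 2) + ?C * (a powr (p / 2 - 1) * c + c powr (p / 2))"
    using C integral_powr_mult_square_le[OF assms(1-9)] X Y
    by (intro add_mono mult_left_mono) auto
  also have "\<dots> \<le> (a + 2 * ?C * c) powr (p / 2)"
    using p ac C by (intro powr_smooth_combine) auto
  finally show "(\<integral>\<omega>. \<bar>X \<omega> + Y \<omega>\<bar> powr p \<partial>M) \<le> (a + 2 * ?C * c) powr (p / 2)" .
qed

text \<open>Splitting the family by membership of one coordinate \<open>k\<close> writes the sum as \<open>X + Y\<close> with \<open>X\<close>
  free of \<open>k\<close> and \<open>Y\<close> degenerate in \<open>k\<close>; each split costs one factor, so a set \<open>A\<close> pays once per
  element. The set \<open>D\<close> collects the coordinates already used by the recursion.\<close>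

lemma moment_sum_le:
  fixes f :: "'i set \<Rightarrow> 'a \<Rightarrow> real"
  assumes p: "2 \<le> p"
    and fin: "finite \<A>"
    and finA: "\<And>A. A \<in> \<A> \<Longrightarrow> finite A"
    and meas: "\<And>A. A \<in> \<A> \<Longrightarrow> f A \<in> borel_measurable M"
    and int: "\<And>A. A \<in> \<A> \<Longrightarrow> integrable M (\<lambda>\<omega>. \<bar>f A \<omega>\<bar> powr p)"
    and bnd: "\<And>A. A \<in> \<A> \<Longrightarrow> (\<integral>\<omega>. \<bar>f A \<omega>\<bar> powr p \<partial>M) \<le> c A powr (p / 2)"
    and c0: "\<And>A. A \<in> \<A> \<Longrightarrow> 0 \<le> c A"
    and orth: "\<And>A k \<X>. A \<in> \<A> \<Longrightarrow> k \<in> A \<Longrightarrow> \<X> \<subseteq> {B \<in> \<A>. k \<notin> B} \<Longrightarrow>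
        (\<integral>\<omega>. sgn (\<Sum>B\<in>\<X>. f B \<omega>) * \<bar>\<Sum>B\<in>\<X>. f B \<omega>\<bar> powr (p - 1) * f A \<omega> \<partial>M) = 0"
    and D: "\<And>A. A \<in> \<A> \<Longrightarrow> D \<subseteq> A"
  shows "integrable M (\<lambda>\<omega>. \<bar>\<Sum>A\<in>\<A>. f A \<omega>\<bar> powr p) \<and>
    (\<integral>\<omega>. \<bar>\<Sum>A\<in>\<A>. f A \<omega>\<bar> powr p \<partial>M)
      \<le> (\<Sum>A\<in>\<A>. (2 * smooth_const p) ^ card (A - D) * c A) powr (p / 2)"
  using fin finA meas int bnd c0 orth D
proof (induction "card \<A>" arbitrary: \<A> D rule: less_induct)
  case less
  let ?K = "2 * smooth_const p"
  have K: "1 \<le> ?K" using smooth_const_ge_1[of p] p by simp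
  show ?case
  proof (cases "\<exists>A\<in>\<A>. \<exists>B\<in>\<A>. A \<noteq> B")
    case False
    then have "\<A> = {} \<or> (\<exists>A. \<A> = {A})" by blast
    then show ?thesis
    proof
      assume "\<exists>A. \<A> = {A}"
      then obtain A where A: "\<A> = {A}" by auto
      have "1 * c A \<le> ?K ^ card (A - D) * c A"
        using K less.prems(6)[of A] A by (intro mult_right_mono one_le_power) auto
      then have "c A powr (p / 2) \<le> (?K ^ card (A - D) * c A) powr (p / 2)"
        using p less.prems(6)[of A] A by (intro powr_mono2) auto
      then have "(\<integral>\<omega>. \<bar>f A \<omega>\<bar> powr p \<partial>M) \<le> (?K ^ card (A - D) * c A) powr (p / 2)"
        using less.prems(5)[of A] A by (auto intro: order_trans)
      with less.prems(4)[of A] show ?thesis by (simp add: A)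
    qed auto
  next
    case True
    then obtain A B where "A \<in> \<A>" "B \<in> \<A>" "A \<noteq> B" by blast
    \<comment> \<open>Two different sets are told apart by some coordinate \<open>k\<close>, so both
      halves of the family are nonempty and hence strictly smaller than \<open>\<A>\<close>.\<close>
    then obtain k A1 A0 where k: "A1 \<in> \<A>" "A0 \<in> \<A>" "k \<in> A1" "k \<notin> A0" by blast
    define \<A>0 where "\<A>0 = {A \<in> \<A>. k \<notin> A}"
    define \<A>1 where "\<A>1 = {A \<in> \<A>. k \<in> A}"
    have sub: "\<A>0 \<subset> \<A>" "\<A>1 \<subset> \<A>" using k by (auto simp: \<A>0_def \<A>1_def)
    have un: "\<A> = \<A>0 \<union> \<A>1" "\<A>0 \<inter> \<A>1 = {}" by (auto simp: \<A>0_def \<A>1_def)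
    have fin01: "finite \<A>0" "finite \<A>1" using less.prems(1) sub by (auto intro: finite_subset)
    have kD: "k \<notin> D" using k less.prems(8)[of A0] by auto
    have lt: "card \<A>0 < card \<A>" "card \<A>1 < card \<A>"
      using less.prems(1) sub by (auto intro: psubset_card_mono)
    have in01: "A \<in> \<A>0 \<Longrightarrow> A \<in> \<A>" "A \<in> \<A>1 \<Longrightarrow> A \<in> \<A>" for A using sub by auto
    have IH0: "integrable M (\<lambda>\<omega>. \<bar>\<Sum>A\<in>\<A>0. f A \<omega>\<bar> powr p) \<and>
        (\<integral>\<omega>. \<bar>\<Sum>A\<in>\<A>0. f A \<omega>\<bar> powr p \<partial>M) \<le> (\<Sum>A\<in>\<A>0. ?K ^ card (A - D) * c A) powr (p / 2)"
    proof (rule less.hyps[OF lt(1) fin01(1)])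
      fix A l \<X> assume "A \<in> \<A>0" "l \<in> A" "\<X> \<subseteq> {B \<in> \<A>0. l \<notin> B}"
      then show "(\<integral>\<omega>. sgn (\<Sum>B\<in>\<X>. f B \<omega>) * \<bar>\<Sum>B\<in>\<X>. f B \<omega>\<bar> powr (p - 1) * f A \<omega> \<partial>M) = 0"
        using sub by (intro less.prems(7)[of A l]) auto
    qed (rule less.prems(2)[OF in01(1)] less.prems(3)[OF in01(1)] less.prems(4)[OF in01(1)] less.prems(5)[OF in01(1)] less.prems(6)[OF in01(1)] less.prems(8)[OF in01(1)], assumption)+
    \<comment> \<open>All sets of \<open>\<A>1\<close> contain \<open>k\<close>, so \<open>k\<close>
      joins \<open>D\<close> and costs nothing inside the recursion; the factor owed for it is the
      one charged when the halves are joined.\<close>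
    have IH1: "integrable M (\<lambda>\<omega>. \<bar>\<Sum>A\<in>\<A>1. f A \<omega>\<bar> powr p) \<and>
        (\<integral>\<omega>. \<bar>\<Sum>A\<in>\<A>1. f A \<omega>\<bar> powr p \<partial>M)
          \<le> (\<Sum>A\<in>\<A>1. ?K ^ card (A - insert k D) * c A) powr (p / 2)"
    proof (rule less.hyps[OF lt(2) fin01(2)])
      fix A l \<X> assume "A \<in> \<A>1" "l \<in> A" "\<X> \<subseteq> {B \<in> \<A>1. l \<notin> B}"
      then show "(\<integral>\<omega>. sgn (\<Sum>B\<in>\<X>. f B \<omega>) * \<bar>\<Sum>B\<in>\<X>. f B \<omega>\<bar> powr (p - 1) * f A \<omega> \<partial>M) = 0"
        using sub by (intro less.prems(7)[of A l]) auto
    next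
      fix A assume "A \<in> \<A>1" then show "insert k D \<subseteq> A" using less.prems(8) by (auto simp: \<A>1_def)
    qed (rule less.prems(2)[OF in01(2)] less.prems(3)[OF in01(2)] less.prems(4)[OF in01(2)] less.prems(5)[OF in01(2)] less.prems(6)[OF in01(2)], assumption)+
    let ?X = "\<lambda>\<omega>. \<Sum>A\<in>\<A>0. f A \<omega>" and ?Y = "\<lambda>\<omega>. \<Sum>A\<in>\<A>1. f A \<omega>"
    have m: "?X \<in> borel_measurable M" "?Y \<in> borel_measurable M"
      using less.prems(3) sub by (auto intro!: borel_measurable_sum)
    have "(\<integral>\<omega>. sgn (?X \<omega>) * \<bar>?X \<omega>\<bar> powr (p - 1) * ?Y \<omega> \<partial>M)
        = (\<Sum>A\<in>\<A>1. \<integral>\<omega>. sgn (?X \<omega>) * \<bar>?X \<omega>\<bar> powr (p - 1) * f A \<omega> \<partial>M)"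
      unfolding sum_distrib_left
      by (intro Bochner_Integration.integral_sum integrable_powr_cross1)
         (use IH0 less.prems(3,4) m sub p in auto)
    also have "\<dots> = 0"
      using sub by (intro sum.neutral ballI less.prems(7)[where k = k]) (auto simp: \<A>0_def \<A>1_def)
    finally have o: "(\<integral>\<omega>. sgn (?X \<omega>) * \<bar>?X \<omega>\<bar> powr (p - 1) * ?Y \<omega> \<partial>M) = 0" .
    have nn: "0 \<le> (\<Sum>A\<in>\<A>0. ?K ^ card (A - D) * c A)"
        "0 \<le> (\<Sum>A\<in>\<A>1. ?K ^ card (A - insert k D) * c A)"
      using K less.prems(6) sub by (auto intro!: sum_nonneg mult_nonneg_nonneg)
    have "?K * (\<Sum>A\<in>\<A>1. ?K ^ card (A - insert k D) * c A) = (\<Sum>A\<in>\<A>1. ?K ^ card (A - D) * c A)"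
      unfolding sum_distrib_left
    proof (rule sum.cong[OF refl])
      fix A assume A: "A \<in> \<A>1"
      then have "A - D = insert k (A - insert k D)" using kD by (auto simp: \<A>1_def)
      moreover have "finite A" using A less.prems(2) sub by auto
      ultimately have "card (A - D) = Suc (card (A - insert k D))"
        by (metis DiffD2 card_insert_disjoint finite_Diff insertI1)
      then show "?K * (?K ^ card (A - insert k D) * c A) = ?K ^ card (A - D) * c A"
        by (simp add: mult_ac)
    qed
    then have eq: "(\<Sum>A\<in>\<A>0. ?K ^ card (A - D) * c A)
        + ?K * (\<Sum>A\<in>\<A>1. ?K ^ card (A - insert k D) * c A) = (\<Sum>A\<in>\<A>. ?K ^ card (A - D) * c A)"
      using un fin01 by (simp add: sum.union_disjoint)
    have s: "(\<Sum>A\<in>\<A>. f A \<omega>) = ?X \<omega> + ?Y \<omega>" for \<omega>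
      using un fin01 by (simp add: sum.union_disjoint)
    show ?thesis
      using moment_add_le[OF p m _ _ _ _ nn o] IH0 IH1 unfolding s eq by blast
  qed
qed

section \<open>Finite index sets\<close>

text \<open>The Moebius transform on the lattice of finite sets, with \<open>sum_alt_sum\<close> as
  its inversion formula; this keeps the combinatorics apart from the integration.\<close>

definition alt_sum :: "('i set \<Rightarrow> real) \<Rightarrow> 'i set \<Rightarrow> real" where
  "alt_sum W A = (\<Sum>B\<in>Pow A. (-1) ^ (card A - card B) * W B)"

text \<open>Splitting the subsets by membership of \<open>k\<close> exhibits the transform as an
  iterated difference. The difference in direction \<open>k\<close> is what produces degeneracy in
  coordinate \<open>k\<close>.\<close>

lemma alt_sum_insert:
  assumes "finite A" "k \<notin> A"
  shows "alt_sum W (insert k A) = alt_sum (\<lambda>B. W (insert k B) - W B) A"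
proof -
  have inj: "inj_on (insert k) (Pow A)" using assms by (auto simp: inj_on_def)
  have "Pow A \<inter> insert k ` Pow A = {}" using assms by auto
  then have "alt_sum W (insert k A) = (\<Sum>B\<in>Pow A. (-1) ^ (card (insert k A) - card B) * W B)
      + (\<Sum>B\<in>Pow A. (-1) ^ (card (insert k A) - card (insert k B)) * W (insert k B))"
    using assms inj unfolding alt_sum_def Pow_insert
    by (subst sum.union_disjoint) (auto simp: sum.reindex)
  also have "\<dots> = (\<Sum>B\<in>Pow A. - ((-1) ^ (card A - card B)) * W B)
      + (\<Sum>B\<in>Pow A. (-1) ^ (card A - card B) * W (insert k B))"
  proof (intro arg_cong2[where f = "(+)"] sum.cong refl)
    fix B assume B: "B \<in> Pow A"
    then have "finite B" "k \<notin> B" "card B \<le> card A"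
      using assms by (auto intro: finite_subset card_mono)
    then show "(-1) ^ (card (insert k A) - card B) * W B = - ((-1) ^ (card A - card B)) * W B"
      "(-1) ^ (card (insert k A) - card (insert k B)) * W (insert k B)
        = (-1) ^ (card A - card B) * W (insert k B)"
      using assms by (simp_all add: Suc_diff_le)
  qed
  also have "\<dots> = alt_sum (\<lambda>B. W (insert k B) - W B) A"
    unfolding alt_sum_def by (simp add: sum.distrib[symmetric] algebra_simps)
  finally show ?thesis .
qed

text \<open>A new point \<open>k\<close> pairs \<open>A\<close> with \<open>insert k A\<close>, and
  the subtracted half of the difference cancels against the term of \<open>A\<close>. What remains
  is the transform of a shifted \<open>W\<close>, so the induction runs over all
  \<open>W\<close>.\<close>

lemma sum_alt_sum:
  assumes "finite I"
  shows "(\<Sum>A\<in>Pow I. alt_sum W A) = W I"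
  using assms
proof (induction I arbitrary: W rule: finite_induct)
  case empty
  then show ?case by (simp add: alt_sum_def)
next
  case (insert k I)
  have inj: "inj_on (insert k) (Pow I)" using insert.hyps(2) by (intro inj_onI) (metis PowD insert_ident subsetD)
  have "Pow I \<inter> insert k ` Pow I = {}" using insert by auto
  then have "(\<Sum>A\<in>Pow (insert k I). alt_sum W A)
      = (\<Sum>A\<in>Pow I. alt_sum W A) + (\<Sum>A\<in>Pow I. alt_sum W (insert k A))"
    using insert inj unfolding Pow_insert by (subst sum.union_disjoint) (auto simp: sum.reindex)
  also have "\<dots> = (\<Sum>A\<in>Pow I. alt_sum (\<lambda>B. W (insert k B)) A)"
    unfolding sum.distrib[symmetric]
  proof (rule sum.cong[OF refl])
    fix A assume "A \<in> Pow I"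
    then have "alt_sum W (insert k A) = alt_sum (\<lambda>B. W (insert k B) - W B) A"
      using insert by (intro alt_sum_insert) (auto intro: finite_subset)
    then show "alt_sum W A + alt_sum W (insert k A) = alt_sum (\<lambda>B. W (insert k B)) A"
      by (simp add: alt_sum_def sum.distrib[symmetric] algebra_simps)
  qed
  finally show ?case using insert.IH by simp
qed

text \<open>Positions start at \<open>1\<close> and values increase, to match
  \<open>incr_tuples\<close>.\<close>

definition enum_set :: "nat set \<Rightarrow> nat \<Rightarrow> nat" where
  "enum_set A s = sorted_list_of_set A ! (s - 1)"

lemma bij_betw_enum_set:
  assumes "finite A"
  shows "bij_betw (enum_set A) {1..card A} A"
proof -
  let ?l = "sorted_list_of_set A"
  have "bij_betw (\<lambda>i. ?l ! i) {..<card A} A"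
    using assms by (intro bij_betw_nth) auto
  moreover have "bij_betw (\<lambda>s. s - 1) {1..card A} {..<card A}"
    by (rule bij_betwI[where g = Suc]) auto
  ultimately have "bij_betw ((\<lambda>i. ?l ! i) \<circ> (\<lambda>s. s - 1)) {1..card A} A"
    by (rule bij_betw_trans[rotated])
  then show ?thesis by (simp add: comp_def enum_set_def[abs_def])
qed

lemma enum_set_Icc: "s \<in> {1..m} \<Longrightarrow> enum_set {1..m} s = s"
proof -
  assume s: "s \<in> {1..m}"
  have "sorted_list_of_set {1..m} = [1..<Suc m]"
    by (metis atLeastLessThanSuc_atLeastAtMost sorted_list_of_set_range)
  then show ?thesis using s by (auto simp: enum_set_def nth_upt simp del: upt_Suc)
qed

text \<open>An increasing tuple is recovered by listing its range in order; this lets U-statistics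
  be summed over index sets.\<close>

lemma bij_betw_incr_tuples:
  "bij_betw (\<lambda>i. i ` {1..d}) (incr_tuples d n) {I. I \<subseteq> {1..n} \<and> card I = d}"
proof (rule bij_betwI[where g = "\<lambda>I. restrict (enum_set I) {1..d}"])
  show "(\<lambda>i. i ` {1..d}) \<in> incr_tuples d n \<rightarrow> {I. I \<subseteq> {1..n} \<and> card I = d}"
    by (auto simp: incr_tuples_def card_image strict_mono_on_imp_inj_on)
next
  show "(\<lambda>I. restrict (enum_set I) {1..d}) \<in> {I. I \<subseteq> {1..n} \<and> card I = d} \<rightarrow> incr_tuples d n"
  proof
    fix I assume "I \<in> {I. I \<subseteq> {1..n} \<and> card I = d}"
    then have I: "I \<subseteq> {1..n}" "card I = d" "finite I" by (auto intro: finite_subset)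
    have "strict_mono_on {1..d} (enum_set I)"
    proof (rule strict_mono_onI)
      fix s t assume "s \<in> {1..d}" "t \<in> {1..d}" "s < t"
      then show "enum_set I s < enum_set I t"
        unfolding enum_set_def using I
        by (intro sorted_wrt_nth_less[OF strict_sorted_list_of_set]) auto
    qed
    then have "strict_mono_on {1..d} (restrict (enum_set I) {1..d})"
      by (auto simp: strict_mono_on_def)
    then show "restrict (enum_set I) {1..d} \<in> incr_tuples d n"
      using I bij_betwE[OF bij_betw_enum_set[OF I(3)]] by (auto simp: incr_tuples_def)
  qed
next
  fix i assume i: "i \<in> incr_tuples d n"
  then have m: "strict_mono_on {1..d} i" by (simp add: incr_tuples_def)
  have 1: "sorted_list_of_set (i ` {1..d}) = map i [1..<Suc d]"
  proof (rule sorted_distinct_set_unique)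
    show "sorted (map i [1..<Suc d])"
      by (auto simp: sorted_iff_nth_mono_less nth_upt simp del: upt_Suc
          intro!: less_imp_le strict_mono_onD[OF m])
    show "distinct (map i [1..<Suc d])"
      using strict_mono_on_imp_inj_on[OF m] 
      by (auto simp: distinct_map atLeastLessThanSuc_atLeastAtMost simp del: upt_Suc)
  qed (auto simp: atLeastLessThanSuc_atLeastAtMost simp del: upt_Suc)
  show "restrict (enum_set (i ` {1..d})) {1..d} = i"
  proof
    fix s show "restrict (enum_set (i ` {1..d})) {1..d} s = i s"
      using i by (auto simp: incr_tuples_def enum_set_def 1 nth_upt restrict_def PiE_def extensional_def
          simp del: upt_Suc One_nat_def)
  qed
next
  fix I assume "I \<in> {I. I \<subseteq> {1..n} \<and> card I = d}"
  then have "card I = d" "finite I" by (auto intro: finite_subset)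
  then show "restrict (enum_set I) {1..d} ` {1..d} = I"
    using bij_betw_enum_set[of I] by (auto simp: bij_betw_def)
qed

text \<open>Double counting: the \<open>d\<close>-sets above \<open>A\<close> correspond to the
  choices of \<open>d - card A\<close> further elements outside \<open>A\<close>.\<close>

lemma sum_Pow_card_eq:
  fixes g :: "nat set \<Rightarrow> real"
  shows "(\<Sum>I | I \<subseteq> {1..n} \<and> card I = d. \<Sum>A\<in>Pow I. g A)
    = (\<Sum>A | A \<subseteq> {1..n} \<and> card A \<le> d. real ((n - card A) choose (d - card A)) * g A)"
proof -
  let ?F = "{I. I \<subseteq> {1..n} \<and> card I = d}" and ?G = "{A. A \<subseteq> {1..n} \<and> card A \<le> d}"
  have fin: "finite ?F" "finite ?G" by (auto intro: finite_subset[of _ "Pow {1..n}"])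
  have "(\<Sum>I\<in>?F. \<Sum>A\<in>Pow I. g A) = (\<Sum>I\<in>?F. \<Sum>A | A \<in> ?G \<and> A \<subseteq> I. g A)"
    by (intro sum.cong refl) (auto intro: card_mono finite_subset)
  also have "\<dots> = (\<Sum>A\<in>?G. \<Sum>I | I \<in> ?F \<and> A \<subseteq> I. g A)"
    by (rule sum.swap_restrict[OF fin])
  also have "\<dots> = (\<Sum>A\<in>?G. real ((n - card A) choose (d - card A)) * g A)"
  proof (rule sum.cong[OF refl])
    fix A assume A: "A \<in> ?G"
    then have fA: "finite A" by (auto intro: finite_subset)
    have "bij_betw (\<lambda>I. I - A) {I. I \<in> ?F \<and> A \<subseteq> I} {J. J \<subseteq> {1..n} - A \<and> card J = d - card A}"
    proof (rule bij_betwI[where g = "\<lambda>J. J \<union> A"])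
      show "(\<lambda>J. J \<union> A) \<in> {J. J \<subseteq> {1..n} - A \<and> card J = d - card A} \<rightarrow> {I. I \<in> ?F \<and> A \<subseteq> I}"
      proof
        fix J assume J: "J \<in> {J. J \<subseteq> {1..n} - A \<and> card J = d - card A}"
        then have "J \<subseteq> {1..n}" by blast
        then have "finite J" by (rule finite_subset) simp
        then have "card (J \<union> A) = d" using J A fA by (subst card_Un_disjoint) auto
        then show "J \<union> A \<in> {I. I \<in> ?F \<and> A \<subseteq> I}" using J A by auto
      qed
    qed (use fA in \<open>auto simp: card_Diff_subset\<close>)
    then have "card {I. I \<in> ?F \<and> A \<subseteq> I} = card {J. J \<subseteq> {1..n} - A \<and> card J = d - card A}"
      by (rule bij_betw_same_card)
    also have "\<dots> = (n - card A) choose (d - card A)"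
      using A fA by (subst n_subsets) (auto simp: card_Diff_subset)
    finally show "(\<Sum>I | I \<in> ?F \<and> A \<subseteq> I. g A) = real ((n - card A) choose (d - card A)) * g A"
      by simp
  qed
  finally show ?thesis .
qed

section \<open>Conditional expectations of a symmetric kernel on product spaces\<close>

declare One_nat_def [simp del]

text \<open>Jensen's inequality: Young's inequality at \<open>u = m\<close> and
  \<open>v = |f x|\<close> is integrated, and the share \<open>(1 - 1 / p) * m powr p\<close> is
  subtracted. If \<open>f\<close> is not integrable, its integral has the default value
  \<open>0\<close>.\<close>

lemma (in prob_space) abs_expectation_powr_le:
  fixes f :: "'a \<Rightarrow> real"
  assumes p: "1 \<le> p" and [measurable]: "f \<in> borel_measurable M"
    and i: "integrable M (\<lambda>x. \<bar>f x\<bar> powr p)"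
  shows "\<bar>\<integral>x. f x \<partial>M\<bar> powr p \<le> (\<integral>x. \<bar>f x\<bar> powr p \<partial>M)"
proof (cases "integrable M f")
  case False
  then show ?thesis by (simp add: not_integrable_integral_eq)
next
  case True
  define m where "m = \<bar>\<integral>x. f x \<partial>M\<bar>"
  have m: "0 \<le> m" by (simp add: m_def)
  have "m powr p = m powr (p - 1) * m"
    using m by (cases "m = 0") (auto simp: powr_diff)
  also have "\<dots> \<le> m powr (p - 1) * (\<integral>x. \<bar>f x\<bar> \<partial>M)"
    unfolding m_def by (intro mult_left_mono integral_abs_bound) auto
  also have "\<dots> = (\<integral>x. m powr (p - 1) * \<bar>f x\<bar> \<partial>M)" by simp
  also have "\<dots> \<le> (\<integral>x. (1 - 1 / p) * m powr p + \<bar>f x\<bar> powr p / p \<partial>M)"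
    using True i p m by (intro integral_mono powr_young) auto
  also have "\<dots> = (1 - 1 / p) * m powr p + (\<integral>x. \<bar>f x\<bar> powr p \<partial>M) / p"
    using i by (simp add: prob_space)
  finally have "m powr p / p \<le> (\<integral>x. \<bar>f x\<bar> powr p \<partial>M) / p" by (simp add: algebra_simps)
  then show ?thesis using p by (simp add: m_def divide_le_cancel)
qed

text \<open>The sample is left out for now: up to the locale of i.i.d. sequences everything concerns
  powers of a single law \<open>P\<close>, where Fubini's theorem and relabelling of coordinates are
  at hand.\<close>

locale symmetric_kernel = prob_space P for P :: "'x measure" +
  fixes d :: nat and \<Phi> :: "(nat \<Rightarrow> 'x) \<Rightarrow> real"
  assumes sym_kernel: "sym_kernel d P \<Phi>"
begin

abbreviation power_space :: "nat set \<Rightarrow> (nat \<Rightarrow> 'x) measure" where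
  "power_space I \<equiv> PiM I (\<lambda>_. P)"

lemma emeasure_P_space: "emeasure P (space P) = 1"
  by (rule emeasure_space_1)

lemma product_prob: "product_prob_space (\<lambda>_. P)"
  by (intro product_prob_spaceI) (rule prob_space_axioms)

lemma prob_power_space: "prob_space (power_space I)"
  by (intro prob_space_PiM) (rule prob_space_axioms)

lemma emeasure_power_space:
  "finite I \<Longrightarrow> (\<And>i. i \<in> I \<Longrightarrow> E i \<in> sets P) \<Longrightarrow>
    emeasure (power_space I) (Pi\<^sub>E I E) = (\<Prod>i\<in>I. emeasure P (E i))"
proof -
  interpret product_prob_space "\<lambda>_. P" UNIV by (rule product_prob)
  show "finite I \<Longrightarrow> (\<And>i. i \<in> I \<Longrightarrow> E i \<in> sets P) \<Longrightarrow> ?thesis"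
    by (rule emeasure_PiM)
qed

lemma measurable_kernel [measurable]: "\<Phi> \<in> borel_measurable (power_space {1..d})"
  using sym_kernel by (simp add: sym_kernel_def)

lemma kernel_permute: "x \<in> space (power_space {1..d}) \<Longrightarrow> \<pi> permutes {1..d} \<Longrightarrow> \<Phi> (x \<circ> \<pi>) = \<Phi> x"
  using sym_kernel by (auto simp: sym_kernel_def)

lemma distr_reindex:
  assumes "inj_on f I" "f ` I \<subseteq> K"
  shows "distr (power_space K) (power_space I) (\<lambda>x. \<lambda>i\<in>I. x (f i)) = power_space I"
  using distr_PiM_reindex[of K "\<lambda>_. P" f I] assms prob_space_axioms by auto

lemma measurable_reindex:
  assumes "f ` I \<subseteq> K"
  shows "(\<lambda>x. \<lambda>i\<in>I. x (f i)) \<in> power_space K \<rightarrow>\<^sub>M power_space I"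
  using assms by (intro measurable_restrict measurable_component_singleton) auto

text \<open>Coordinates \<open>n + 1\<close> to \<open>n + d\<close> hold a fresh value for every
  argument of the kernel. Sample and fresh values thus live in one power of \<open>P\<close>, in
  which they may be swapped.\<close>

definition append_point :: "nat \<Rightarrow> (nat \<Rightarrow> 'x) \<Rightarrow> (nat \<Rightarrow> 'x) \<Rightarrow> nat \<Rightarrow> 'x" where
  "append_point n x y = (\<lambda>i\<in>{1..n+d}. if i \<le> n then x i else y (i - n))"

lemma measurable_append_point [measurable]:
  "(\<lambda>(x, y). append_point n x y)
     \<in> power_space {1..n} \<Otimes>\<^sub>M power_space {1..d} \<rightarrow>\<^sub>M power_space {1..n+d}"
  unfolding append_point_def split_beta'
proof (rule measurable_restrict)
  fix i assume i: "i \<in> {1..n+d}"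
  show "(\<lambda>z. if i \<le> n then fst z i else snd z (i - n))
      \<in> power_space {1..n} \<Otimes>\<^sub>M power_space {1..d} \<rightarrow>\<^sub>M P"
  proof (cases "i \<le> n")
    case True
    then have [measurable]: "(\<lambda>x. x i) \<in> power_space {1..n} \<rightarrow>\<^sub>M P"
      using i by (intro measurable_component_singleton) auto
    have "(\<lambda>z. fst z i) \<in> power_space {1..n} \<Otimes>\<^sub>M power_space {1..d} \<rightarrow>\<^sub>M P" by measurable
    then show ?thesis using True by simp
  next
    case False
    then have [measurable]: "(\<lambda>x. x (i - n)) \<in> power_space {1..d} \<rightarrow>\<^sub>M P"
      using i by (intro measurable_component_singleton) auto
    have "(\<lambda>z. snd z (i - n)) \<in> power_space {1..n} \<Otimes>\<^sub>M power_space {1..d} \<rightarrow>\<^sub>M P" by measurable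
    then show ?thesis using False by simp
  qed
qed

text \<open>Both measures agree on boxes, which determine a product measure.\<close>

lemma distr_append_point:
  "distr (power_space {1..n} \<Otimes>\<^sub>M power_space {1..d}) (power_space {1..n+d})
     (\<lambda>(x, y). append_point n x y) = power_space {1..n+d}"
proof -
  interpret product_prob_space "\<lambda>_. P" UNIV by (rule product_prob)
  interpret D: prob_space "power_space {1..d}" by (rule prob_power_space)
  let ?T = "\<lambda>(x, y). append_point n x y"
  show ?thesis
  proof (rule PiM_eqI)
    fix E :: "nat \<Rightarrow> 'x set" assume E: "\<And>i. i \<in> {1..n+d} \<Longrightarrow> E i \<in> sets P"
    have "?T -` Pi\<^sub>E {1..n+d} E \<inter> space (power_space {1..n} \<Otimes>\<^sub>M power_space {1..d})
        = Pi\<^sub>E {1..n} E \<times> Pi\<^sub>E {1..d} (\<lambda>s. E (n + s))" (is "?L = ?R")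
    proof (intro equalityI subsetI)
      fix z assume "z \<in> ?L"
      then obtain x y where z: "z = (x, y)" "x \<in> space (power_space {1..n})"
          "y \<in> space (power_space {1..d})" "append_point n x y \<in> Pi\<^sub>E {1..n+d} E"
        by (auto simp: space_pair_measure)
      have a: "append_point n x y i \<in> E i" if "i \<in> {1..n+d}" for i
        using z(4) that by (auto simp: PiE_iff)
      have "x i \<in> E i" if "i \<in> {1..n}" for i using a[of i] that by (auto simp: append_point_def)
      moreover have "y s \<in> E (n + s)" if "s \<in> {1..d}" for s
        using a[of "n + s"] that by (auto simp: append_point_def)
      ultimately show "z \<in> ?R" using z(1-3) by (auto simp: space_PiM PiE_iff)
    next
      fix z assume "z \<in> ?R"
      then obtain x y where z: "z = (x, y)" "x \<in> Pi\<^sub>E {1..n} E" "y \<in> Pi\<^sub>E {1..d} (\<lambda>s. E (n + s))"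
        by auto
      have "append_point n x y i \<in> E i" if "i \<in> {1..n+d}" for i
      proof (cases "i \<le> n")
        case False
        then have "y (i - n) \<in> E (n + (i - n))" using z(3) that by (intro PiE_mem[of y]) auto
        then show ?thesis using False that by (simp add: append_point_def)
      qed (use z that in \<open>auto simp: append_point_def PiE_iff\<close>)
      then have "append_point n x y \<in> Pi\<^sub>E {1..n+d} E" by (auto simp: append_point_def)
      moreover have "x i \<in> space P" if "i \<in> {1..n}" for i
        using z(2) E[of i] that sets.sets_into_space[of "E i" P] by (auto simp: PiE_iff)
      moreover have "y s \<in> space P" if "s \<in> {1..d}" for s
        using z(3) E[of "n + s"] that sets.sets_into_space[of "E (n + s)" P] by (auto simp: PiE_iff)
      ultimately show "z \<in> ?L"
        using z by (auto simp: space_pair_measure space_PiM PiE_iff)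
    qed
    then have "emeasure (distr (power_space {1..n} \<Otimes>\<^sub>M power_space {1..d}) (power_space {1..n+d}) ?T)
          (Pi\<^sub>E {1..n+d} E)
        = emeasure (power_space {1..n} \<Otimes>\<^sub>M power_space {1..d}) ?R"
      using E by (subst emeasure_distr) (auto intro!: sets_PiM_I_finite)
    also have "\<dots> = emeasure (power_space {1..n}) (Pi\<^sub>E {1..n} E)
        * emeasure (power_space {1..d}) (Pi\<^sub>E {1..d} (\<lambda>s. E (n + s)))"
      using E by (intro D.emeasure_pair_measure_Times sets_PiM_I_finite) auto
    also have "\<dots> = (\<Prod>i\<in>{1..n}. emeasure P (E i)) * (\<Prod>s\<in>{1..d}. emeasure P (E (n + s)))"
      using E by (intro arg_cong2[where f = "(*)"] emeasure_power_space) auto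
    also have "(\<Prod>s\<in>{1..d}. emeasure P (E (n + s))) = (\<Prod>i\<in>{n+1..n+d}. emeasure P (E i))"
      by (rule prod.reindex_bij_witness[where i = "\<lambda>i. i - n" and j = "\<lambda>s. n + s"]) auto
    also have "(\<Prod>i\<in>{1..n}. emeasure P (E i)) * (\<Prod>i\<in>{n+1..n+d}. emeasure P (E i))
        = (\<Prod>i\<in>{1..n} \<union> {n+1..n+d}. emeasure P (E i))"
      by (rule prod.union_disjoint[symmetric]) auto
    also have "{1..n} \<union> {n+1..n+d} = {1..n+d}" by auto
    finally show "emeasure (distr (power_space {1..n} \<Otimes>\<^sub>M power_space {1..d}) (power_space {1..n+d}) ?T)
          (Pi\<^sub>E {1..n+d} E) = (\<Prod>i\<in>{1..n+d}. emeasure P (E i))" .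
  qed auto
qed

text \<open>Fubini's theorem, carried over from the pair measure by
  \<open>distr_append_point\<close>; the inner variables are the fresh coordinates.\<close>

lemma
  fixes F :: "(nat \<Rightarrow> 'x) \<Rightarrow> real"
  assumes F: "integrable (power_space {1..n+d}) F"
  shows AE_integrable_append: "AE x in power_space {1..n}.
      integrable (power_space {1..d}) (\<lambda>y. F (append_point n x y))"
    and integrable_append: "integrable (power_space {1..n})
      (\<lambda>x. \<integral>y. F (append_point n x y) \<partial>power_space {1..d})"
    and integral_append: "(\<integral>x. (\<integral>y. F (append_point n x y) \<partial>power_space {1..d}) \<partial>power_space {1..n})
      = (\<integral>z. F z \<partial>power_space {1..n+d})"
proof -
  interpret N: prob_space "power_space {1..n}" by (rule prob_power_space)
  interpret D: prob_space "power_space {1..d}" by (rule prob_power_space)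
  interpret pair_sigma_finite "power_space {1..n}" "power_space {1..d}" ..
  have [measurable]: "F \<in> borel_measurable (power_space {1..n+d})" using F by auto
  have "integrable (distr (power_space {1..n} \<Otimes>\<^sub>M power_space {1..d}) (power_space {1..n+d})
     (\<lambda>(x, y). append_point n x y)) F" using F by (simp only: distr_append_point)
  then have i: "integrable (power_space {1..n} \<Otimes>\<^sub>M power_space {1..d}) (\<lambda>z. F (case z of (x, y) \<Rightarrow> append_point n x y))"
    by (subst (asm) integrable_distr_eq) auto
  have "(\<integral>z. F z \<partial>power_space {1..n+d})
      = (\<integral>z. F (case z of (x, y) \<Rightarrow> append_point n x y) \<partial>(power_space {1..n} \<Otimes>\<^sub>M power_space {1..d}))"
    by (subst distr_append_point[symmetric]) (rule integral_distr; measurable)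
  with AE_integrable_fst'[OF i] integrable_fst'[OF i] integral_fst'[OF i]
  show "AE x in power_space {1..n}. integrable (power_space {1..d}) (\<lambda>y. F (append_point n x y))"
    "integrable (power_space {1..n}) (\<lambda>x. \<integral>y. F (append_point n x y) \<partial>power_space {1..d})"
    "(\<integral>x. (\<integral>y. F (append_point n x y) \<partial>power_space {1..d}) \<partial>power_space {1..n})
      = (\<integral>z. F z \<partial>power_space {1..n+d})"
    by simp_all
qed

text \<open>Argument positions and sample coordinates are kept apart by \<open>e\<close>: the
  symmetry of the kernel relabels the former, the invariance of the power measure the
  latter.\<close>

definition fill :: "nat set \<Rightarrow> (nat \<Rightarrow> nat) \<Rightarrow> (nat \<Rightarrow> 'x) \<Rightarrow> (nat \<Rightarrow> 'x) \<Rightarrow> nat \<Rightarrow> 'x" where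
  "fill A e x y = (\<lambda>s\<in>{1..d}. if s \<in> A then x (e s) else y s)"

text \<open>\<open>cond_kernel A e\<close> is the conditional expectation of the kernel given that its arguments in
  \<open>A\<close> are the coordinates \<open>e s\<close>; it has the value \<open>0\<close> on the null set of points where the integral
  does not exist.\<close>

definition cond_kernel :: "nat set \<Rightarrow> (nat \<Rightarrow> nat) \<Rightarrow> (nat \<Rightarrow> 'x) \<Rightarrow> real" where
  "cond_kernel A e x = (\<integral>y. \<Phi> (fill A e x y) \<partial>power_space {1..d})"

lemma cond_kernel_cong: "(\<And>s. s \<in> A \<Longrightarrow> x (e s) = x' (e' s)) \<Longrightarrow> cond_kernel A e x = cond_kernel A e' x'"
  unfolding cond_kernel_def fill_def by (intro Bochner_Integration.integral_cong arg_cong[where f = \<Phi>]) auto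

section \<open>Conditional expectations of the kernel and their symmetry\<close>

lemma measurable_fill:
  assumes "\<And>s. s \<in> A \<Longrightarrow> x (e s) \<in> space P"
  shows "fill A e x \<in> power_space {1..d} \<rightarrow>\<^sub>M power_space {1..d}"
  unfolding fill_def
proof (rule measurable_restrict)
  fix s assume s: "s \<in> {1..d}"
  show "(\<lambda>y. if s \<in> A then x (e s) else y s) \<in> power_space {1..d} \<rightarrow>\<^sub>M P"
    using assms s by (cases "s \<in> A") auto
qed

text \<open>On a box both sides factor over the arguments, and the point mass at \<open>x s\<close>
  contributes \<open>1\<close> or \<open>0\<close> according to whether \<open>x s\<close> lies in
  that side of the box; hence the case split. The equality makes Fubini's theorem available for the
  integrals in \<open>hoeffding_g\<close>.\<close>

lemma hoeffding_measure_eq: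
  assumes A: "A \<subseteq> {1..d}" and x: "\<And>s. s \<in> A \<Longrightarrow> x s \<in> space P"
  shows "PiM {1..d} (\<lambda>s. if s \<in> A then return P (x s) else P)
     = distr (power_space {1..d}) (power_space {1..d}) (fill A (\<lambda>s. s) x)"
proof -
  let ?M = "\<lambda>s. if s \<in> A then return P (x s) else P"
  interpret product_prob_space ?M UNIV
    by (intro product_prob_spaceI) (auto intro: prob_space_return x prob_space_axioms)
  have [measurable]: "fill A (\<lambda>s. s) x \<in> power_space {1..d} \<rightarrow>\<^sub>M power_space {1..d}"
    by (rule measurable_fill) (rule x)
  have sets_eq: "sets (power_space {1..d}) = sets (PiM {1..d} ?M)"
    by (intro sets_PiM_cong) auto
  show ?thesis
  proof (rule PiM_eqI[symmetric])
    fix E assume E': "\<And>s. s \<in> {1..d} \<Longrightarrow> E s \<in> sets (?M s)"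
    have E: "E s \<in> sets P" if "s \<in> {1..d}" for s
      using E'[OF that] by (cases "s \<in> A") simp_all
    have "emeasure (distr (power_space {1..d}) (power_space {1..d}) (fill A (\<lambda>s. s) x)) (Pi\<^sub>E {1..d} E)
      = emeasure (power_space {1..d}) (fill A (\<lambda>s. s) x -` Pi\<^sub>E {1..d} E \<inter> space (power_space {1..d}))"
      using E by (subst emeasure_distr) (auto intro!: sets_PiM_I_finite)
    also have "\<dots> = (\<Prod>s\<in>{1..d}. emeasure (?M s) (E s))"
    proof (cases "\<forall>s\<in>A. x s \<in> E s")
      case True
      let ?E' = "\<lambda>s. if s \<in> A then space P else E s"
      have "fill A (\<lambda>s. s) x -` Pi\<^sub>E {1..d} E \<inter> space (power_space {1..d}) = Pi\<^sub>E {1..d} ?E'"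
      proof (intro equalityI subsetI)
        fix y assume y: "y \<in> fill A (\<lambda>s. s) x -` Pi\<^sub>E {1..d} E \<inter> space (power_space {1..d})"
        have "y s \<in> ?E' s" if "s \<in> {1..d}" for s
        proof -
          have "fill A (\<lambda>s. s) x y s \<in> E s" "y s \<in> space P"
            using y that by (auto simp: space_PiM PiE_iff)
          then show ?thesis using that by (auto simp: fill_def)
        qed
        then show "y \<in> Pi\<^sub>E {1..d} ?E'" using y by (auto simp: space_PiM PiE_iff)
      next
        fix y assume y: "y \<in> Pi\<^sub>E {1..d} ?E'"
        have *: "y s \<in> ?E' s" if "s \<in> {1..d}" for s using y that by (rule PiE_mem)
        have "y s \<in> space P" if "s \<in> {1..d}" for s
          using *[OF that] sets.sets_into_space[OF E[OF that]] by (auto split: if_splits)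
        moreover have "fill A (\<lambda>s. s) x y s \<in> E s" if "s \<in> {1..d}" for s
          using *[OF that] True that by (auto simp: fill_def)
        ultimately show "y \<in> fill A (\<lambda>s. s) x -` Pi\<^sub>E {1..d} E \<inter> space (power_space {1..d})"
          using y by (auto simp: space_PiM PiE_iff fill_def)
      qed
      moreover have "emeasure (power_space {1..d}) (Pi\<^sub>E {1..d} ?E') = (\<Prod>s\<in>{1..d}. emeasure P (?E' s))"
        using E by (intro emeasure_power_space) auto
      moreover have "\<dots> = (\<Prod>s\<in>{1..d}. emeasure (?M s) (E s))"
        using E True x by (intro prod.cong refl) (auto simp: emeasure_P_space)
      ultimately show ?thesis by simp
    next
      case False
      then obtain s where s: "s \<in> A" "x s \<notin> E s" by auto
      have "fill A (\<lambda>s. s) x y s \<notin> E s" for y using s A by (auto simp: fill_def)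
      then have "fill A (\<lambda>s. s) x -` Pi\<^sub>E {1..d} E \<inter> space (power_space {1..d}) = {}"
        using s A by (auto simp: PiE_iff)
      moreover have "emeasure (?M s) (E s) = 0" using s A E[of s] x by auto
      then have "(\<Prod>s\<in>{1..d}. emeasure (?M s) (E s)) = 0"
        using s A by (intro prod_zero) auto
      ultimately show ?thesis by simp
    qed
    finally show "emeasure (distr (power_space {1..d}) (power_space {1..d}) (fill A (\<lambda>s. s) x)) (Pi\<^sub>E {1..d} E)
        = (\<Prod>s\<in>{1..d}. emeasure (?M s) (E s))" .
  qed (simp_all add: sets_eq)
qed

lemma integral_hoeffding_measure:
  assumes A: "A \<subseteq> {1..d}" and x: "\<And>s. s \<in> A \<Longrightarrow> x s \<in> space P"
  shows "(\<integral>y. \<Phi> y \<partial>PiM {1..d} (\<lambda>s. if s \<in> A then return P (x s) else P)) = cond_kernel A (\<lambda>s. s) x"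
proof -
  have "PiM {1..d} (\<lambda>s. if s \<in> A then return P (x s) else P)
     = distr (power_space {1..d}) (power_space {1..d}) (fill A (\<lambda>s. s) x)"
    using A x by (rule hoeffding_measure_eq)
  then show ?thesis
    unfolding cond_kernel_def by (simp only:) (intro integral_distr measurable_fill x; simp)
qed

text \<open>Two placements of the same coordinates differ by a permutation of the argument
  positions. The kernel is invariant under it, and the averaged arguments, which get permuted as
  well, keep their law.\<close>

lemma cond_kernel_image_eq:
  assumes A: "A \<subseteq> {1..d}" "A' \<subseteq> {1..d}" and inj: "inj_on e A" "inj_on e' A'" and im: "e ` A = e' ` A'"
    and x: "\<And>i. i \<in> e ` A \<Longrightarrow> x i \<in> space P"
  shows "cond_kernel A e x = cond_kernel A' e' x"
proof -
  have fin: "finite A" "finite A'"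
    using A finite_subset[OF _ finite_atLeastAtMost] by blast+
  define g where "g = inv_into A e \<circ> e'"
  have "bij_betw e' A' (e ` A)" using inj im by (simp add: bij_betw_def)
  moreover have "bij_betw (inv_into A e) (e ` A) A" using inj by (intro bij_betw_inv_into) (simp add: bij_betw_def)
  ultimately have g: "bij_betw g A' A" unfolding g_def by (rule bij_betw_trans)
  have eg: "e (g s) = e' s" if "s \<in> A'" for s
    unfolding g_def comp_def using that im by (intro f_inv_into_f) auto
  \<comment> \<open>Any bijection between the complements completes \<open>g\<close> to a
    permutation; how the averaged positions are matched is immaterial.\<close>
  have "card ({1..d} - A') = card ({1..d} - A)"
    using A fin bij_betw_same_card[OF g] by (simp add: card_Diff_subset)
  then obtain h where h: "bij_betw h ({1..d} - A') ({1..d} - A)"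
    using finite_same_card_bij[of "{1..d} - A'" "{1..d} - A"] by auto
  define \<pi> where "\<pi> s = (if s \<in> A' then g s else if s \<in> {1..d} then h s else s)" for s
  have "bij_betw \<pi> A' A" using g by (subst bij_betw_cong[of _ _ g]) (auto simp: \<pi>_def)
  moreover have "bij_betw \<pi> ({1..d} - A') ({1..d} - A)"
    using h by (subst bij_betw_cong[of _ _ h]) (auto simp: \<pi>_def)
  ultimately have "bij_betw \<pi> (A' \<union> ({1..d} - A')) (A \<union> ({1..d} - A))"
    by (rule bij_betw_combine) auto
  then have bij: "bij_betw \<pi> {1..d} {1..d}" using A by (simp add: Un_absorb1)
  have perm: "\<pi> permutes {1..d}"
    using A by (intro bij_imp_permutes bij) (auto simp: \<pi>_def)
  have \<pi>A: "\<pi> s \<in> A \<longleftrightarrow> s \<in> A'" if "s \<in> {1..d}" for s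
    using bij_betwE[OF g] bij_betwE[OF h] that by (auto simp: \<pi>_def)
  have eq: "\<Phi> (fill A e x y) = \<Phi> (fill A' e' x (\<lambda>s\<in>{1..d}. y (\<pi> s)))"
    if y: "y \<in> space (power_space {1..d})" for y
  proof -
    have "fill A e x y \<in> space (power_space {1..d})"
      using measurable_space[OF measurable_fill y] x by auto
    then have "\<Phi> (fill A e x y) = \<Phi> (fill A e x y \<circ> \<pi>)" using kernel_permute perm by simp
    also have "fill A e x y \<circ> \<pi> = fill A' e' x (\<lambda>s\<in>{1..d}. y (\<pi> s))"
    proof
      fix s
      show "(fill A e x y \<circ> \<pi>) s = fill A' e' x (\<lambda>s\<in>{1..d}. y (\<pi> s)) s"
      proof (cases "s \<in> {1..d}")
        case True
        then have "\<pi> s \<in> {1..d}" using bij by (auto simp: bij_betw_def)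
        then show ?thesis using True \<pi>A[OF True] eg by (auto simp: fill_def \<pi>_def)
      next
        case False
        then have "\<pi> s = s" using perm by (simp add: permutes_def)
        then show ?thesis using False by (auto simp: fill_def)
      qed
    qed
    finally show ?thesis .
  qed
  have [measurable]: "fill A' e' x \<in> power_space {1..d} \<rightarrow>\<^sub>M power_space {1..d}"
    using x im by (intro measurable_fill) auto
  have m: "(\<lambda>y. \<lambda>s\<in>{1..d}. y (\<pi> s)) \<in> power_space {1..d} \<rightarrow>\<^sub>M power_space {1..d}"
    using bij by (intro measurable_reindex) (simp add: bij_betw_def)
  have "cond_kernel A e x = (\<integral>y. \<Phi> (fill A' e' x (\<lambda>s\<in>{1..d}. y (\<pi> s))) \<partial>power_space {1..d})"
    unfolding cond_kernel_def by (intro Bochner_Integration.integral_cong refl eq)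
  also have "\<dots> = (\<integral>y. \<Phi> (fill A' e' x y)
      \<partial>distr (power_space {1..d}) (power_space {1..d}) (\<lambda>y. \<lambda>s\<in>{1..d}. y (\<pi> s)))"
    by (rule integral_distr[symmetric, OF m]) measurable
  also have "\<dots> = cond_kernel A' e' x"
    unfolding cond_kernel_def using bij by (subst distr_reindex) (auto simp: bij_betw_def)
  finally show ?thesis .
qed


lemma
  fixes p :: real
  assumes inj: "inj_on f {1..d}" "f ` {1..d} \<subseteq> K"
  shows measurable_kernel_reindex: "(\<lambda>z. \<Phi> (\<lambda>s\<in>{1..d}. z (f s))) \<in> borel_measurable (power_space K)"
    and integrable_kernel_reindex: "integrable (power_space {1..d}) (\<lambda>x. \<bar>\<Phi> x\<bar> powr p) \<Longrightarrow>
      integrable (power_space K) (\<lambda>z. \<bar>\<Phi> (\<lambda>s\<in>{1..d}. z (f s))\<bar> powr p)"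
    and integral_kernel_reindex: "(\<integral>z. \<bar>\<Phi> (\<lambda>s\<in>{1..d}. z (f s))\<bar> powr p \<partial>power_space K)
      = (\<integral>x. \<bar>\<Phi> x\<bar> powr p \<partial>power_space {1..d})"
proof -
  have m [measurable]: "(\<lambda>z. \<lambda>s\<in>{1..d}. z (f s)) \<in> power_space K \<rightarrow>\<^sub>M power_space {1..d}"
    by (rule measurable_reindex[OF inj(2)])
  show "(\<lambda>z. \<Phi> (\<lambda>s\<in>{1..d}. z (f s))) \<in> borel_measurable (power_space K)" by measurable
  have [measurable]: "(\<lambda>x. \<bar>\<Phi> x\<bar> powr p) \<in> borel_measurable (power_space {1..d})" by measurable
  show "integrable (power_space K) (\<lambda>z. \<bar>\<Phi> (\<lambda>s\<in>{1..d}. z (f s))\<bar> powr p)"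
    if "integrable (power_space {1..d}) (\<lambda>x. \<bar>\<Phi> x\<bar> powr p)"
    using that by (subst (asm) distr_reindex[OF inj, symmetric]) (subst (asm) integrable_distr_eq[OF m], auto)
  show "(\<integral>z. \<bar>\<Phi> (\<lambda>s\<in>{1..d}. z (f s))\<bar> powr p \<partial>power_space K)
      = (\<integral>x. \<bar>\<Phi> x\<bar> powr p \<partial>power_space {1..d})"
    by (subst distr_reindex[OF inj, symmetric], subst integral_distr[OF m]) auto
qed

text \<open>The coordinate of \<open>append_point n x y\<close> from which argument \<open>s\<close>
  is read. It turns partial averages of the kernel into integrals of the kernel at distinct
  coordinates of one power space.\<close>

definition lift_index :: "nat set \<Rightarrow> (nat \<Rightarrow> nat) \<Rightarrow> nat \<Rightarrow> nat \<Rightarrow> nat" where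
  "lift_index A e n s = (if s \<in> A then e s else n + s)"

lemma inj_on_lift_index:
  assumes "inj_on e A" "e ` A \<subseteq> {1..n}"
  shows "inj_on (lift_index A e n) {1..d}"
proof (rule inj_onI)
  fix s t assume st: "s \<in> {1..d}" "t \<in> {1..d}" "lift_index A e n s = lift_index A e n t"
  have "u \<in> A \<Longrightarrow> e u \<le> n" for u using assms(2) by auto
  from this[of s] this[of t] show "s = t"
    using st inj_onD[OF assms(1), of s t] by (auto simp: lift_index_def split: if_splits)
qed

lemma lift_index_image:
  assumes "e ` A \<subseteq> {1..n}"
  shows "lift_index A e n ` {1..d} \<subseteq> {1..n+d}"
  using assms by (force simp: lift_index_def)

lemma append_point_lift_index:
  assumes "e ` A \<subseteq> {1..n}"
  shows "(\<lambda>s\<in>{1..d}. append_point n x y (lift_index A e n s)) = fill A e x y"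
proof
  fix s
  show "(\<lambda>s\<in>{1..d}. append_point n x y (lift_index A e n s)) s = fill A e x y s"
  proof (cases "s \<in> A \<and> s \<in> {1..d}")
    case True
    then have "e s \<in> {1..n}" using assms by auto
    then show ?thesis using True by (auto simp: append_point_def lift_index_def fill_def)
  qed (auto simp: append_point_def lift_index_def fill_def)
qed

lemma restrict_append_point:
  assumes "x \<in> space (power_space {1..n})"
  shows "restrict (append_point n x y) {1..n} = x"
proof
  fix i show "restrict (append_point n x y) {1..n} i = x i"
    using assms by (auto simp: append_point_def space_PiM PiE_def extensional_def)
qed

lemma measurable_cond_kernel:
  assumes "inj_on e A" "e ` A \<subseteq> {1..n}"
  shows "cond_kernel A e \<in> borel_measurable (power_space {1..n})"
proof -
  interpret D: prob_space "power_space {1..d}" by (rule prob_power_space)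
  have [measurable]: "(\<lambda>z. \<Phi> (\<lambda>s\<in>{1..d}. z (lift_index A e n s))) \<in> borel_measurable (power_space {1..n+d})"
    by (intro measurable_kernel_reindex inj_on_lift_index lift_index_image assms)
  have "(\<lambda>z. \<Phi> (\<lambda>s\<in>{1..d}. (case z of (x, y) \<Rightarrow> append_point n x y) (lift_index A e n s)))
      \<in> borel_measurable (power_space {1..n} \<Otimes>\<^sub>M power_space {1..d})"
    by (rule measurable_compose[OF measurable_append_point]) measurable
  then have "(\<lambda>(x, y). \<Phi> (fill A e x y)) \<in> borel_measurable (power_space {1..n} \<Otimes>\<^sub>M power_space {1..d})"
    by (simp add: split_beta' append_point_lift_index[OF assms(2)])
  then show ?thesis unfolding cond_kernel_def[abs_def] by (rule D.borel_measurable_lebesgue_integral)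
qed

text \<open>Conditional expectation contracts the norm of \<open>L_p\<close>: Jensen's inequality in
  the fresh coordinates, for almost every \<open>x\<close>, followed by Fubini's theorem.\<close>

lemma
  fixes p :: real
  assumes A: "inj_on e A" "e ` A \<subseteq> {1..n}" and p: "1 \<le> p"
    and i: "integrable (power_space {1..d}) (\<lambda>x. \<bar>\<Phi> x\<bar> powr p)"
  shows integrable_cond_kernel_powr: "integrable (power_space {1..n}) (\<lambda>x. \<bar>cond_kernel A e x\<bar> powr p)"
    and integral_cond_kernel_powr_le: "(\<integral>x. \<bar>cond_kernel A e x\<bar> powr p \<partial>power_space {1..n})
      \<le> (\<integral>x. \<bar>\<Phi> x\<bar> powr p \<partial>power_space {1..d})"
proof -
  interpret D: prob_space "power_space {1..d}" by (rule prob_power_space)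
  note [measurable] = measurable_cond_kernel[OF A]
  let ?F = "\<lambda>z. \<bar>\<Phi> (\<lambda>s\<in>{1..d}. z (lift_index A e n s))\<bar> powr p"
  let ?J = "\<lambda>x. \<integral>y. \<bar>\<Phi> (fill A e x y)\<bar> powr p \<partial>power_space {1..d}"
  have iF: "integrable (power_space {1..n+d}) ?F"
    by (intro integrable_kernel_reindex inj_on_lift_index lift_index_image A i)
  note ap = append_point_lift_index[OF A(2)]
  have AE: "AE x in power_space {1..n}. \<bar>cond_kernel A e x\<bar> powr p \<le> ?J x"
    using AE_integrable_append[OF iF] AE_space
  proof eventually_elim
    fix x assume 1: "integrable (power_space {1..d}) (\<lambda>y. ?F (append_point n x y))"
      and x: "x \<in> space (power_space {1..n})"
    have [measurable]: "fill A e x \<in> power_space {1..d} \<rightarrow>\<^sub>M power_space {1..d}"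
      using x A(2) by (intro measurable_fill) (auto simp: space_PiM PiE_iff)
    show "\<bar>cond_kernel A e x\<bar> powr p \<le> ?J x"
      unfolding cond_kernel_def using 1 p unfolding ap by (intro D.abs_expectation_powr_le) auto
  qed
  have iJ: "integrable (power_space {1..n}) ?J" using integrable_append[OF iF] unfolding ap .
  show int: "integrable (power_space {1..n}) (\<lambda>x. \<bar>cond_kernel A e x\<bar> powr p)"
    by (rule Bochner_Integration.integrable_bound[OF iJ]) (use AE in auto)
  have "(\<integral>x. \<bar>cond_kernel A e x\<bar> powr p \<partial>power_space {1..n}) \<le> (\<integral>x. ?J x \<partial>power_space {1..n})"
    by (intro integral_mono_AE int iJ AE)
  also have "\<dots> = (\<integral>z. ?F z \<partial>power_space {1..n+d})" using integral_append[OF iF] unfolding ap .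
  also have "\<dots> = (\<integral>x. \<bar>\<Phi> x\<bar> powr p \<partial>power_space {1..d})"
    by (intro integral_kernel_reindex inj_on_lift_index lift_index_image A)
  finally show "(\<integral>x. \<bar>cond_kernel A e x\<bar> powr p \<partial>power_space {1..n})
      \<le> (\<integral>x. \<bar>\<Phi> x\<bar> powr p \<partial>power_space {1..d})" .
qed

text \<open>The defining property of a conditional expectation: against a factor depending on the
  first \<open>n\<close> coordinates only, the average may be replaced by the kernel itself.\<close>

lemma integral_mult_cond_kernel:
  assumes A: "e ` A \<subseteq> {1..n}"
    and i: "integrable (power_space {1..n+d})
      (\<lambda>z. h (restrict z {1..n}) * \<Phi> (\<lambda>s\<in>{1..d}. z (lift_index A e n s)))"
  shows "(\<integral>x. h x * cond_kernel A e x \<partial>power_space {1..n})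
    = (\<integral>z. h (restrict z {1..n}) * \<Phi> (\<lambda>s\<in>{1..d}. z (lift_index A e n s)) \<partial>power_space {1..n+d})"
  unfolding integral_append[OF i, symmetric]
proof (rule Bochner_Integration.integral_cong[OF refl])
  fix x assume x: "x \<in> space (power_space {1..n})"
  show "h x * cond_kernel A e x = (\<integral>y. h (restrict (append_point n x y) {1..n}) *
     \<Phi> (\<lambda>s\<in>{1..d}. append_point n x y (lift_index A e n s)) \<partial>power_space {1..d})"
    unfolding restrict_append_point[OF x] append_point_lift_index[OF A] cond_kernel_def by simp
qed

text \<open>The conditional expectation of the kernel given the coordinates in \<open>B\<close>, for
  \<open>card B \<le> d\<close>. The increasing enumeration is one choice of argument positions; by
  \<open>proj_kernel_eq\<close> any other gives the same value.\<close>

definition proj_kernel :: "nat set \<Rightarrow> (nat \<Rightarrow> 'x) \<Rightarrow> real" where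
  "proj_kernel B = cond_kernel {1..card B} (enum_set B)"

text \<open>At the coordinates of \<open>A\<close> this is \<open>hoeffding_g\<close> of order
  \<open>card A\<close>, see \<open>hoeffding_g_eq_comp\<close>. Indexing by sets instead of by
  order lets single coordinates be split off.\<close>

definition hoeffding_comp :: "nat set \<Rightarrow> (nat \<Rightarrow> 'x) \<Rightarrow> real" where
  "hoeffding_comp A x = alt_sum (\<lambda>B. proj_kernel B x) A"

section \<open>Moments of projections and components\<close>

lemma
  assumes "finite B"
  shows inj_on_enum_set: "inj_on (enum_set B) {1..card B}"
    and enum_set_image: "enum_set B ` {1..card B} = B"
  using bij_betw_enum_set[OF assms] by (auto simp: bij_betw_def)

lemma finite_subset_Icc: "B \<subseteq> {1..n::nat} \<Longrightarrow> finite B"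
  by (rule finite_subset[OF _ finite_atLeastAtMost])

lemma proj_kernel_eq:
  assumes A: "A \<subseteq> {1..d}" "inj_on e A" and x: "\<And>i. i \<in> e ` A \<Longrightarrow> x i \<in> space P"
  shows "proj_kernel (e ` A) x = cond_kernel A e x"
  unfolding proj_kernel_def
proof (rule cond_kernel_image_eq)
  have fin: "finite A" using A by (auto intro: finite_subset_Icc)
  show "{1..card (e ` A)} \<subseteq> {1..d}"
    using card_mono[OF _ A(1)] A(2) by (simp add: card_image)
  show "inj_on (enum_set (e ` A)) {1..card (e ` A)}" "enum_set (e ` A) ` {1..card (e ` A)} = e ` A"
    using inj_on_enum_set enum_set_image fin by auto
  then show "x i \<in> space P" if "i \<in> enum_set (e ` A) ` {1..card (e ` A)}" for i
    using that x by auto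
qed (use A in auto)

lemma proj_kernel_cong:
  assumes "finite B" "\<And>i. i \<in> B \<Longrightarrow> x i = x' i"
  shows "proj_kernel B x = proj_kernel B x'"
  unfolding proj_kernel_def
  using bij_betwE[OF bij_betw_enum_set[OF assms(1)]] assms(2) by (intro cond_kernel_cong) auto

lemma hoeffding_comp_cong:
  assumes "finite A" "\<And>i. i \<in> A \<Longrightarrow> x i = x' i"
  shows "hoeffding_comp A x = hoeffding_comp A x'"
  unfolding hoeffding_comp_def alt_sum_def
  using assms by (intro sum.cong refl arg_cong2[where f = "(*)"] proj_kernel_cong) (auto intro: finite_subset)

lemma
  fixes p :: real
  assumes B: "B \<subseteq> {1..n}"
  shows measurable_proj_kernel: "proj_kernel B \<in> borel_measurable (power_space {1..n})"
    and integrable_proj_kernel_powr: "1 \<le> p \<Longrightarrow> integrable (power_space {1..d}) (\<lambda>x. \<bar>\<Phi> x\<bar> powr p) \<Longrightarrow>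
      integrable (power_space {1..n}) (\<lambda>x. \<bar>proj_kernel B x\<bar> powr p)"
    and integral_proj_kernel_powr_le: "1 \<le> p \<Longrightarrow> integrable (power_space {1..d}) (\<lambda>x. \<bar>\<Phi> x\<bar> powr p) \<Longrightarrow>
      (\<integral>x. \<bar>proj_kernel B x\<bar> powr p \<partial>power_space {1..n})
        \<le> (\<integral>x. \<bar>\<Phi> x\<bar> powr p \<partial>power_space {1..d})"
proof -
  note fin = finite_subset_Icc[OF B]
  have *: "inj_on (enum_set B) {1..card B}" "enum_set B ` {1..card B} \<subseteq> {1..n}"
    using inj_on_enum_set[OF fin] enum_set_image[OF fin] B by auto
  show "proj_kernel B \<in> borel_measurable (power_space {1..n})"
    unfolding proj_kernel_def by (rule measurable_cond_kernel[OF *])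
  show "integrable (power_space {1..n}) (\<lambda>x. \<bar>proj_kernel B x\<bar> powr p)"
    "(\<integral>x. \<bar>proj_kernel B x\<bar> powr p \<partial>power_space {1..n}) \<le> (\<integral>x. \<bar>\<Phi> x\<bar> powr p \<partial>power_space {1..d})"
    if "1 \<le> p" "integrable (power_space {1..d}) (\<lambda>x. \<bar>\<Phi> x\<bar> powr p)"
    unfolding proj_kernel_def
    using integrable_cond_kernel_powr[OF * that] integral_cond_kernel_powr_le[OF * that] by auto
qed

lemma measurable_hoeffding_comp:
  "A \<subseteq> {1..n} \<Longrightarrow> hoeffding_comp A \<in> borel_measurable (power_space {1..n})"
  unfolding hoeffding_comp_def[abs_def] alt_sum_def
  by (intro borel_measurable_sum borel_measurable_times borel_measurable_const measurable_proj_kernel) auto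

text \<open>There are \<open>2 ^ card A\<close> projections, each with moment at most that of the
  kernel. The constant is \<open>(4 ^ d) powr p\<close>, written as
  \<open>(16 ^ d) powr (p / 2)\<close> because \<open>moment_sum_le\<close> works with squared
  norms.\<close>

lemma
  fixes p :: real
  assumes A: "A \<subseteq> {1..n}" "card A \<le> d" and p: "1 \<le> p"
    and i: "integrable (power_space {1..d}) (\<lambda>x. \<bar>\<Phi> x\<bar> powr p)"
  shows integrable_hoeffding_comp_powr: "integrable (power_space {1..n}) (\<lambda>x. \<bar>hoeffding_comp A x\<bar> powr p)"
    and integral_hoeffding_comp_powr_le: "(\<integral>x. \<bar>hoeffding_comp A x\<bar> powr p \<partial>power_space {1..n})
      \<le> (16 ^ d) powr (p / 2) * (\<integral>x. \<bar>\<Phi> x\<bar> powr p \<partial>power_space {1..d})"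
proof -
  note fin = finite_subset_Icc[OF A(1)]
  let ?S = "\<lambda>x. real (card (Pow A)) powr p * (\<Sum>B\<in>Pow A. \<bar>proj_kernel B x\<bar> powr p)"
  have le: "\<bar>hoeffding_comp A x\<bar> powr p \<le> ?S x" for x
  proof -
    have "\<bar>hoeffding_comp A x\<bar> powr p
        \<le> real (card (Pow A)) powr p * (\<Sum>B\<in>Pow A. \<bar>(-1) ^ (card A - card B) * proj_kernel B x\<bar> powr p)"
      unfolding hoeffding_comp_def alt_sum_def using fin p by (intro powr_abs_sum_le) auto
    then show ?thesis by (simp add: abs_mult power_abs)
  qed
  have iW: "integrable (power_space {1..n}) (\<lambda>x. \<bar>proj_kernel B x\<bar> powr p)" if "B \<in> Pow A" for B
    using that A p i by (intro integrable_proj_kernel_powr) auto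
  have iS: "integrable (power_space {1..n}) ?S"
    by (intro integrable_mult_right Bochner_Integration.integrable_sum iW)
  show int: "integrable (power_space {1..n}) (\<lambda>x. \<bar>hoeffding_comp A x\<bar> powr p)"
  proof (rule Bochner_Integration.integrable_bound[OF iS])
    show "AE x in power_space {1..n}. norm (\<bar>hoeffding_comp A x\<bar> powr p) \<le> norm (?S x)"
      unfolding real_norm_def abs_of_nonneg[OF powr_ge_zero]
      by (rule AE_I2) (rule order_trans[OF le abs_ge_self])
  qed (use measurable_hoeffding_comp[OF A(1)] in measurable)
  let ?I = "\<integral>x. \<bar>\<Phi> x\<bar> powr p \<partial>power_space {1..d}"
  have "(\<integral>x. \<bar>hoeffding_comp A x\<bar> powr p \<partial>power_space {1..n}) \<le> (\<integral>x. ?S x \<partial>power_space {1..n})"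
    by (intro integral_mono int iS le)
  also have "\<dots> = real (card (Pow A)) powr p *
      (\<Sum>B\<in>Pow A. \<integral>x. \<bar>proj_kernel B x\<bar> powr p \<partial>power_space {1..n})"
    by (simp add: Bochner_Integration.integral_sum iW)
  also have "\<dots> \<le> real (card (Pow A)) powr p * (\<Sum>B\<in>Pow A. ?I)"
    using A p i by (intro mult_left_mono sum_mono integral_proj_kernel_powr_le) auto
  also have "\<dots> = (2 ^ card A) powr p * 2 ^ card A * ?I" using fin by (simp add: card_Pow)
  also have "\<dots> \<le> (16 ^ d) powr (p / 2) * ?I"
  proof (rule mult_right_mono)
    have 1: "(2::real) ^ card A \<le> 2 ^ d" using A by (intro power_increasing) auto
    have "(1::real) \<le> 2 ^ d" by simp
    then have "(2::real) ^ d \<le> (2 ^ d) powr p" using p powr_mono[of 1 p "2 ^ d :: real"] by simp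
    with 1 have "(2::real) ^ card A \<le> (2 ^ d) powr p" by linarith
    with 1 have "(2 ^ card A) powr p * 2 ^ card A \<le> (2 ^ d) powr p * (2 ^ d :: real) powr p"
      using p by (intro mult_mono powr_mono2) auto
    also have "\<dots> = (4 ^ d) powr p" by (simp add: powr_mult[symmetric] power_mult_distrib[symmetric])
    also have "(4::real) ^ d = (16 ^ d) powr (1 / 2)"
    proof -
      have "(16::real) ^ d = (4 ^ d)\<^sup>2" by (simp add: power2_eq_square power_mult_distrib[symmetric])
      then show ?thesis by (simp add: powr_half_sqrt)
    qed
    finally show "(2 ^ card A) powr p * 2 ^ card A \<le> (16 ^ d :: real) powr (p / 2)"
      by (simp add: powr_powr)
  qed simp
  finally show "(\<integral>x. \<bar>hoeffding_comp A x\<bar> powr p \<partial>power_space {1..n}) \<le> (16 ^ d) powr (p / 2) * ?I" .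
qed

end

section \<open>Degeneracy of the Hoeffding components\<close>

context symmetric_kernel
begin

text \<open>By Fubini both sides are integrals over \<open>n + d\<close> coordinates in which the arguments not in
  \<open>B\<close> are fresh; the two integrands differ by exchanging \<open>k\<close> with one of the fresh coordinates.\<close>

lemma integral_mult_proj_kernel_insert:
  fixes p :: real and X :: "(nat \<Rightarrow> 'x) \<Rightarrow> real"
  defines "h \<equiv> \<lambda>x. sgn (X x) * \<bar>X x\<bar> powr (p - 1)"
  assumes p: "1 \<le> p" and i\<Phi>: "integrable (power_space {1..d}) (\<lambda>x. \<bar>\<Phi> x\<bar> powr p)"
    and mX [measurable]: "X \<in> borel_measurable (power_space {1..n})"
    and iX: "integrable (power_space {1..n}) (\<lambda>x. \<bar>X x\<bar> powr p)"
    and indep: "\<And>x x'. (\<And>i. i \<in> {1..n} \<Longrightarrow> i \<noteq> k \<Longrightarrow> x i = x' i) \<Longrightarrow> X x = X x'"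
    and B: "B \<subseteq> {1..n}" "k \<in> {1..n}" "k \<notin> B" "card B < d"
  shows "(\<integral>x. h x * proj_kernel (insert k B) x \<partial>power_space {1..n})
    = (\<integral>x. h x * proj_kernel B x \<partial>power_space {1..n})"
proof -
  have fin: "finite B" using B(1) by (rule finite_subset_Icc)
  define b where "b = card B"
  \<comment> \<open>The fresh coordinate that feeds argument \<open>b + 1\<close> under
    \<open>f\<close>. Under \<open>f1\<close> that argument is fed by \<open>k\<close>, so swapping
    \<open>k\<close> and \<open>j\<close> turns \<open>f\<close> into \<open>f1\<close>;
    \<open>card B < d\<close> keeps \<open>j\<close> within \<open>n + d\<close>.\<close>
  define j where "j = n + (b + 1)"
  define e where "e = enum_set B"
  define e1 where "e1 = e(b + 1 := k)"
  define f where "f = lift_index {1..b} e n"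
  define f1 where "f1 = lift_index {1..b+1} e1 n"
  define \<tau> where "\<tau> = Transposition.transpose k j"
  have inj_e: "inj_on e {1..b}" and im_e: "e ` {1..b} = B"
    using inj_on_enum_set[OF fin] enum_set_image[OF fin] by (simp_all add: e_def b_def)
  have Icc: "{1..b+1} = insert (b + 1) {1..b}" by auto
  have e1_eq: "s \<in> {1..b} \<Longrightarrow> e1 s = e s" for s by (auto simp: e1_def)
  have e1_image: "e1 ` {1..b} = B"
    unfolding im_e[symmetric] by (intro image_cong refl e1_eq)
  have "inj_on e1 {1..b}" using inj_e inj_on_cong[of "{1..b}" e1 e] e1_eq by blast
  moreover have "e1 (b + 1) \<notin> e1 ` {1..b}" unfolding e1_image using B(3) by (simp add: e1_def)
  moreover have "{1..b} - {b + 1} = {1..b}" by auto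
  ultimately have inj_e1: "inj_on e1 {1..b+1}" unfolding Icc inj_on_insert by simp
  have im_e1: "e1 ` {1..b+1} = insert k B"
    unfolding Icc image_insert e1_image by (simp add: e1_def)
  have sub: "e ` {1..b} \<subseteq> {1..n}" "e1 ` {1..b+1} \<subseteq> {1..n}" using im_e im_e1 B by auto
  have j: "j \<in> {1..n+d}" "n < j" using B(4) by (auto simp: j_def b_def)
  have \<tau>f: "\<tau> (f s) = f1 s" if s: "s \<in> {1..d}" for s
  proof -
    consider "s \<in> {1..b}" | "s = b + 1" | "s > b + 1" using s by fastforce
    then show ?thesis
    proof cases
      case 1
      then have "e s \<in> B" using im_e by auto
      then have "e s \<noteq> k" "e s \<noteq> j" using B j by auto
      then show ?thesis using 1 by (simp add: \<tau>_def f_def f1_def lift_index_def e1_eq transpose_apply_other)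
    next
      case 2
      then show ?thesis by (simp add: \<tau>_def f_def f1_def lift_index_def e1_def j_def)
    next
      case 3
      then have "n + s \<noteq> k" "n + s \<noteq> j" using B(2) by (auto simp: j_def)
      then show ?thesis using 3 by (simp add: \<tau>_def f_def f1_def lift_index_def transpose_apply_other)
    qed
  qed
  have f: "inj_on f {1..d}" "f ` {1..d} \<subseteq> {1..n+d}" and f1: "inj_on f1 {1..d}" "f1 ` {1..d} \<subseteq> {1..n+d}"
    unfolding f_def f1_def using sub inj_e inj_e1 by (auto intro!: inj_on_lift_index dest: subsetD[OF lift_index_image])
  have restr: "distr (power_space {1..n+d}) (power_space {1..n}) (\<lambda>z. restrict z {1..n}) = power_space {1..n}"
    using distr_reindex[of "\<lambda>i. i" "{1..n}" "{1..n+d}"] by auto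
  have mr [measurable]: "(\<lambda>z. restrict z {1..n}) \<in> power_space {1..n+d} \<rightarrow>\<^sub>M power_space {1..n}"
    using measurable_reindex[of "\<lambda>i. i" "{1..n}" "{1..n+d}"] by auto
  have mX' [measurable]: "(\<lambda>z. X (restrict z {1..n})) \<in> borel_measurable (power_space {1..n+d})"
    by measurable
  have iX': "integrable (power_space {1..n+d}) (\<lambda>z. \<bar>X (restrict z {1..n})\<bar> powr p)"
    using iX by (subst (asm) restr[symmetric]) (subst (asm) integrable_distr_eq[OF mr], auto)
  let ?F = "\<lambda>f z. h (restrict z {1..n}) * \<Phi> (\<lambda>s\<in>{1..d}. z (f s))"
  have iF: "integrable (power_space {1..n+d}) (?F g)"
    if "inj_on g {1..d}" "g ` {1..d} \<subseteq> {1..n+d}" for g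
    unfolding h_def using p that i\<Phi>
    by (intro integrable_powr_cross1 mX' iX' measurable_kernel_reindex integrable_kernel_reindex) auto
  have "inj_on \<tau> {1..n+d}" unfolding \<tau>_def by (rule inj_on_transpose)
  moreover have "\<tau> ` {1..n+d} \<subseteq> {1..n+d}" using j B(2) by (auto simp: \<tau>_def transpose_def)
  ultimately have \<tau>: "inj_on \<tau> {1..n+d}" "\<tau> ` {1..n+d} \<subseteq> {1..n+d}" by auto
  have \<tau>n: "\<tau> i = i" if "i \<in> {1..n}" "i \<noteq> k" for i
    using that j by (auto simp: \<tau>_def transpose_def)
  \<comment> \<open>\<open>X\<close> ignores coordinate \<open>k\<close>, and \<open>j > n\<close>
    is cut off by the restriction.\<close>
  have h_inv: "h (restrict (\<lambda>i\<in>{1..n+d}. z (\<tau> i)) {1..n}) = h (restrict z {1..n})" for z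
  proof -
    have "X (restrict (\<lambda>i\<in>{1..n+d}. z (\<tau> i)) {1..n}) = X (restrict z {1..n})"
      by (rule indep) (auto simp: \<tau>n)
    then show ?thesis by (simp add: h_def)
  qed
  have \<Phi>_inv: "(\<lambda>s\<in>{1..d}. (\<lambda>i\<in>{1..n+d}. z (\<tau> i)) (f s)) = (\<lambda>s\<in>{1..d}. z (f1 s))" for z
  proof
    fix s show "(\<lambda>s\<in>{1..d}. (\<lambda>i\<in>{1..n+d}. z (\<tau> i)) (f s)) s = (\<lambda>s\<in>{1..d}. z (f1 s)) s"
    proof (cases "s \<in> {1..d}")
      case True
      then have "f s \<in> {1..n+d}" using f(2) by blast
      then show ?thesis using True \<tau>f[OF True] by simp
    qed auto
  qed
  have "(\<integral>x. h x * proj_kernel B x \<partial>power_space {1..n}) = (\<integral>z. ?F f z \<partial>power_space {1..n+d})"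
    unfolding proj_kernel_def b_def[symmetric] e_def[symmetric] f_def
    using sub iF[OF f] by (intro integral_mult_cond_kernel) (auto simp: f_def)
  also have "\<dots> = (\<integral>z. ?F f (\<lambda>i\<in>{1..n+d}. z (\<tau> i)) \<partial>power_space {1..n+d})"
    by (subst distr_reindex[OF \<tau>, symmetric], subst integral_distr)
       (use iF[OF f] \<tau> in \<open>auto intro!: measurable_reindex\<close>)
  also have "\<dots> = (\<integral>z. ?F f1 z \<partial>power_space {1..n+d})"
    by (simp only: h_inv \<Phi>_inv)
  also have "\<dots> = (\<integral>x. h x * cond_kernel {1..b+1} e1 x \<partial>power_space {1..n})"
    unfolding f1_def
    using sub iF[OF f1] by (intro integral_mult_cond_kernel[symmetric]) (auto simp: f1_def)
  \<comment> \<open>\<open>e1\<close> puts \<open>k\<close> last instead of listing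
    \<open>insert k B\<close> in order; by symmetry this makes no difference.\<close>
  also have "\<dots> = (\<integral>x. h x * proj_kernel (insert k B) x \<partial>power_space {1..n})"
  proof (rule Bochner_Integration.integral_cong[OF refl])
    fix x assume x: "x \<in> space (power_space {1..n})"
    have "proj_kernel (e1 ` {1..b+1}) x = cond_kernel {1..b+1} e1 x"
    proof (rule proj_kernel_eq)
      show "{1..b+1} \<subseteq> {1..d}" using B(4) by (auto simp: b_def)
      show "x i \<in> space P" if "i \<in> e1 ` {1..b+1}" for i
        using x sub that by (auto simp: space_PiM PiE_iff)
    qed (rule inj_e1)
    then show "h x * cond_kernel {1..b+1} e1 x = h x * proj_kernel (insert k B) x"
      unfolding im_e1 by simp
  qed
  finally show ?thesis by simp
qed

text \<open>In direction \<open>k\<close> the component is an alternating sum of differences between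
  the projections on \<open>insert k B\<close> and on \<open>B\<close>, and each difference
  integrates to \<open>0\<close> against a function that ignores \<open>k\<close>. The test function
  is the one \<open>moment_sum_le\<close> asks for; \<open>p = 2\<close> gives ordinary
  orthogonality.\<close>

lemma hoeffding_comp_orthogonal:
  fixes p :: real and X :: "(nat \<Rightarrow> 'x) \<Rightarrow> real"
  assumes p: "1 \<le> p" and i\<Phi>: "integrable (power_space {1..d}) (\<lambda>x. \<bar>\<Phi> x\<bar> powr p)"
    and mX [measurable]: "X \<in> borel_measurable (power_space {1..n})"
    and iX: "integrable (power_space {1..n}) (\<lambda>x. \<bar>X x\<bar> powr p)"
    and indep: "\<And>x x'. (\<And>i. i \<in> {1..n} \<Longrightarrow> i \<noteq> k \<Longrightarrow> x i = x' i) \<Longrightarrow> X x = X x'"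
    and A: "A \<subseteq> {1..n}" "k \<in> A" "card A \<le> d"
  shows "(\<integral>x. sgn (X x) * \<bar>X x\<bar> powr (p - 1) * hoeffding_comp A x \<partial>power_space {1..n}) = 0"
proof -
  define A0 where "A0 = A - {k}"
  have fin: "finite A" using A(1) by (rule finite_subset_Icc)
  have A0: "A = insert k A0" "k \<notin> A0" "finite A0" "A0 \<subseteq> {1..n}" "card A = Suc (card A0)"
    using A fin card_Suc_Diff1[OF fin A(2)] by (auto simp: A0_def)
  let ?h = "\<lambda>x. sgn (X x) * \<bar>X x\<bar> powr (p - 1)"
  have i: "integrable (power_space {1..n}) (\<lambda>x. ?h x * proj_kernel B x)" if "B \<subseteq> {1..n}" for B
    using p i\<Phi> that
    by (intro integrable_powr_cross1 mX iX measurable_proj_kernel integrable_proj_kernel_powr)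
  have "(\<integral>x. ?h x * hoeffding_comp A x \<partial>power_space {1..n})
      = (\<integral>x. (\<Sum>B\<in>Pow A0. (-1) ^ (card A0 - card B) *
          (?h x * proj_kernel (insert k B) x - ?h x * proj_kernel B x)) \<partial>power_space {1..n})"
    unfolding hoeffding_comp_def A0(1) alt_sum_insert[OF A0(3,2)]
    by (simp add: alt_sum_def sum_distrib_left algebra_simps)
  also have "\<dots> = (\<Sum>B\<in>Pow A0. (-1) ^ (card A0 - card B) *
      ((\<integral>x. ?h x * proj_kernel (insert k B) x \<partial>power_space {1..n})
        - (\<integral>x. ?h x * proj_kernel B x \<partial>power_space {1..n})))"
  proof -
    have "insert k B \<subseteq> {1..n}" "B \<subseteq> {1..n}" if "B \<in> Pow A0" for B using that A0 A by auto
    then show ?thesis by (subst Bochner_Integration.integral_sum) (simp_all add: i)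
  qed
  also have "\<dots> = 0"
  proof (intro sum.neutral ballI)
    fix B assume B: "B \<in> Pow A0"
    have "card B < d" using card_mono[OF A0(3), of B] B A0(5) A(3) by simp
    then have "(\<integral>x. ?h x * proj_kernel (insert k B) x \<partial>power_space {1..n})
        = (\<integral>x. ?h x * proj_kernel B x \<partial>power_space {1..n})"
      using B A A0 by (intro integral_mult_proj_kernel_insert[OF p i\<Phi> mX iX indep]) auto
    then show "(-1) ^ (card A0 - card B) * ((\<integral>x. ?h x * proj_kernel (insert k B) x \<partial>power_space {1..n})
        - (\<integral>x. ?h x * proj_kernel B x \<partial>power_space {1..n})) = 0" by simp
  qed
  finally show ?thesis .
qed

text \<open>Conditioning on all \<open>d\<close> arguments returns the kernel, and Moebius inversion
  expands it. Being algebraic, the identity holds at every point of the space, even where some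
  average takes its default value.\<close>

lemma kernel_at_tuple_eq_sum:
  assumes I: "I \<subseteq> {1..n}" "card I = d" and x: "x \<in> space (power_space {1..n})"
    and e: "inj_on e {1..d}" "e ` {1..d} = I"
  shows "\<Phi> (\<lambda>s\<in>{1..d}. x (e s)) = (\<Sum>A\<in>Pow I. hoeffding_comp A x)"
proof -
  interpret D: prob_space "power_space {1..d}" by (rule prob_power_space)
  have "fill {1..d} e x y = (\<lambda>s\<in>{1..d}. x (e s))" for y by (rule ext) (simp add: fill_def)
  then have "\<Phi> (\<lambda>s\<in>{1..d}. x (e s)) = cond_kernel {1..d} e x"
    by (simp add: cond_kernel_def D.prob_space)
  also have "\<dots> = proj_kernel I x"
    unfolding e(2)[symmetric] using e I x by (intro proj_kernel_eq[symmetric]) (auto simp: space_PiM PiE_iff)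
  also have "\<dots> = (\<Sum>A\<in>Pow I. hoeffding_comp A x)"
    unfolding hoeffding_comp_def using sum_alt_sum[of I "\<lambda>B. proj_kernel B x"] I
    by (simp add: finite_subset_Icc)
  finally show ?thesis .
qed

text \<open>The bridge to the definition of the rank: the enumeration of \<open>A\<close> carries
  subsets of \<open>{1..card A}\<close> to subsets of \<open>A\<close>.\<close>

lemma hoeffding_g_eq_comp:
  assumes A: "A \<subseteq> {1..n}" "card A \<le> d" and x: "x \<in> space (power_space {1..n})"
  shows "hoeffding_g d P \<Phi> (card A) (\<lambda>s\<in>{1..card A}. x (enum_set A s)) = hoeffding_comp A x"
proof -
  let ?m = "card A" and ?x = "\<lambda>s\<in>{1..card A}. x (enum_set A s)"
  have fin: "finite A" using A(1) by (rule finite_subset_Icc)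
  have bij: "bij_betw (enum_set A) {1..?m} A" by (rule bij_betw_enum_set[OF fin])
  have inj: "inj_on (enum_set A) B" if "B \<subseteq> {1..?m}" for B
    using bij that by (auto simp: bij_betw_def intro: inj_on_subset)
  have xA: "x (enum_set A s) \<in> space P" if "s \<in> {1..?m}" for s
  proof -
    have "enum_set A s \<in> {1..n}" using bij_betwE[OF bij] that A(1) by blast
    then show ?thesis using x by (auto simp: space_PiM PiE_iff)
  qed
  have "hoeffding_g d P \<Phi> ?m ?x = (\<Sum>B\<in>Pow {1..?m}. (-1) ^ (?m - card B) * proj_kernel (enum_set A ` B) x)"
    unfolding hoeffding_g_def
  proof (intro sum.cong refl arg_cong2[where f = "(*)"])
    fix B assume B: "B \<in> Pow {1..?m}"
    have "(\<integral>y. \<Phi> y \<partial>PiM {1..d} (\<lambda>s. if s \<in> B then return P (?x s) else P)) = cond_kernel B (\<lambda>s. s) ?x"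
      using B A xA by (intro integral_hoeffding_measure) auto
    also have "\<dots> = cond_kernel B (enum_set A) x" using B by (intro cond_kernel_cong) auto
    also have "\<dots> = proj_kernel (enum_set A ` B) x"
      using B A xA by (intro proj_kernel_eq[symmetric] inj) auto
    finally show "(\<integral>y. \<Phi> y \<partial>PiM {1..d} (\<lambda>s. if s \<in> B then return P (?x s) else P))
        = proj_kernel (enum_set A ` B) x" .
  qed
  also have "\<dots> = (\<Sum>B\<in>Pow {1..?m}. (-1) ^ (?m - card (enum_set A ` B)) * proj_kernel (enum_set A ` B) x)"
    using inj by (intro sum.cong refl) (auto simp: card_image)
  also have "\<dots> = (\<Sum>B\<in>Pow A. (-1) ^ (?m - card B) * proj_kernel B x)"
    using sum.reindex_bij_betw[OF bij_betw_Pow[OF bij], of "\<lambda>B. (-1) ^ (?m - card B) * proj_kernel B x"] by simp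
  finally show ?thesis by (simp add: hoeffding_comp_def alt_sum_def)
qed

end

section \<open>Moments and variance of sums of Hoeffding components\<close>

text \<open>The proportion of \<open>d\<close>-subsets of \<open>{1..n}\<close> that contain a given
  \<open>m\<close>-subset, equal to \<open>(d choose m) / (n choose m)\<close> for
  \<open>m \<le> d \<le> n\<close>.\<close>

definition hoeffding_weight :: "nat \<Rightarrow> nat \<Rightarrow> nat \<Rightarrow> real" where
  "hoeffding_weight d n m = real ((n - m) choose (d - m)) / real (n choose d)"

lemma hoeffding_weight_mult_choose:
  assumes "m \<le> d" "d \<le> n"
  shows "hoeffding_weight d n m * real (n choose m) = real (d choose m)"
proof -
  have "(n choose d) * (d choose m) = (n choose m) * ((n - m) choose (d - m))"
    using assms by (rule choose_mult)
  then have "real (n choose d) * real (d choose m) = real (n choose m) * real ((n - m) choose (d - m))"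
    by (metis of_nat_mult)
  moreover have "0 < n choose d" using assms by (simp add: zero_less_binomial)
  ultimately show ?thesis by (simp add: hoeffding_weight_def field_simps)
qed

text \<open>The left side equals \<open>(d choose m)^2 / (n choose m)\<close>, and
  \<open>n choose r \<le> (n choose m) * (m choose r)\<close> because every \<open>r\<close>-set
  extends to an \<open>m\<close>-set. Hence no size above the rank exceeds the order
  \<open>1 / (n choose r)\<close>.\<close>

lemma hoeffding_weight_square_le:
  assumes "r \<le> m" "m \<le> d" "d \<le> n"
  shows "real (n choose m) * (hoeffding_weight d n m)\<^sup>2
     \<le> (real (d choose m))\<^sup>2 * real (m choose r) / real (n choose r)"
proof -
  have pos: "0 < real (n choose m)" "0 < real (n choose r)" using assms by (auto simp: zero_less_binomial)
  have w: "hoeffding_weight d n m = real (d choose m) / real (n choose m)"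
    using hoeffding_weight_mult_choose[of m d n] assms pos by (simp add: field_simps)
  have "(n choose m) * (m choose r) = (n choose r) * ((n - r) choose (m - r))"
    using assms by (intro choose_mult) auto
  moreover have "0 < (n - r) choose (m - r)" using assms by (intro zero_less_binomial) auto
  then have "1 \<le> (n - r) choose (m - r)" by linarith
  ultimately have "n choose r \<le> (n choose m) * (m choose r)"
    using mult_le_mono2[of 1 "(n - r) choose (m - r)" "n choose r"] by simp
  then have le: "real (n choose r) \<le> real (n choose m) * real (m choose r)"
    by (metis of_nat_le_iff of_nat_mult)
  have "real (n choose m) * (hoeffding_weight d n m)\<^sup>2 = (real (d choose m))\<^sup>2 * (1 / real (n choose m))"
    using pos by (simp add: w power2_eq_square)
  also have "\<dots> \<le> (real (d choose m))\<^sup>2 * (real (m choose r) / real (n choose r))"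
    using le pos by (intro mult_left_mono) (simp_all add: field_simps)
  finally show ?thesis by simp
qed

definition hoeffding_sets :: "nat \<Rightarrow> nat \<Rightarrow> nat \<Rightarrow> nat set set" where
  "hoeffding_sets r d n = {A. A \<subseteq> {1..n} \<and> r \<le> card A \<and> card A \<le> d}"

lemma finite_hoeffding_sets: "finite (hoeffding_sets r d n)"
  by (rule finite_subset[of _ "Pow {1..n}"]) (auto simp: hoeffding_sets_def)

lemma sum_hoeffding_sets:
  fixes g :: "nat \<Rightarrow> real"
  shows "(\<Sum>A\<in>hoeffding_sets r d n. g (card A)) = (\<Sum>m=r..d. real (n choose m) * g m)"
proof -
  have "(\<Sum>A\<in>hoeffding_sets r d n. g (card A))
      = (\<Sum>m=r..d. \<Sum>A | A \<in> hoeffding_sets r d n \<and> card A = m. g (card A))"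
    by (rule sum.group[symmetric]) (auto simp: finite_hoeffding_sets, auto simp: hoeffding_sets_def)
  also have "\<dots> = (\<Sum>m=r..d. real (n choose m) * g m)"
  proof (rule sum.cong[OF refl])
    fix m assume "m \<in> {r..d}"
    then have "{A. A \<in> hoeffding_sets r d n \<and> card A = m} = {A. A \<subseteq> {1..n} \<and> card A = m}"
      by (auto simp: hoeffding_sets_def)
    then show "(\<Sum>A | A \<in> hoeffding_sets r d n \<and> card A = m. g (card A)) = real (n choose m) * g m"
      using n_subsets[of "{1..n}" m] by simp
  qed
  finally show ?thesis .
qed

text \<open>\<open>16 ^ d\<close> compares a component with the kernel, the power of
  \<open>2 * smooth_const b\<close> is the price of splitting along at most \<open>d\<close>
  coordinates per set, and the sum collects the squared weights by size.\<close>

definition moment_const :: "real \<Rightarrow> nat \<Rightarrow> nat \<Rightarrow> real" where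
  "moment_const b r d = 16 ^ d * (2 * smooth_const b) ^ d
     * (\<Sum>m=r..d. (real (d choose m))\<^sup>2 * real (m choose r))"

lemma moment_const_nonneg: "0 \<le> b \<Longrightarrow> 0 \<le> moment_const b r d"
  using smooth_const_ge_1[of b] by (auto simp: moment_const_def intro!: mult_nonneg_nonneg sum_nonneg)

text \<open>Passing from \<open>smooth_const p\<close> to \<open>smooth_const b\<close> makes the
  bound the same for all \<open>p\<close>; it is here that \<open>b\<close> has to be
  finite.\<close>

lemma sum_hoeffding_weight_le:
  assumes p: "2 \<le> p" "p \<le> b" and n: "d \<le> n"
  shows "(\<Sum>A\<in>hoeffding_sets r d n. (2 * smooth_const p) ^ card A * (16 ^ d * (hoeffding_weight d n (card A))\<^sup>2))
    \<le> moment_const b r d / real (n choose r)"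
proof -
  let ?K = "2 * smooth_const b"
  have K: "1 \<le> smooth_const p" "smooth_const p \<le> smooth_const b"
    using smooth_const_ge_1[of p] smooth_const_mono[of p b] p by auto
  have "(\<Sum>A\<in>hoeffding_sets r d n. (2 * smooth_const p) ^ card A * (16 ^ d * (hoeffding_weight d n (card A))\<^sup>2))
     = (\<Sum>m=r..d. real (n choose m) * ((2 * smooth_const p) ^ m * (16 ^ d * (hoeffding_weight d n m)\<^sup>2)))"
    by (rule sum_hoeffding_sets)
  also have "\<dots> \<le> (\<Sum>m=r..d. 16 ^ d * ?K ^ d * ((real (d choose m))\<^sup>2 * real (m choose r) / real (n choose r)))"
  proof (rule sum_mono)
    fix m assume m: "m \<in> {r..d}"
    have "(2 * smooth_const p) ^ m \<le> ?K ^ m" using K by (intro power_mono) auto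
    also have "\<dots> \<le> ?K ^ d" using K m by (intro power_increasing) auto
    finally have "(2 * smooth_const p) ^ m * (real (n choose m) * (hoeffding_weight d n m)\<^sup>2)
        \<le> ?K ^ d * ((real (d choose m))\<^sup>2 * real (m choose r) / real (n choose r))"
      using K m n by (intro mult_mono hoeffding_weight_square_le) auto
    then have "16 ^ d * ((2 * smooth_const p) ^ m * (real (n choose m) * (hoeffding_weight d n m)\<^sup>2))
        \<le> 16 ^ d * (?K ^ d * ((real (d choose m))\<^sup>2 * real (m choose r) / real (n choose r)))"
      by (rule mult_left_mono) simp
    then show "real (n choose m) * ((2 * smooth_const p) ^ m * (16 ^ d * (hoeffding_weight d n m)\<^sup>2))
      \<le> 16 ^ d * ?K ^ d * ((real (d choose m))\<^sup>2 * real (m choose r) / real (n choose r))"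
      by (simp only: mult_ac)
  qed
  also have "\<dots> = moment_const b r d / real (n choose r)"
    by (simp add: moment_const_def sum_distrib_left sum_divide_distrib)
  finally show ?thesis .
qed

context symmetric_kernel
begin

text \<open>The kernel at each tuple is expanded over the subsets of its range; exchanging the sums
  counts the tuples that share a given \<open>A\<close>.\<close>

lemma U_stat_eq_hoeffding_sum:
  assumes x: "x \<in> space (power_space {1..n})"
  shows "(\<Sum>i\<in>incr_tuples d n. \<Phi> (\<lambda>s\<in>{1..d}. x (i s))) / real (n choose d)
    = (\<Sum>A\<in>hoeffding_sets 0 d n. hoeffding_weight d n (card A) * hoeffding_comp A x)"
proof -
  have "(\<Sum>i\<in>incr_tuples d n. \<Phi> (\<lambda>s\<in>{1..d}. x (i s)))
      = (\<Sum>i\<in>incr_tuples d n. \<Sum>A\<in>Pow (i ` {1..d}). hoeffding_comp A x)"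
  proof (rule sum.cong[OF refl])
    fix i assume "i \<in> incr_tuples d n"
    then have "inj_on i {1..d}" "i ` {1..d} \<subseteq> {1..n}"
      by (auto simp: incr_tuples_def strict_mono_on_imp_inj_on)
    then show "\<Phi> (\<lambda>s\<in>{1..d}. x (i s)) = (\<Sum>A\<in>Pow (i ` {1..d}). hoeffding_comp A x)"
      using x by (intro kernel_at_tuple_eq_sum) (auto simp: card_image)
  qed
  also have "\<dots> = (\<Sum>I | I \<subseteq> {1..n} \<and> card I = d. \<Sum>A\<in>Pow I. hoeffding_comp A x)"
    by (rule sum.reindex_bij_betw[OF bij_betw_incr_tuples])
  also have "\<dots> = (\<Sum>A\<in>hoeffding_sets 0 d n. real ((n - card A) choose (d - card A)) * hoeffding_comp A x)"
    unfolding sum_Pow_card_eq hoeffding_sets_def by simp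
  finally show ?thesis by (simp add: hoeffding_weight_def sum_divide_distrib)
qed

lemma hoeffding_sum_cong:
  assumes "\<X> \<subseteq> hoeffding_sets r d n" "\<And>A. A \<in> \<X> \<Longrightarrow> k \<notin> A"
    and "\<And>i. i \<in> {1..n} \<Longrightarrow> i \<noteq> k \<Longrightarrow> x i = x' i"
  shows "(\<Sum>A\<in>\<X>. w A * hoeffding_comp A x) = (\<Sum>A\<in>\<X>. w A * hoeffding_comp A x')"
proof (intro sum.cong refl arg_cong2[where f = "(*)"] hoeffding_comp_cong)
  fix A assume A: "A \<in> \<X>"
  then have "A \<subseteq> {1..n}" using assms(1) by (auto simp: hoeffding_sets_def)
  then show "finite A" by (rule finite_subset_Icc)
  show "x i = x' i" if "i \<in> A" for i
    using \<open>A \<subseteq> {1..n}\<close> assms(2)[OF A] that by (intro assms(3)) auto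
qed

lemma measurable_hoeffding_sum:
  assumes "\<X> \<subseteq> hoeffding_sets r d n"
  shows "(\<lambda>x. \<Sum>A\<in>\<X>. w A * hoeffding_comp A x) \<in> borel_measurable (power_space {1..n})"
  using assms
  by (intro borel_measurable_sum borel_measurable_times borel_measurable_const measurable_hoeffding_comp)
     (auto simp: hoeffding_sets_def)

lemma integrable_hoeffding_sum_powr:
  fixes p :: real
  assumes \<X>: "\<X> \<subseteq> hoeffding_sets r d n" and p: "1 \<le> p"
    and i: "integrable (power_space {1..d}) (\<lambda>x. \<bar>\<Phi> x\<bar> powr p)"
  shows "integrable (power_space {1..n}) (\<lambda>x. \<bar>\<Sum>A\<in>\<X>. w A * hoeffding_comp A x\<bar> powr p)"
proof -
  have fin: "finite \<X>" using \<X> finite_hoeffding_sets by (rule finite_subset)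
  let ?S = "\<lambda>x. real (card \<X>) powr p * (\<Sum>A\<in>\<X>. \<bar>w A\<bar> powr p * \<bar>hoeffding_comp A x\<bar> powr p)"
  have le: "\<bar>\<Sum>A\<in>\<X>. w A * hoeffding_comp A x\<bar> powr p \<le> ?S x" for x
    using powr_abs_sum_le[OF fin, of p "\<lambda>A. w A * hoeffding_comp A x"] p by (simp add: abs_mult powr_mult)
  have iS: "integrable (power_space {1..n}) ?S"
    using \<X> p i
    by (intro integrable_mult_right Bochner_Integration.integrable_sum integrable_hoeffding_comp_powr)
       (auto simp: hoeffding_sets_def)
  show ?thesis
  proof (rule Bochner_Integration.integrable_bound[OF iS])
    show "AE x in power_space {1..n}. norm (\<bar>\<Sum>A\<in>\<X>. w A * hoeffding_comp A x\<bar> powr p) \<le> norm (?S x)"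
      unfolding real_norm_def abs_of_nonneg[OF powr_ge_zero]
      by (rule AE_I2) (rule order_trans[OF le abs_ge_self])
  qed (use measurable_hoeffding_sum[OF \<X>] in measurable)
qed

lemma hoeffding_sum_moment_le:
  fixes p b :: real
  assumes p: "2 \<le> p" "p \<le> b" and n: "d \<le> n"
    and i: "integrable (power_space {1..d}) (\<lambda>x. \<bar>\<Phi> x\<bar> powr p)"
  shows "(\<integral>x. \<bar>\<Sum>A\<in>hoeffding_sets r d n. hoeffding_weight d n (card A) * hoeffding_comp A x\<bar> powr p
        \<partial>power_space {1..n})
    \<le> (moment_const b r d / real (n choose r)) powr (p / 2) * (\<integral>x. \<bar>\<Phi> x\<bar> powr p \<partial>power_space {1..d})"
proof -
  let ?w = "\<lambda>A. hoeffding_weight d n (card A)"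
  let ?f = "\<lambda>A x. ?w A * hoeffding_comp A x"
  let ?\<A> = "hoeffding_sets r d n"
  define a where "a = (\<integral>x. \<bar>\<Phi> x\<bar> powr p \<partial>power_space {1..d})"
  \<comment> \<open>The squared \<open>L_p\<close> norm of the kernel, chosen so that
    \<open>c A\<close> bounds the squared norm of the weighted component.\<close>
  define a2 where "a2 = a powr (2 / p)"
  have a: "0 \<le> a" by (simp add: a_def)
  have a2: "a2 powr (p / 2) = a" using a p by (simp add: a2_def powr_powr)
  have w0: "0 \<le> ?w A" for A by (simp add: hoeffding_weight_def)
  define c where "c A = 16 ^ d * (?w A)\<^sup>2 * a2" for A :: "nat set"
  have int: "integrable (power_space {1..n}) (\<lambda>x. \<bar>?f A x\<bar> powr p)" if "A \<in> ?\<A>" for A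
    using that p i by (auto simp: abs_mult powr_mult hoeffding_sets_def intro!: integrable_hoeffding_comp_powr)
  have bnd: "(\<integral>x. \<bar>?f A x\<bar> powr p \<partial>power_space {1..n}) \<le> c A powr (p / 2)" if A: "A \<in> ?\<A>" for A
  proof -
    have "(\<integral>x. \<bar>?f A x\<bar> powr p \<partial>power_space {1..n})
        = ?w A powr p * (\<integral>x. \<bar>hoeffding_comp A x\<bar> powr p \<partial>power_space {1..n})"
      using w0[of A] by (simp add: abs_mult powr_mult)
    also have "\<dots> \<le> ?w A powr p * ((16 ^ d) powr (p / 2) * a)"
      unfolding a_def using A p i
      by (intro mult_left_mono integral_hoeffding_comp_powr_le) (auto simp: hoeffding_sets_def)
    also have "\<dots> = c A powr (p / 2)"
      using w0[of A] by (simp add: c_def powr_mult a2 power2_powr)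
    finally show ?thesis .
  qed
  \<comment> \<open>No coordinate has been used yet, so \<open>D\<close> starts as the empty
    set.\<close>
  have "(\<integral>x. \<bar>\<Sum>A\<in>?\<A>. ?f A x\<bar> powr p \<partial>power_space {1..n})
      \<le> (\<Sum>A\<in>?\<A>. (2 * smooth_const p) ^ card (A - {}) * c A) powr (p / 2)"
  proof (rule conjunct2[OF moment_sum_le[OF p(1) finite_hoeffding_sets _ _ int bnd]])
    fix A assume A: "A \<in> ?\<A>"
    then show "finite A" by (auto simp: hoeffding_sets_def intro: finite_subset_Icc)
    show "?f A \<in> borel_measurable (power_space {1..n})"
      using measurable_hoeffding_sum[of "{A}" r n ?w] A by simp
    show "0 \<le> c A" by (simp add: c_def a2_def)
    fix k \<X> assume k: "k \<in> A" and \<X>: "\<X> \<subseteq> {B \<in> ?\<A>. k \<notin> B}"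
    then have \<X>': "\<X> \<subseteq> ?\<A>" by auto
    have "(\<integral>x. sgn (\<Sum>B\<in>\<X>. ?f B x) * \<bar>\<Sum>B\<in>\<X>. ?f B x\<bar> powr (p - 1) * hoeffding_comp A x
        \<partial>power_space {1..n}) = 0"
      using p i \<X> A k
      by (intro hoeffding_comp_orthogonal[where k = k] measurable_hoeffding_sum[OF \<X>']
          integrable_hoeffding_sum_powr[OF \<X>'] hoeffding_sum_cong[OF \<X>'])
         (auto simp: hoeffding_sets_def)
    moreover have "sgn (\<Sum>B\<in>\<X>. ?f B x) * \<bar>\<Sum>B\<in>\<X>. ?f B x\<bar> powr (p - 1) * ?f A x
        = ?w A * (sgn (\<Sum>B\<in>\<X>. ?f B x) * \<bar>\<Sum>B\<in>\<X>. ?f B x\<bar> powr (p - 1) * hoeffding_comp A x)" for x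
      by (simp only: mult_ac)
    ultimately show "(\<integral>x. sgn (\<Sum>B\<in>\<X>. ?f B x) * \<bar>\<Sum>B\<in>\<X>. ?f B x\<bar> powr (p - 1) * ?f A x
        \<partial>power_space {1..n}) = 0" by (simp only: integral_mult_right_zero mult_zero_right)
  qed auto
  also have "(\<Sum>A\<in>?\<A>. (2 * smooth_const p) ^ card (A - {}) * c A)
      = (\<Sum>A\<in>?\<A>. (2 * smooth_const p) ^ card A * (16 ^ d * (?w A)\<^sup>2)) * a2"
    unfolding c_def sum_distrib_right Diff_empty by (simp only: mult_ac)
  also have "\<dots> powr (p / 2) \<le> (moment_const b r d / real (n choose r) * a2) powr (p / 2)"
    using p n smooth_const_ge_1[of p]
    by (intro powr_mono2 mult_right_mono sum_hoeffding_weight_le mult_nonneg_nonneg sum_nonneg)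
       (auto simp: a2_def)
  also have "\<dots> = (moment_const b r d / real (n choose r)) powr (p / 2) * a"
  proof -
    have "0 \<le> moment_const b r d / real (n choose r)" "0 \<le> a2"
      using moment_const_nonneg[of b r d] p by (simp_all add: a2_def)
    then show ?thesis by (simp only: powr_mult a2)
  qed
  finally show ?thesis by (simp add: a_def)
qed


text \<open>Both sides are \<open>hoeffding_g\<close> of order \<open>m\<close> at the same
  arguments. So components of equal size are copies of the one on the first \<open>m\<close>
  coordinates, to which the rank refers.\<close>

lemma hoeffding_comp_eq_leading:
  assumes A: "A \<subseteq> {1..n}" "card A = m" "m \<le> d" and x: "x \<in> space (power_space {1..n})"
  shows "hoeffding_comp A x = hoeffding_comp {1..m} (\<lambda>s\<in>{1..m}. x (enum_set A s))"
    and "(\<lambda>s\<in>{1..m}. x (enum_set A s)) \<in> space (power_space {1..m})"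
proof -
  let ?x = "\<lambda>s\<in>{1..m}. x (enum_set A s)"
  have im: "enum_set A ` {1..m} \<subseteq> {1..n}" using enum_set_image[of A] A by (auto simp: finite_subset_Icc)
  show sp: "?x \<in> space (power_space {1..m})"
    using measurable_space[OF measurable_reindex[OF im] x] .
  have "(\<lambda>s\<in>{1..m}. ?x (enum_set {1..m} s)) = ?x"
    by (rule ext) (auto simp: enum_set_Icc)
  then show "hoeffding_comp A x = hoeffding_comp {1..m} ?x"
    using hoeffding_g_eq_comp[of A n x] hoeffding_g_eq_comp[of "{1..m}" m ?x] A x sp by simp
qed

lemma integral_hoeffding_comp_square:
  assumes A: "A \<subseteq> {1..n}" "card A = m" "m \<le> d"
  shows "(\<integral>x. (hoeffding_comp A x)\<^sup>2 \<partial>power_space {1..n})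
    = (\<integral>x. (hoeffding_comp {1..m} x)\<^sup>2 \<partial>power_space {1..m})"
proof -
  have fin: "finite A" using A by (simp add: finite_subset_Icc)
  have inj: "inj_on (enum_set A) {1..m}" and im: "enum_set A ` {1..m} \<subseteq> {1..n}"
    using inj_on_enum_set[OF fin] enum_set_image[OF fin] A by auto
  have [measurable]: "hoeffding_comp {1..m} \<in> borel_measurable (power_space {1..m})"
    by (rule measurable_hoeffding_comp) simp
  have "(\<integral>x. (hoeffding_comp A x)\<^sup>2 \<partial>power_space {1..n})
      = (\<integral>x. (hoeffding_comp {1..m} (\<lambda>s\<in>{1..m}. x (enum_set A s)))\<^sup>2 \<partial>power_space {1..n})"
    by (intro Bochner_Integration.integral_cong refl) (simp add: hoeffding_comp_eq_leading(1)[OF A])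
  also have "\<dots> = (\<integral>x. (hoeffding_comp {1..m} x)\<^sup>2 \<partial>power_space {1..m})"
    by (subst distr_reindex[OF inj im, symmetric], subst integral_distr[OF measurable_reindex[OF im]]) auto
  finally show ?thesis .
qed

lemma AE_hoeffding_comp_eq_0:
  assumes A: "A \<subseteq> {1..n}" "card A = m" "m \<le> d"
    and AE: "AE x in power_space {1..m}. hoeffding_comp {1..m} x = 0"
  shows "AE x in power_space {1..n}. hoeffding_comp A x = 0"
proof -
  have fin: "finite A" using A by (simp add: finite_subset_Icc)
  have inj: "inj_on (enum_set A) {1..m}" and im: "enum_set A ` {1..m} \<subseteq> {1..n}"
    using inj_on_enum_set[OF fin] enum_set_image[OF fin] A by auto
  have "AE x in distr (power_space {1..n}) (power_space {1..m}) (\<lambda>x. \<lambda>s\<in>{1..m}. x (enum_set A s)).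
      hoeffding_comp {1..m} x = 0"
    using AE by (simp only: distr_reindex[OF inj im])
  then have "AE x in power_space {1..n}. hoeffding_comp {1..m} (\<lambda>s\<in>{1..m}. x (enum_set A s)) = 0"
    by (rule AE_distrD[OF measurable_reindex[OF im]])
  then show ?thesis
    using AE_space by eventually_elim (simp add: hoeffding_comp_eq_leading(1)[OF A])
qed

section \<open>Orthogonality and the lower bound for the variance\<close>

lemma
  assumes i: "integrable (power_space {1..d}) (\<lambda>x. \<bar>\<Phi> x\<bar> powr 2)"
    and A: "A \<subseteq> {1..n}" "card A \<le> d"
  shows integrable_hoeffding_comp: "integrable (power_space {1..n}) (hoeffding_comp A)"
    and integral_hoeffding_comp_eq_0: "A \<noteq> {} \<Longrightarrow> (\<integral>x. hoeffding_comp A x \<partial>power_space {1..n}) = 0"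
proof -
  interpret N: prob_space "power_space {1..n}" by (rule prob_power_space)
  have "integrable (power_space {1..n}) (\<lambda>x. (hoeffding_comp A x)\<^sup>2)"
    using integrable_hoeffding_comp_powr[OF A _ i] by simp
  then show "integrable (power_space {1..n}) (hoeffding_comp A)"
    by (rule N.square_integrable_imp_integrable[OF measurable_hoeffding_comp[OF A(1)]])
  assume "A \<noteq> {}"
  then obtain k where "k \<in> A" by auto
  \<comment> \<open>The test function belonging to the constant \<open>X = 1\<close> is again
    \<open>1\<close>.\<close>
  then show "(\<integral>x. hoeffding_comp A x \<partial>power_space {1..n}) = 0"
    using hoeffding_comp_orthogonal[of 2 "\<lambda>_. 1" n k A] i A by simp
qed

text \<open>Distinct sets differ in some \<open>k\<close>: one component is degenerate in
  \<open>k\<close>, the other ignores it. For \<open>p = 2\<close> the test function of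
  \<open>X\<close> is \<open>X\<close> itself.\<close>

lemma
  assumes i: "integrable (power_space {1..d}) (\<lambda>x. \<bar>\<Phi> x\<bar> powr 2)"
    and A: "A \<in> hoeffding_sets r d n" and B: "B \<in> hoeffding_sets r d n"
  shows integrable_hoeffding_comp_mult:
      "integrable (power_space {1..n}) (\<lambda>x. hoeffding_comp A x * hoeffding_comp B x)"
    and integral_hoeffding_comp_mult:
      "A \<noteq> B \<Longrightarrow> (\<integral>x. hoeffding_comp A x * hoeffding_comp B x \<partial>power_space {1..n}) = 0"
proof -
  have AB: "A \<subseteq> {1..n}" "card A \<le> d" "B \<subseteq> {1..n}" "card B \<le> d"
    using A B by (auto simp: hoeffding_sets_def)
  have abs: "sgn y * \<bar>y\<bar> powr (2 - 1) = y" for y :: real by (simp add: sgn_mult_abs)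
  show "integrable (power_space {1..n}) (\<lambda>x. hoeffding_comp A x * hoeffding_comp B x)"
    using integrable_powr_cross1[OF measurable_hoeffding_comp measurable_hoeffding_comp
      integrable_hoeffding_comp_powr integrable_hoeffding_comp_powr, of A n B 2] AB i
    unfolding abs by simp
  have *: "(\<integral>x. hoeffding_comp B x * hoeffding_comp A x \<partial>power_space {1..n}) = 0"
    if k: "k \<in> A" "k \<notin> B" and A: "A \<subseteq> {1..n}" "card A \<le> d" and B: "B \<subseteq> {1..n}" "card B \<le> d"
    for A B k
  proof -
    have cong: "hoeffding_comp B x = hoeffding_comp B x'"
      if x: "\<And>i. i \<in> {1..n} \<Longrightarrow> i \<noteq> k \<Longrightarrow> x i = x' i" for x x'
    proof (rule hoeffding_comp_cong[OF finite_subset_Icc[OF B(1)]])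
      fix i assume "i \<in> B"
      then show "x i = x' i" using k(2) B(1) by (intro x) auto
    qed
    have "(\<integral>x. sgn (hoeffding_comp B x) * \<bar>hoeffding_comp B x\<bar> powr (2 - 1) * hoeffding_comp A x
        \<partial>power_space {1..n}) = 0"
      by (rule hoeffding_comp_orthogonal[OF _ i measurable_hoeffding_comp[OF B(1)]
            integrable_hoeffding_comp_powr[OF B _ i] cong A(1) k(1) A(2)]) simp_all
    then show ?thesis unfolding abs .
  qed
  assume "A \<noteq> B"
  then consider k where "k \<in> A" "k \<notin> B" | k where "k \<in> B" "k \<notin> A" by auto
  then show "(\<integral>x. hoeffding_comp A x * hoeffding_comp B x \<partial>power_space {1..n}) = 0"
  proof cases
    case (1 k)
    from *[OF this AB] show ?thesis by (simp add: mult.commute)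
  next
    case (2 k)
    from *[OF this AB(3,4,1,2)] show ?thesis .
  qed
qed

text \<open>Orthogonality leaves a sum of squares, of which only the sets of size \<open>r\<close>
  are kept. Their \<open>n choose r\<close> equal contributions add up to
  \<open>(d choose r)^2 * L / (n choose r)\<close>, and \<open>d choose r\<close> is at least
  \<open>1\<close>.\<close>

lemma hoeffding_sum_square_ge:
  assumes i: "integrable (power_space {1..d}) (\<lambda>x. \<bar>\<Phi> x\<bar> powr 2)" and rd: "r \<le> d" "d \<le> n"
  shows "(\<integral>x. (hoeffding_comp {1..r} x)\<^sup>2 \<partial>power_space {1..r}) / real (n choose r)
    \<le> (\<integral>x. (\<Sum>A\<in>hoeffding_sets r d n. hoeffding_weight d n (card A) * hoeffding_comp A x)\<^sup>2
        \<partial>power_space {1..n})"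
proof -
  let ?w = "\<lambda>A. hoeffding_weight d n (card A)" and ?N = "power_space {1..n}"
  let ?\<A> = "hoeffding_sets r d n"
  define L where "L = (\<integral>x. (hoeffding_comp {1..r} x)\<^sup>2 \<partial>power_space {1..r})"
  have L: "0 \<le> L" by (simp add: L_def)
  have "(\<integral>x. (\<Sum>A\<in>?\<A>. ?w A * hoeffding_comp A x)\<^sup>2 \<partial>?N)
      = (\<integral>x. (\<Sum>A\<in>?\<A>. \<Sum>B\<in>?\<A>. (?w A * ?w B) * (hoeffding_comp A x * hoeffding_comp B x)) \<partial>?N)"
    by (simp add: power2_eq_square sum_product mult_ac)
  also have "\<dots> = (\<Sum>A\<in>?\<A>. \<Sum>B\<in>?\<A>. (?w A * ?w B) * (\<integral>x. hoeffding_comp A x * hoeffding_comp B x \<partial>?N))"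
    by (simp add: Bochner_Integration.integral_sum integrable_hoeffding_comp_mult[OF i])
  also have "\<dots> = (\<Sum>A\<in>?\<A>. (?w A)\<^sup>2 * (\<integral>x. (hoeffding_comp A x)\<^sup>2 \<partial>?N))"
  proof (rule sum.cong[OF refl])
    fix A assume A: "A \<in> ?\<A>"
    have "(\<Sum>B\<in>?\<A>. (?w A * ?w B) * (\<integral>x. hoeffding_comp A x * hoeffding_comp B x \<partial>?N))
        = (\<Sum>B\<in>?\<A>. if B = A then (?w A)\<^sup>2 * (\<integral>x. (hoeffding_comp A x)\<^sup>2 \<partial>?N) else 0)"
    proof (rule sum.cong[OF refl])
      fix B assume B: "B \<in> ?\<A>"
      show "(?w A * ?w B) * (\<integral>x. hoeffding_comp A x * hoeffding_comp B x \<partial>?N)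
          = (if B = A then (?w A)\<^sup>2 * (\<integral>x. (hoeffding_comp A x)\<^sup>2 \<partial>?N) else 0)"
        using integral_hoeffding_comp_mult[OF i A B] by (cases "B = A") (simp_all add: power2_eq_square)
    qed
    then show "(\<Sum>B\<in>?\<A>. (?w A * ?w B) * (\<integral>x. hoeffding_comp A x * hoeffding_comp B x \<partial>?N))
        = (?w A)\<^sup>2 * (\<integral>x. (hoeffding_comp A x)\<^sup>2 \<partial>?N)"
      using A by (simp add: finite_hoeffding_sets)
  qed
  finally have sq: "(\<integral>x. (\<Sum>A\<in>?\<A>. ?w A * hoeffding_comp A x)\<^sup>2 \<partial>?N)
      = (\<Sum>A\<in>?\<A>. (?w A)\<^sup>2 * (\<integral>x. (hoeffding_comp A x)\<^sup>2 \<partial>?N))" .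
  have "(\<Sum>A | A \<subseteq> {1..n} \<and> card A = r. (?w A)\<^sup>2 * (\<integral>x. (hoeffding_comp A x)\<^sup>2 \<partial>?N))
      \<le> (\<Sum>A\<in>?\<A>. (?w A)\<^sup>2 * (\<integral>x. (hoeffding_comp A x)\<^sup>2 \<partial>?N))"
    using rd by (intro sum_mono2 finite_hoeffding_sets) (auto simp: hoeffding_sets_def)
  moreover have "(\<Sum>A | A \<subseteq> {1..n} \<and> card A = r. (?w A)\<^sup>2 * (\<integral>x. (hoeffding_comp A x)\<^sup>2 \<partial>?N))
      = (\<Sum>A | A \<subseteq> {1..n} \<and> card A = r. (hoeffding_weight d n r)\<^sup>2 * L)"
  proof (rule sum.cong[OF refl])
    fix A assume "A \<in> {A. A \<subseteq> {1..n} \<and> card A = r}"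
    then show "(?w A)\<^sup>2 * (\<integral>x. (hoeffding_comp A x)\<^sup>2 \<partial>?N) = (hoeffding_weight d n r)\<^sup>2 * L"
      using integral_hoeffding_comp_square[of A n r] rd unfolding L_def by auto
  qed
  moreover have "(\<Sum>A | A \<subseteq> {1..n} \<and> card A = r. (hoeffding_weight d n r)\<^sup>2 * L)
      = real (n choose r) * ((hoeffding_weight d n r)\<^sup>2 * L)"
    using n_subsets[of "{1..n}" r] by simp
  ultimately have *: "real (n choose r) * ((hoeffding_weight d n r)\<^sup>2 * L)
      \<le> (\<integral>x. (\<Sum>A\<in>?\<A>. ?w A * hoeffding_comp A x)\<^sup>2 \<partial>?N)"
    unfolding sq by linarith
  have pos: "0 < real (n choose r)" using rd by (simp add: zero_less_binomial)
  have w: "hoeffding_weight d n r = real (d choose r) / real (n choose r)"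
    using hoeffding_weight_mult_choose[OF rd] pos by (simp add: field_simps)
  have "1 \<le> real (d choose r)" using rd zero_less_binomial[of r d] by linarith
  then have "1 * L \<le> (real (d choose r))\<^sup>2 * L" using L by (intro mult_right_mono one_le_power)
  then have "L / real (n choose r) \<le> (real (d choose r))\<^sup>2 * L / real (n choose r)"
    using pos by (simp add: divide_right_mono)
  also have "\<dots> = real (n choose r) * ((hoeffding_weight d n r)\<^sup>2 * L)"
    using pos by (simp add: w power2_eq_square)
  finally show ?thesis using * unfolding L_def by linarith
qed

lemma hoeffding_comp_empty: "hoeffding_comp {} x = (\<integral>y. \<Phi> y \<partial>power_space {1..d})"
proof -
  have "(\<integral>y. \<Phi> (fill {} e x y) \<partial>power_space {1..d}) = (\<integral>y. \<Phi> y \<partial>power_space {1..d})" for e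
  proof (rule Bochner_Integration.integral_cong[OF refl])
    fix y assume "y \<in> space (power_space {1..d})"
    then have "fill {} e x y = y"
      by (intro ext) (auto simp: fill_def space_PiM PiE_def extensional_def)
    then show "\<Phi> (fill {} e x y) = \<Phi> y" by simp
  qed
  then show ?thesis by (simp add: hoeffding_comp_def alt_sum_def proj_kernel_def cond_kernel_def)
qed

text \<open>The empty set contributes the mean, which is \<open>0\<close>; a nonempty set below the
  rank carries a copy of a component that vanishes almost everywhere. There are finitely many such
  sets, so the exceptional null sets combine.\<close>

lemma hoeffding_sum_rank:
  assumes mean: "(\<integral>y. \<Phi> y \<partial>power_space {1..d}) = 0" and r: "r \<le> d"
    and rank: "\<And>m. 1 \<le> m \<Longrightarrow> m < r \<Longrightarrow> AE x in power_space {1..m}. hoeffding_comp {1..m} x = 0"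
  shows "AE x in power_space {1..n}. (\<Sum>A\<in>hoeffding_sets 0 d n. w A * hoeffding_comp A x)
    = (\<Sum>A\<in>hoeffding_sets r d n. w A * hoeffding_comp A x)"
proof -
  have "AE x in power_space {1..n}. \<forall>A\<in>hoeffding_sets 0 d n - hoeffding_sets r d n. hoeffding_comp A x = 0"
  proof (rule AE_finite_allI)
    fix A assume "A \<in> hoeffding_sets 0 d n - hoeffding_sets r d n"
    then have A: "A \<subseteq> {1..n}" "card A < r" by (auto simp: hoeffding_sets_def)
    show "AE x in power_space {1..n}. hoeffding_comp A x = 0"
    proof (cases "A = {}")
      case True
      then show ?thesis by (simp add: hoeffding_comp_empty mean)
    next
      case False
      then have "1 \<le> card A" using A(1) by (simp add: Suc_leI card_gt_0_iff finite_subset_Icc One_nat_def)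
      then show ?thesis using A r by (intro AE_hoeffding_comp_eq_0[OF A(1) refl] rank) auto
    qed
  qed (simp add: finite_hoeffding_sets)
  then show ?thesis
  proof eventually_elim
    fix x assume "\<forall>A\<in>hoeffding_sets 0 d n - hoeffding_sets r d n. hoeffding_comp A x = 0"
    then show "(\<Sum>A\<in>hoeffding_sets 0 d n. w A * hoeffding_comp A x)
        = (\<Sum>A\<in>hoeffding_sets r d n. w A * hoeffding_comp A x)"
      by (intro sum.mono_neutral_right) (auto simp: finite_hoeffding_sets, auto simp: hoeffding_sets_def)
  qed
qed

end

section \<open>The U-statistic of an i.i.d. sequence\<close>

locale iid_kernel = symmetric_kernel "distr M S (\<xi> 1)" d \<Phi>
  for M :: "'a measure" and S :: "'x measure" and \<xi> :: "nat \<Rightarrow> 'a \<Rightarrow> 'x" and d :: nat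
    and \<Phi> :: "(nat \<Rightarrow> 'x) \<Rightarrow> real" +
  assumes iid: "iid_seq M S \<xi>" and d_pos: "1 \<le> d"
begin

sublocale M: prob_space M using iid unfolding iid_seq_def by blast

definition sample :: "nat \<Rightarrow> 'a \<Rightarrow> nat \<Rightarrow> 'x" where
  "sample n \<omega> = (\<lambda>i\<in>{1..n}. \<xi> i \<omega>)"

text \<open>Independence makes the joint law a product, and equal marginals make it a power of
  \<open>P\<close>; the results on power spaces are transported along \<open>sample\<close>.\<close>

lemma
  assumes "1 \<le> n"
  shows measurable_sample [measurable]: "sample n \<in> M \<rightarrow>\<^sub>M power_space {1..n}"
    and distr_sample: "distr M (power_space {1..n}) (sample n) = power_space {1..n}"
proof -
  have indep: "M.indep_vars (\<lambda>_. S) \<xi> {1..n}"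
  proof (rule M.indep_vars_subset)
    show "M.indep_vars (\<lambda>_. S) \<xi> {1..}" using iid unfolding iid_seq_def by blast
  qed auto
  have rv: "\<xi> i \<in> M \<rightarrow>\<^sub>M S" if "i \<in> {1..n}" for i
    using indep that unfolding M.indep_vars_def by blast
  \<comment> \<open>Power spaces over \<open>S\<close> and over the law of \<open>\<xi> 1\<close>
    may differ as measures but have the same measurable sets.\<close>
  have sets_eq: "sets (power_space {1..n}) = sets (PiM {1..n} (\<lambda>_. S))"
    by (intro sets_PiM_cong) auto
  have "sample n \<in> M \<rightarrow>\<^sub>M PiM {1..n} (\<lambda>_. S)"
    unfolding sample_def by (intro measurable_restrict rv)
  then show "sample n \<in> M \<rightarrow>\<^sub>M power_space {1..n}"
    by (simp only: measurable_cong_sets[OF refl sets_eq])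
  have "distr M (PiM {1..n} (\<lambda>_. S)) (sample n) = PiM {1..n} (\<lambda>i. distr M S (\<xi> i))"
    unfolding sample_def using assms indep rv by (subst M.indep_vars_iff_distr_eq_PiM'[symmetric]) auto
  also have "\<dots> = power_space {1..n}"
  proof (rule PiM_cong[OF refl])
    fix i assume "i \<in> {1..n}"
    moreover have "\<forall>i\<ge>1. distr M S (\<xi> i) = distr M S (\<xi> 1)"
      using iid unfolding iid_seq_def by blast
    ultimately show "distr M S (\<xi> i) = distr M S (\<xi> 1)" by (meson atLeastAtMost_iff)
  qed
  also have "distr M (PiM {1..n} (\<lambda>_. S)) (sample n) = distr M (power_space {1..n}) (sample n)"
    by (intro distr_cong sets_eq[symmetric]) auto
  finally show "distr M (power_space {1..n}) (sample n) = power_space {1..n}" .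
qed

lemma sample_in_space: "1 \<le> n \<Longrightarrow> \<omega> \<in> space M \<Longrightarrow> sample n \<omega> \<in> space (power_space {1..n})"
  using measurable_sample by (rule measurable_space)

lemma
  fixes F :: "(nat \<Rightarrow> 'x) \<Rightarrow> real"
  assumes n: "1 \<le> n" and F: "F \<in> borel_measurable (power_space {1..n})"
  shows integral_sample: "(\<integral>\<omega>. F (sample n \<omega>) \<partial>M) = (\<integral>x. F x \<partial>power_space {1..n})"
    and integrable_sample_iff: "integrable M (\<lambda>\<omega>. F (sample n \<omega>)) \<longleftrightarrow> integrable (power_space {1..n}) F"
    and AE_sample_iff: "(AE \<omega> in M. F (sample n \<omega>) = 0) \<longleftrightarrow> (AE x in power_space {1..n}. F x = 0)"
proof -
  show "(\<integral>\<omega>. F (sample n \<omega>) \<partial>M) = (\<integral>x. F x \<partial>power_space {1..n})"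
    using integral_distr[OF measurable_sample[OF n] F] unfolding distr_sample[OF n] by simp
  show "integrable M (\<lambda>\<omega>. F (sample n \<omega>)) \<longleftrightarrow> integrable (power_space {1..n}) F"
    using integrable_distr_eq[OF measurable_sample[OF n] F] unfolding distr_sample[OF n] by simp
  show "(AE \<omega> in M. F (sample n \<omega>) = 0) \<longleftrightarrow> (AE x in power_space {1..n}. F x = 0)"
    using AE_distr_iff[OF measurable_sample[OF n], of "\<lambda>x. F x = 0"] F unfolding distr_sample[OF n] by simp
qed

lemma at_sample_kernel: "at_sample d \<Phi> \<xi> (\<lambda>s. s) = (\<lambda>\<omega>. \<Phi> (sample d \<omega>))"
  by (simp add: at_sample_def sample_def)

lemma U_stat_eq:
  assumes "\<omega> \<in> space M" "1 \<le> n"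
  shows "U_stat d \<Phi> \<xi> n \<omega>
    = (\<Sum>A\<in>hoeffding_sets 0 d n. hoeffding_weight d n (card A) * hoeffding_comp A (sample n \<omega>))"
proof -
  have "at_sample d \<Phi> \<xi> i \<omega> = \<Phi> (\<lambda>s\<in>{1..d}. sample n \<omega> (i s))" if "i \<in> incr_tuples d n" for i
  proof -
    have "i s \<in> {1..n}" if "s \<in> {1..d}" for s
      using \<open>i \<in> incr_tuples d n\<close> that by (auto simp: incr_tuples_def)
    then show ?thesis unfolding at_sample_def
      by (intro arg_cong[where f = \<Phi>] restrict_ext) (simp add: sample_def)
  qed
  then have "(\<Sum>i\<in>incr_tuples d n. at_sample d \<Phi> \<xi> i \<omega>)
      = (\<Sum>i\<in>incr_tuples d n. \<Phi> (\<lambda>s\<in>{1..d}. sample n \<omega> (i s)))"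
    by (intro sum.cong refl)
  then show ?thesis
    unfolding U_stat_def U_stat_eq_hoeffding_sum[OF sample_in_space[OF assms(2,1)], symmetric] by simp
qed

lemma g_comp_eq:
  assumes "\<omega> \<in> space M" "1 \<le> m" "m \<le> d"
  shows "g_comp M S d \<Phi> \<xi> m \<omega> = hoeffding_comp {1..m} (sample m \<omega>)"
proof -
  have "(\<lambda>s\<in>{1..card {1..m}}. sample m \<omega> (enum_set {1..m} s)) = sample m \<omega>"
    by (rule ext) (auto simp: enum_set_Icc sample_def)
  then show ?thesis
    using hoeffding_g_eq_comp[of "{1..m}" m "sample m \<omega>"] assms sample_in_space[of m \<omega>]
    by (simp add: g_comp_def at_sample_def sample_def)
qed

end

text \<open>The second moment is demanded in the form \<open>powr 2\<close> used for all other
  moments; in the theorem it comes from \<open>p = 2\<close> in the Grand Lebesgue norm.\<close>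

locale ranked_kernel = iid_kernel M S \<xi> d \<Phi>
  for M :: "'a measure" and S :: "'x measure" and \<xi> :: "nat \<Rightarrow> 'a \<Rightarrow> 'x" and d :: nat
    and \<Phi> :: "(nat \<Rightarrow> 'x) \<Rightarrow> real" +
  fixes r :: nat
  assumes rank: "has_rank M S d \<Phi> \<xi> r"
    and mean: "M.expectation (at_sample d \<Phi> \<xi> (\<lambda>s. s)) = 0"
    and square_integrable: "integrable M (\<lambda>\<omega>. \<bar>at_sample d \<Phi> \<xi> (\<lambda>s. s) \<omega>\<bar> powr 2)"
begin

lemma r_bounds: "1 \<le> r" "r \<le> d"
  using rank unfolding has_rank_def by blast+

lemma integrable_kernel_sample:
  "integrable M (\<lambda>\<omega>. \<bar>at_sample d \<Phi> \<xi> (\<lambda>s. s) \<omega>\<bar> powr p)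
    \<longleftrightarrow> integrable (power_space {1..d}) (\<lambda>x. \<bar>\<Phi> x\<bar> powr p)"
  unfolding at_sample_kernel by (intro integrable_sample_iff d_pos) measurable

lemma kernel_square_integrable: "integrable (power_space {1..d}) (\<lambda>x. \<bar>\<Phi> x\<bar> powr 2)"
  using square_integrable by (simp only: integrable_kernel_sample)

lemma integral_kernel_eq_0: "(\<integral>x. \<Phi> x \<partial>power_space {1..d}) = 0"
  using mean integral_sample[OF d_pos measurable_kernel] by (simp add: at_sample_kernel)

text \<open>The decomposition with everything below the rank deleted; in general it agrees with the
  U-statistic only almost surely.\<close>

definition hoeffding_sum :: "nat \<Rightarrow> (nat \<Rightarrow> 'x) \<Rightarrow> real" where
  "hoeffding_sum n x = (\<Sum>A\<in>hoeffding_sets r d n. hoeffding_weight d n (card A) * hoeffding_comp A x)"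

lemma measurable_hoeffding_sum_rank [measurable]: "hoeffding_sum n \<in> borel_measurable (power_space {1..n})"
  unfolding hoeffding_sum_def[abs_def] by (rule measurable_hoeffding_sum[OF order_refl])

lemma AE_hoeffding_comp_below_rank:
  assumes "1 \<le> m" "m < r"
  shows "AE x in power_space {1..m}. hoeffding_comp {1..m} x = 0"
proof -
  have "AE \<omega> in M. g_comp M S d \<Phi> \<xi> m \<omega> = 0" using rank assms unfolding has_rank_def by blast
  then have "AE \<omega> in M. hoeffding_comp {1..m} (sample m \<omega>) = 0"
    using AE_space
  proof eventually_elim
    fix \<omega> assume "g_comp M S d \<Phi> \<xi> m \<omega> = 0" "\<omega> \<in> space M"
    then show "hoeffding_comp {1..m} (sample m \<omega>) = 0" using g_comp_eq[of \<omega> m] assms r_bounds by simp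
  qed
  then show ?thesis
    using AE_sample_iff[OF assms(1) measurable_hoeffding_comp[OF order_refl]] by simp
qed

lemma AE_U_stat_eq:
  assumes n: "1 \<le> n"
  shows "AE \<omega> in M. U_stat d \<Phi> \<xi> n \<omega> = hoeffding_sum n (sample n \<omega>)"
proof -
  let ?S = "\<lambda>r x. \<Sum>A\<in>hoeffding_sets r d n. hoeffding_weight d n (card A) * hoeffding_comp A x"
  have "AE x in power_space {1..n}. ?S 0 x = ?S r x"
    by (rule hoeffding_sum_rank[OF integral_kernel_eq_0 r_bounds(2) AE_hoeffding_comp_below_rank])
  then have "AE x in distr M (power_space {1..n}) (sample n). ?S 0 x = ?S r x"
    by (simp only: distr_sample[OF n])
  then have "AE \<omega> in M. ?S 0 (sample n \<omega>) = ?S r (sample n \<omega>)"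
    by (rule AE_distrD[OF measurable_sample[OF n]])
  then show ?thesis
    using AE_space by eventually_elim (simp add: U_stat_eq[OF _ n] hoeffding_sum_def)
qed

lemma integral_hoeffding_sum_eq_0: "(\<integral>x. hoeffding_sum n x \<partial>power_space {1..n}) = 0"
proof -
  have A: "A \<subseteq> {1..n}" "card A \<le> d" "A \<noteq> {}" if "A \<in> hoeffding_sets r d n" for A
    using that r_bounds by (auto simp: hoeffding_sets_def)
  have "(\<integral>x. hoeffding_sum n x \<partial>power_space {1..n}) = (\<Sum>A\<in>hoeffding_sets r d n.
      \<integral>x. hoeffding_weight d n (card A) * hoeffding_comp A x \<partial>power_space {1..n})"
    unfolding hoeffding_sum_def using A
    by (intro Bochner_Integration.integral_sum integrable_mult_right
        integrable_hoeffding_comp[OF kernel_square_integrable])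
  also have "\<dots> = 0"
    using A by (intro sum.neutral ballI)
      (simp add: integral_hoeffding_comp_eq_0[OF kernel_square_integrable])
  finally show ?thesis .
qed

lemma measurable_U_stat: "1 \<le> n \<Longrightarrow> U_stat d \<Phi> \<xi> n \<in> borel_measurable M"
proof -
  assume n: "1 \<le> n"
  have "(\<lambda>\<omega>. \<Sum>A\<in>hoeffding_sets 0 d n. hoeffding_weight d n (card A) * hoeffding_comp A (sample n \<omega>))
      \<in> borel_measurable M"
    by (rule measurable_compose[OF measurable_sample[OF n] measurable_hoeffding_sum[OF order_refl]])
  then show ?thesis by (subst measurable_cong[OF U_stat_eq[OF _ n]])
qed

text \<open>Every set in \<open>hoeffding_sum\<close> is nonempty because \<open>r \<ge> 1\<close>,
  so the mean is zero and the variance is a second moment.\<close>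

lemma variance_U_stat:
  assumes n: "1 \<le> n"
  shows "M.variance (U_stat d \<Phi> \<xi> n) = (\<integral>x. (hoeffding_sum n x)\<^sup>2 \<partial>power_space {1..n})"
proof -
  note [measurable] = measurable_U_stat[OF n] measurable_sample[OF n]
  have "M.expectation (U_stat d \<Phi> \<xi> n) = (\<integral>\<omega>. hoeffding_sum n (sample n \<omega>) \<partial>M)"
    using AE_U_stat_eq[OF n] by (intro integral_cong_AE) auto
  then have "M.expectation (U_stat d \<Phi> \<xi> n) = 0"
    using integral_sample[OF n measurable_hoeffding_sum_rank] by (simp add: integral_hoeffding_sum_eq_0)
  then have "M.variance (U_stat d \<Phi> \<xi> n) = (\<integral>\<omega>. (hoeffding_sum n (sample n \<omega>))\<^sup>2 \<partial>M)"
    using AE_U_stat_eq[OF n] by (intro integral_cong_AE) auto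
  also have "\<dots> = (\<integral>x. (hoeffding_sum n x)\<^sup>2 \<partial>power_space {1..n})"
    by (intro integral_sample n) measurable
  finally show ?thesis .
qed

lemma lead_var_eq: "lead_var M S d \<Phi> \<xi> r = (\<integral>x. (hoeffding_comp {1..r} x)\<^sup>2 \<partial>power_space {1..r})"
proof -
  note r = r_bounds
  have m [measurable]: "hoeffding_comp {1..r} \<in> borel_measurable (power_space {1..r})"
    by (rule measurable_hoeffding_comp[OF order_refl])
  have "M.expectation (g_comp M S d \<Phi> \<xi> r) = (\<integral>\<omega>. hoeffding_comp {1..r} (sample r \<omega>) \<partial>M)"
    using r by (intro Bochner_Integration.integral_cong refl g_comp_eq)
  also have "\<dots> = 0"
    using integral_sample[OF r(1) m] r
      integral_hoeffding_comp_eq_0[OF kernel_square_integrable order_refl, of r] by simp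
  finally have "lead_var M S d \<Phi> \<xi> r = (\<integral>\<omega>. (hoeffding_comp {1..r} (sample r \<omega>))\<^sup>2 \<partial>M)"
    unfolding lead_var_def using r by (intro Bochner_Integration.integral_cong refl) (simp add: g_comp_eq)
  also have "\<dots> = (\<integral>x. (hoeffding_comp {1..r} x)\<^sup>2 \<partial>power_space {1..r})"
    by (intro integral_sample r) measurable
  finally show ?thesis .
qed

text \<open>A vanishing second moment would make the leading component zero almost surely, against
  the definition of the rank. Positivity is what permits division by
  \<open>\<sigma>(n)\<close>.\<close>

lemma lead_var_pos: "0 < lead_var M S d \<Phi> \<xi> r"
proof (rule ccontr)
  assume "\<not> 0 < lead_var M S d \<Phi> \<xi> r"
  moreover have "0 \<le> lead_var M S d \<Phi> \<xi> r" by (simp add: lead_var_eq)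
  ultimately have 0: "(\<integral>x. (hoeffding_comp {1..r} x)\<^sup>2 \<partial>power_space {1..r}) = 0"
    unfolding lead_var_eq by linarith
  have "integrable (power_space {1..r}) (\<lambda>x. (hoeffding_comp {1..r} x)\<^sup>2)"
    using integrable_hoeffding_comp_powr[of "{1..r}" r 2] kernel_square_integrable r_bounds by simp
  then have "AE x in power_space {1..r}. (hoeffding_comp {1..r} x)\<^sup>2 = 0"
    using 0 by (subst integral_nonneg_eq_0_iff_AE[symmetric]) auto
  then have "AE x in power_space {1..r}. hoeffding_comp {1..r} x = 0" by simp
  then have "AE \<omega> in M. hoeffding_comp {1..r} (sample r \<omega>) = 0"
    using AE_sample_iff[OF r_bounds(1) measurable_hoeffding_comp[OF order_refl]] by simp
  then have "AE \<omega> in M. g_comp M S d \<Phi> \<xi> r \<omega> = 0"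
    using AE_space
  proof eventually_elim
    fix \<omega> assume "hoeffding_comp {1..r} (sample r \<omega>) = 0" "\<omega> \<in> space M"
    then show "g_comp M S d \<Phi> \<xi> r \<omega> = 0" using g_comp_eq[of \<omega> r] r_bounds by simp
  qed
  then show False using rank unfolding has_rank_def by blast
qed

lemma sigma_U_ge:
  assumes "d \<le> n"
  shows "sqrt (lead_var M S d \<Phi> \<xi> r / real (n choose r)) \<le> sigma_U M d \<Phi> \<xi> n"
proof -
  have n: "1 \<le> n" using assms d_pos by simp
  show ?thesis
    using hoeffding_sum_square_ge[OF kernel_square_integrable r_bounds(2) assms]
    unfolding sigma_U_def variance_U_stat[OF n] lead_var_eq hoeffding_sum_def
    by (rule real_sqrt_le_mono)
qed

text \<open>The upper bound for the moment and the lower bound for the variance contain the same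
  \<open>n choose r\<close>, which cancels in the quotient; this gives uniformity in
  \<open>n\<close>.\<close>

lemma U_stat_moment_le:
  assumes p: "2 \<le> p" "p \<le> b" and n: "d \<le> n"
    and i: "integrable M (\<lambda>\<omega>. \<bar>at_sample d \<Phi> \<xi> (\<lambda>s. s) \<omega>\<bar> powr p)"
  shows "integrable M (\<lambda>\<omega>. \<bar>U_stat d \<Phi> \<xi> n \<omega> / sigma_U M d \<Phi> \<xi> n\<bar> powr p)" (is ?int)
    and "(\<integral>\<omega>. \<bar>U_stat d \<Phi> \<xi> n \<omega> / sigma_U M d \<Phi> \<xi> n\<bar> powr p \<partial>M)
      \<le> (moment_const b r d / lead_var M S d \<Phi> \<xi> r) powr (p / 2)
         * (\<integral>\<omega>. \<bar>at_sample d \<Phi> \<xi> (\<lambda>s. s) \<omega>\<bar> powr p \<partial>M)" (is ?le)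
proof -
  have n1: "1 \<le> n" using n d_pos by simp
  note [measurable] = measurable_U_stat[OF n1] measurable_sample[OF n1]
  define \<sigma> where "\<sigma> = sigma_U M d \<Phi> \<xi> n"
  define L where "L = lead_var M S d \<Phi> \<xi> r"
  define N where "N = real (n choose r)"
  define D where "D = moment_const b r d"
  define a where "a = (\<integral>x. \<bar>\<Phi> x\<bar> powr p \<partial>power_space {1..d})"
  have N: "0 < N" using n r_bounds by (simp add: N_def zero_less_binomial)
  have L: "0 < L" using lead_var_pos by (simp add: L_def)
  have D: "0 \<le> D" using moment_const_nonneg p by (simp add: D_def)
  have a: "0 \<le> a" by (simp add: a_def)
  have \<sigma>_ge: "sqrt (L / N) \<le> \<sigma>" using sigma_U_ge[OF n] by (simp add: \<sigma>_def L_def N_def)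
  have \<sigma>: "0 < \<sigma>" using \<sigma>_ge L N by (smt (verit) divide_pos_pos real_sqrt_gt_0_iff)
  have i\<Phi>: "integrable (power_space {1..d}) (\<lambda>x. \<bar>\<Phi> x\<bar> powr p)" using i by (simp only: integrable_kernel_sample)
  have iV: "integrable (power_space {1..n}) (\<lambda>x. \<bar>hoeffding_sum n x\<bar> powr p)"
    unfolding hoeffding_sum_def using p i\<Phi> by (intro integrable_hoeffding_sum_powr) auto
  have mV: "(\<lambda>x. \<bar>hoeffding_sum n x\<bar> powr p) \<in> borel_measurable (power_space {1..n})" by measurable
  have iV': "integrable M (\<lambda>\<omega>. \<bar>hoeffding_sum n (sample n \<omega>)\<bar> powr p)"
    using iV by (simp only: integrable_sample_iff[OF n1 mV])
  have eq: "AE \<omega> in M. \<bar>U_stat d \<Phi> \<xi> n \<omega> / \<sigma>\<bar> powr p = \<bar>hoeffding_sum n (sample n \<omega>)\<bar> powr p / \<sigma> powr p"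
    using AE_U_stat_eq[OF n1] by eventually_elim (use \<sigma> in \<open>simp add: powr_divide\<close>)
  show ?int
    unfolding \<sigma>_def[symmetric] by (subst integrable_cong_AE[OF _ _ eq]) (use iV' in auto)
  have "(\<integral>\<omega>. \<bar>U_stat d \<Phi> \<xi> n \<omega> / \<sigma>\<bar> powr p \<partial>M)
      = (\<integral>\<omega>. \<bar>hoeffding_sum n (sample n \<omega>)\<bar> powr p / \<sigma> powr p \<partial>M)"
    by (rule integral_cong_AE[OF _ _ eq]) measurable
  also have "\<dots> = (\<integral>x. \<bar>hoeffding_sum n x\<bar> powr p \<partial>power_space {1..n}) / \<sigma> powr p"
    using integral_sample[OF n1 mV] by simp
  also have "\<dots> \<le> (D / N) powr (p / 2) * a / \<sigma> powr p"
    using hoeffding_sum_moment_le[OF p n i\<Phi>, of r]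
    by (intro divide_right_mono) (simp_all add: hoeffding_sum_def D_def N_def a_def)
  also have "\<dots> \<le> (D / N) powr (p / 2) * a / (L / N) powr (p / 2)"
  proof (intro divide_left_mono)
    have "(L / N) powr (p / 2) = (sqrt (L / N)) powr p"
      using L N by (simp add: powr_half_sqrt[symmetric] powr_powr)
    also have "\<dots> \<le> \<sigma> powr p" using \<sigma>_ge L N p by (intro powr_mono2) auto
    finally show "(L / N) powr (p / 2) \<le> \<sigma> powr p" .
  qed (use L N \<sigma> D a in auto)
  also have "\<dots> = ((D / N) powr (p / 2) / (L / N) powr (p / 2)) * a" by simp
  also have "(D / N) powr (p / 2) / (L / N) powr (p / 2) = ((D / N) / (L / N)) powr (p / 2)"
    by (rule powr_divide[symmetric])
  also have "(D / N) / (L / N) = D / L" using N by simp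
  also have "a = (\<integral>\<omega>. \<bar>at_sample d \<Phi> \<xi> (\<lambda>s. s) \<omega>\<bar> powr p \<partial>M)"
    unfolding a_def at_sample_kernel by (rule integral_sample[OF d_pos, symmetric]; measurable)
  finally show ?le by (simp only: \<sigma>_def D_def L_def)
qed

end

section \<open>From moments to Grand Lebesgue norms\<close>

lemma Lp_norm_eq:
  assumes "integrable M (\<lambda>\<omega>. \<bar>f \<omega>\<bar> powr p)"
  shows "Lp_norm M p f = ennreal ((\<integral>\<omega>. \<bar>f \<omega>\<bar> powr p \<partial>M) powr (1 / p))"
proof -
  have "(\<integral>\<^sup>+\<omega>. ennreal (\<bar>f \<omega>\<bar> powr p) \<partial>M) = ennreal (\<integral>\<omega>. \<bar>f \<omega>\<bar> powr p \<partial>M)"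
    using assms by (intro nn_integral_eq_integral) auto
  then show ?thesis by (simp add: Lp_norm_def)
qed

lemma integrable_if_Lp_norm_finite:
  assumes "f \<in> borel_measurable M" "Lp_norm M p f < \<infinity>"
  shows "integrable M (\<lambda>\<omega>. \<bar>f \<omega>\<bar> powr p)"
proof (rule integrableI_bounded)
  show "(\<lambda>\<omega>. \<bar>f \<omega>\<bar> powr p) \<in> borel_measurable M" using assms(1) by measurable
  show "(\<integral>\<^sup>+\<omega>. ennreal (norm (\<bar>f \<omega>\<bar> powr p)) \<partial>M) < \<infinity>"
    using assms(2) by (auto simp: Lp_norm_def Let_def less_top split: if_splits)
qed

text \<open>Taking the root of order \<open>p\<close> turns \<open>K powr (p / 2)\<close> into
  \<open>sqrt K\<close>, a constant free of \<open>p\<close>.\<close>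

lemma powr_bound_root:
  fixes I J K p :: real
  assumes "I \<le> K powr (p / 2) * J" "0 \<le> I" "0 \<le> J" "0 \<le> K" "0 < p"
  shows "I powr (1 / p) \<le> sqrt K * J powr (1 / p)"
proof -
  have "I powr (1 / p) \<le> (K powr (p / 2) * J) powr (1 / p)"
    using assms by (intro powr_mono2) auto
  also have "\<dots> = sqrt K * J powr (1 / p)"
    using assms by (simp add: powr_mult powr_powr powr_half_sqrt)
  finally show ?thesis .
qed

lemma one_le_divide_ln:
  fixes p :: real
  assumes "1 < p"
  shows "1 \<le> p / ln p"
  using assms ln_le_minus_one[of p] by (simp add: field_simps)

text \<open>Since \<open>ln p < p\<close>, the extra factor is at least \<open>1\<close>; a larger
  generating function only lowers the norm.\<close>

lemma psi_le_psi_pow: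
  assumes "1 < p"
  shows "\<psi> p \<le> psi_pow d \<psi> p"
proof -
  have "1 \<le> ennreal ((p / ln p) ^ d)"
    using one_le_power[OF one_le_divide_ln[OF assms], of d] by (subst ennreal_1[symmetric]) (rule ennreal_leI)
  then show ?thesis unfolding psi_pow_def using mult_right_mono[of 1 _ "\<psi> p"] by simp
qed

lemma ennreal_inverse_antimono: "x \<le> y \<Longrightarrow> inverse y \<le> inverse x" for x y :: ennreal
  unfolding less_eq_ennreal.rep_eq inverse_ennreal.rep_eq
  by (rule ereal_inverse_antimono) (rule enn2ereal_nonneg)

text \<open>The witness \<open>\<lambda>v. sqrt (moment_const b r d / v)\<close> divides the
  constant of the upper bound for squared norms by that of the lower bound for the variance. It is
  fixed before the probability space and the kernel, so it depends on them only through
  \<open>lead_var\<close>.\<close>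

theorem theorem3p1:
  fixes d r :: nat and b :: real and \<psi> :: "real \<Rightarrow> ennreal"
  assumes "1 \<le> r" and "r \<le> d - 1" and "2 < b" and "\<psi> \<in> Psi b"
  shows "\<exists>C :: real \<Rightarrow> real.
    \<forall>(M :: 'a measure) (S :: 'x measure) (\<xi> :: nat \<Rightarrow> 'a \<Rightarrow> 'x) (\<Phi> :: (nat \<Rightarrow> 'x) \<Rightarrow> real).
      iid_seq M S \<xi> \<longrightarrow> sym_kernel d S \<Phi> \<longrightarrow> has_rank M S d \<Phi> \<xi> r \<longrightarrow>
      prob_space.expectation M (at_sample d \<Phi> \<xi> (\<lambda>s. s)) = 0 \<longrightarrow>
      prob_space.variance M (at_sample d \<Phi> \<xi> (\<lambda>s. s)) = 1 \<longrightarrow>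
      at_sample d \<Phi> \<xi> (\<lambda>s. s) \<in> GLS M b \<psi> \<longrightarrow>
      (SUP n\<in>{d<..}. GLS_norm M b (psi_pow d \<psi>) (\<lambda>\<omega>. U_stat d \<Phi> \<xi> n \<omega> / sigma_U M d \<Phi> \<xi> n))
        \<le> ennreal (C (lead_var M S d \<Phi> \<xi> r))
           * GLS_norm M b \<psi> (at_sample d \<Phi> \<xi> (\<lambda>s. s))"
proof (intro exI[where x = "\<lambda>v. sqrt (moment_const b r d / v)"] allI impI)
  fix M :: "'a measure" and S :: "'x measure" and \<xi> :: "nat \<Rightarrow> 'a \<Rightarrow> 'x" and \<Phi> :: "(nat \<Rightarrow> 'x) \<Rightarrow> real"
  assume iid: "iid_seq M S \<xi>" and sym: "sym_kernel d S \<Phi>" and rank: "has_rank M S d \<Phi> \<xi> r"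
    and mean: "prob_space.expectation M (at_sample d \<Phi> \<xi> (\<lambda>s. s)) = 0"
    and "prob_space.variance M (at_sample d \<Phi> \<xi> (\<lambda>s. s)) = 1"
    and gls: "at_sample d \<Phi> \<xi> (\<lambda>s. s) \<in> GLS M b \<psi>"
  let ?f = "at_sample d \<Phi> \<xi> (\<lambda>s. s)" and ?v = "lead_var M S d \<Phi> \<xi> r"
  let ?U = "\<lambda>n \<omega>. U_stat d \<Phi> \<xi> n \<omega> / sigma_U M d \<Phi> \<xi> n"
  have d: "1 \<le> d" using assms(1,2) by simp
  interpret M: prob_space M using iid unfolding iid_seq_def by blast
  have "M.indep_vars (\<lambda>_. S) \<xi> {1..}" using iid unfolding iid_seq_def by blast
  then have \<xi>1: "\<xi> 1 \<in> M \<rightarrow>\<^sub>M S" unfolding M.indep_vars_def by auto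
  \<comment> \<open>Symmetry and measurability of the kernel involve only the measurable sets, which
    \<open>S\<close> shares with the law of \<open>\<xi> 1\<close>.\<close>
  have sets_eq: "sets (PiM {1..d} (\<lambda>_. distr M S (\<xi> 1))) = sets (PiM {1..d} (\<lambda>_. S))"
    by (intro sets_PiM_cong) auto
  have sym': "sym_kernel d (distr M S (\<xi> 1)) \<Phi>"
    using sym unfolding sym_kernel_def sets_eq_imp_space_eq[OF sets_eq] measurable_cong_sets[OF sets_eq refl] .
  \<comment> \<open>As \<open>\<psi> p\<close> is finite, an infinite moment would make the quotient
    infinite, so the finite norm forces finite moments.\<close>
  have fin: "Lp_norm M p ?f < \<infinity>" if p: "p \<in> {2..<b}" for p
  proof -
    have "Lp_norm M p ?f / \<psi> p \<le> GLS_norm M b \<psi> ?f"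
      unfolding GLS_norm_def using p by (rule SUP_upper)
    also have "\<dots> < \<infinity>" using gls by (simp add: GLS_def)
    finally have *: "Lp_norm M p ?f / \<psi> p < \<infinity>" .
    have "\<psi> p < \<infinity>" using assms(4) p by (auto simp: Psi_def)
    then have "Lp_norm M p ?f / \<psi> p = \<infinity>" if "Lp_norm M p ?f = \<infinity>"
      using that by (simp add: divide_ennreal_def ennreal_top_mult)
    then show ?thesis using * by (metis infinity_ennreal_def less_top)
  qed
  have f: "?f \<in> borel_measurable M" using gls by (simp add: GLS_def)
  have int: "integrable M (\<lambda>\<omega>. \<bar>?f \<omega>\<bar> powr p)" if "p \<in> {2..<b}" for p
    using integrable_if_Lp_norm_finite[OF f fin[OF that]] .
  interpret ranked_kernel M S \<xi> d \<Phi> r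
  proof -
    interpret prob_space "distr M S (\<xi> 1)" using \<xi>1 by (rule M.prob_space_distr)
    show "ranked_kernel M S \<xi> d \<Phi> r"
      by unfold_locales (use sym' iid d rank mean int[of 2] assms(3) in auto)
  qed
  have Lp_le: "Lp_norm M p (?U n) \<le> ennreal (sqrt (moment_const b r d / ?v)) * Lp_norm M p ?f"
    if p: "p \<in> {2..<b}" and n: "d < n" for p n
  proof -
    have p': "2 \<le> p" "p \<le> b" and n': "d \<le> n" using p n by auto
    have K: "0 \<le> moment_const b r d / ?v"
      using moment_const_nonneg[of b r d] lead_var_pos assms(3) by simp
    have "(\<integral>\<omega>. \<bar>?U n \<omega>\<bar> powr p \<partial>M) powr (1 / p)
        \<le> sqrt (moment_const b r d / ?v) * (\<integral>\<omega>. \<bar>?f \<omega>\<bar> powr p \<partial>M) powr (1 / p)"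
      using U_stat_moment_le(2)[OF p' n' int[OF p]] K p' by (intro powr_bound_root) auto
    then show ?thesis
      unfolding Lp_norm_eq[OF U_stat_moment_le(1)[OF p' n' int[OF p]]] Lp_norm_eq[OF int[OF p]]
      using K by (subst ennreal_mult[symmetric]) (auto intro: ennreal_leI)
  qed
  show "(SUP n\<in>{d<..}. GLS_norm M b (psi_pow d \<psi>) (?U n))
      \<le> ennreal (sqrt (moment_const b r d / ?v)) * GLS_norm M b \<psi> ?f"
  proof (rule SUP_least)
    fix n assume n: "n \<in> {d<..}"
    show "GLS_norm M b (psi_pow d \<psi>) (?U n) \<le> ennreal (sqrt (moment_const b r d / ?v)) * GLS_norm M b \<psi> ?f"
      unfolding GLS_norm_def[of M b "psi_pow d \<psi>"]
    proof (rule SUP_least)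
      fix p assume p: "p \<in> {2..<b}"
      have "Lp_norm M p (?U n) / psi_pow d \<psi> p
          \<le> (ennreal (sqrt (moment_const b r d / ?v)) * Lp_norm M p ?f) / \<psi> p"
        using Lp_le[OF p] n psi_le_psi_pow[of p \<psi> d] p
        unfolding divide_ennreal_def by (intro mult_mono ennreal_inverse_antimono) auto
      also have "\<dots> = ennreal (sqrt (moment_const b r d / ?v)) * (Lp_norm M p ?f / \<psi> p)"
        by (simp add: ennreal_times_divide)
      also have "\<dots> \<le> ennreal (sqrt (moment_const b r d / ?v)) * GLS_norm M b \<psi> ?f"
        unfolding GLS_norm_def using p by (intro mult_left_mono SUP_upper) auto
      finally show "Lp_norm M p (?U n) / psi_pow d \<psi> p
          \<le> ennreal (sqrt (moment_const b r d / ?v)) * GLS_norm M b \<psi> ?f" .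
    qed
  qed
qed

end
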